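(* Fix constants $\Gamma,\alpha,\nu>0$ and left data $\rho_0=1$, $u_0>0$, $e_0>0$. Let $\mathcal{C}_{u_0,e_0}\subset\mathbb{R}^2$ be the feasible set and $\Psi:\mathcal{C}_{u_0,e_0}\to(0,\infty)^2$ the Cauchy-to-boundary-value map, and let $\gamma(c):=\det d\Psi(c)$ for $c\in\mathcal{C}_{u_0,e_0}$. (1) If $\gamma$ does not vanish on $\mathcal{C}_{u_0,e_0}$, then solutions are globally unique: for every $(u_1,e_1)\in(0,\infty)^2$ the equation $\Psi(c)=(u_1,e_1)$ has at most one solution $c\in\mathcal{C}_{u_0,e_0}$. (2) If $\gamma$ changes sign on $\mathcal{C}_{u_0,e_0}$ (i.e. takes both strictly positive and strictly negative values there), then even local uniqueness is violated, i.e. there is a point of $\mathcal{C}_{u_0,e_0}$ having no neighborhood on which $\Psi$ is injective; in particular, there is at least one $(u_1,e_1)\in(0,\infty)^2$ for which $\Psi(c)=(u_1,e_1)$ has more than one solution $c\in\mathcal{C}_{u_0,e_0}$.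
   Context: For $c=(c_1,c_2)\in\mathbb{R}^2$ consider the profile initial value problem (on the domain $\{u>0\}$) $$\frac{\alpha}{u_0}u'=c_1+u+\Gamma\frac{e}{u},\qquad \frac{\nu}{u_0}e'=c_2-c_1u-\frac12u^2+e,\qquad u(0)=u_0,\ e(0)=e_0.$$ It is obtained by integrating once the steady 1D compressible Navier--Stokes equations of a polytropic gas, normalized so that $\rho(0)=\rho_0=1$ and with $\rho=u_0/u$. The feasible set $\mathcal{C}_{u_0,e_0}$ is the set of all $c\in\mathbb{R}^2$ for which this problem has a continuous solution $(u,e)$ on $[0,1]$ with $u>0$ and $e>0$ on $[0,1]$; it is an open set. The map $\Psi$ is defined by $\Psi(c)=(u,e)(1)$, where $(u,e)$ is the maximal solution of the problem for the given $c$. Solutions $c$ of $\Psi(c)=(u_1,e_1)$ correspond to steady solutions on $[0,1]$ with boundary data $(\rho,u,e)(0)=(1,u_0,e_0)$, $(u,e)(1)=(u_1,e_1)$. *)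

theory Defs
  imports "HOL-Analysis.Analysis"
begin

text \<open>The solution is only required on the interval \<open>I\<close>; one-sided derivatives are meant at endpoints
  of \<open>I\<close> that belong to \<open>I\<close>. The equations are solved for the derivatives. The phase domain is
  \<open>{u > 0}\<close>; no sign is imposed on \<open>e\<close> here.\<close>

definition profile_solution ::
  "real \<Rightarrow> real \<Rightarrow> real \<Rightarrow> real \<Rightarrow> real \<Rightarrow> real^2 \<Rightarrow> real set \<Rightarrow> (real \<Rightarrow> real) \<Rightarrow> (real \<Rightarrow> real) \<Rightarrow> bool"
where
  "profile_solution \<Gamma> \<alpha> \<nu> u0 e0 c I u e \<longleftrightarrow>
     is_interval I \<and> 0 \<in> I \<and> u 0 = u0 \<and> e 0 = e0 \<and>
     (\<forall>x\<in>I. u x > 0 \<and>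
        (u has_real_derivative (u0 / \<alpha> * (c$1 + u x + \<Gamma> * (e x / u x)))) (at x within I) \<and>
        (e has_real_derivative (u0 / \<nu> * (c$2 - c$1 * u x - 1/2 * (u x)^2 + e x))) (at x within I))"

definition maximal_profile_solution ::
  "real \<Rightarrow> real \<Rightarrow> real \<Rightarrow> real \<Rightarrow> real \<Rightarrow> real^2 \<Rightarrow> real set \<Rightarrow> (real \<Rightarrow> real) \<Rightarrow> (real \<Rightarrow> real) \<Rightarrow> bool"
where
  "maximal_profile_solution \<Gamma> \<alpha> \<nu> u0 e0 c I u e \<longleftrightarrow>
     profile_solution \<Gamma> \<alpha> \<nu> u0 e0 c I u e \<and>
     (\<forall>J v w. profile_solution \<Gamma> \<alpha> \<nu> u0 e0 c J v w \<and> I \<subseteq> J \<and>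
        (\<forall>x\<in>I. v x = u x \<and> w x = e x) \<longrightarrow> J = I)"

definition feasible_set :: "real \<Rightarrow> real \<Rightarrow> real \<Rightarrow> real \<Rightarrow> real \<Rightarrow> (real^2) set" where
  "feasible_set \<Gamma> \<alpha> \<nu> u0 e0 =
     {c. \<exists>u e. profile_solution \<Gamma> \<alpha> \<nu> u0 e0 c {0..1} u e \<and> (\<forall>x\<in>{0..1}. e x > 0)}"

text \<open>The map \<open>\<Psi>\<close>. Its value is meaningful only when the maximal solution reaches \<open>x = 1\<close>, in
  particular on the feasible set.\<close>

definition cauchy_to_boundary :: "real \<Rightarrow> real \<Rightarrow> real \<Rightarrow> real \<Rightarrow> real \<Rightarrow> real^2 \<Rightarrow> real^2" where
  "cauchy_to_boundary \<Gamma> \<alpha> \<nu> u0 e0 c =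
     (THE b. \<exists>I u e. maximal_profile_solution \<Gamma> \<alpha> \<nu> u0 e0 c I u e \<and> 1 \<in> I \<and> b = vector [u 1, e 1])"

definition profile_jacobian_det :: "real \<Rightarrow> real \<Rightarrow> real \<Rightarrow> real \<Rightarrow> real \<Rightarrow> real^2 \<Rightarrow> real" where
  "profile_jacobian_det \<Gamma> \<alpha> \<nu> u0 e0 c = det (jacobian (cauchy_to_boundary \<Gamma> \<alpha> \<nu> u0 e0) (at c))"

end

(*
For u, e > 0 the energy w = nu e + alpha u^2/2 satisfies w' = u0 (c2 + u^2/2 + (1 + Gamma) e), which
does not involve c1. It gives a priori bounds on c, u and e in terms of the end values, and with them
the map Psi from the feasible set C to the open quadrant Q is proper: in a limit of feasible solutions
u can only vanish together with e, which forces c2 = 0 and w nondecreasing, and a zero of e alone is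
excluded by e'' < 0 or by uniqueness.

Suppose Psi is locally injective. By invariance of domain and properness each component of C is mapped
onto Q. As the end value of u tends to 0 with the end value of e fixed and large, every preimage enters
a region where c1 is very negative and c2 positive, which is convex and contained in C; so C is
connected. Then Psi is a covering of the simply connected set Q, hence injective.

Part (1) follows because Psi is strictly differentiable, so that gamma(c) /= 0 makes it injective near c.
For part (2), an injective continuous planar map on a connected open set has a constant winding number
along small circles, which is the sign of its Jacobian determinant wherever that is nonzero.
*)

theory Submission
  imports Defs "HOL-Complex_Analysis.Great_Picard"
begin

section \<open>Ordinary differential equations\<close>

text \<open>The obstacle is the quotient e/u. The right-hand side is Lipschitz only on bounded boxes
  away from u = 0, and limits of feasible solutions might run into that singular line. Within such a
  box, the nearest-point projection onto it makes the system globally Lipschitz; a tube estimate or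
  an a priori bound then shows that the projection never acts. For limits, z = u^2 gives a
  right-hand side that is continuous up to z = 0 but contains sqrt z, so convergence comes from
  compactness of the set of solutions and not from continuous dependence. Connectedness of C is a
  separate issue, because the covering argument alone would allow two components, each mapped onto
  Q. A single fibre lying in a connected subset of C excludes this. A large end value of e forces c2
  > 0, since c2 <= 0 caps the energy by a constant of the left data. A small end value of u forces
  c1 to be very negative, since a positive e pushes a small u upwards.\<close>

lemma gronwall_norm:
  fixes D :: "real \<Rightarrow> 'a::real_inner"
  assumes der: "\<And>t. t \<in> {0..T} \<Longrightarrow> (D has_vector_derivative D' t) (at t within {0..T})"
    and le: "\<And>t. t \<in> {0..T} \<Longrightarrow> norm (D' t) \<le> K * norm (D t) + \<beta>"
    and D0: "D 0 = 0" and \<beta>: "0 \<le> \<beta>" and K: "0 \<le> K" and t: "t \<in> {0..T}"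
  shows "norm (D t) \<le> \<beta> * exp ((K + 1) * t)"
proof -
  \<comment> \<open>The squared norm is differentiable even where \<open>D\<close> vanishes. By 2
    |D| beta <= |D|^2 + beta^2 its derivative is at most (2K+1) (|D|^2 + beta^2), which the
    exponential factor absorbs; adding beta^2 makes the inequality homogeneous.\<close>
  define N where "N t = (D t \<bullet> D t + \<beta>\<^sup>2) * exp (- (2 * K + 1) * t)" for t
  have "N t \<le> N 0"
  proof (rule DERIV_nonpos_imp_decreasing_open[of 0 t N])
    show "0 \<le> t" using t by simp
  next
    show "continuous_on {0..t} N"
    proof -
      have "continuous_on {0..T} D"
        using der by (meson continuous_on_eq_continuous_within has_vector_derivative_continuous)
      then have "continuous_on {0..t} D" using t by (auto intro: continuous_on_subset)
      then show ?thesis unfolding N_def by (intro continuous_intros)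
    qed
  next
    fix s assume s: "0 < s" "s < t"
    then have sT: "s \<in> {0..T}" "s \<in> interior {0..T}" using t by auto
    then have d: "(D has_vector_derivative D' s) (at s)"
      using der[of s] by (metis at_within_interior)
    have 1: "((\<lambda>t. D t \<bullet> D t) has_real_derivative 2 * (D s \<bullet> D' s)) (at s)"
      using d unfolding has_vector_derivative_def has_field_derivative_def
      by (auto intro!: derivative_eq_intros simp: inner_commute algebra_simps fun_eq_iff)
    have 2: "(N has_real_derivative (2 * (D s \<bullet> D' s) - (2*K+1) * (D s \<bullet> D s + \<beta>\<^sup>2)) * exp (- (2 * K + 1) * s)) (at s)"
      unfolding N_def
      by (rule 1 derivative_eq_intros refl | simp add: algebra_simps)+
    have "D s \<bullet> D' s \<le> norm (D s) * (K * norm (D s) + \<beta>)"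
      using norm_cauchy_schwarz[of "D s" "D' s"] le[OF sT(1)] mult_left_mono[OF le[OF sT(1)] norm_ge_zero[of "D s"]] by linarith
    moreover have "2 * (norm (D s) * \<beta>) \<le> (norm (D s))\<^sup>2 + \<beta>\<^sup>2"
      using sum_squares_bound[of "norm (D s)" \<beta>] by (simp add: algebra_simps)
    ultimately have "2 * (D s \<bullet> D' s) \<le> (2*K+1) * (D s \<bullet> D s) + \<beta>\<^sup>2"
      by (simp add: power2_norm_eq_inner[symmetric] algebra_simps power2_eq_square)
    moreover have "(2*K+1) * \<beta>\<^sup>2 \<ge> \<beta>\<^sup>2" using K mult_right_mono[of 1 "2*K+1" "\<beta>\<^sup>2"] by simp
    ultimately have "2 * (D s \<bullet> D' s) - (2*K+1) * (D s \<bullet> D s + \<beta>\<^sup>2) \<le> 0"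
      by (simp add: algebra_simps)
    then show "\<exists>y. (N has_real_derivative y) (at s) \<and> y \<le> 0"
      using 2 by (meson exp_ge_zero mult_nonpos_nonneg)
  qed
  then have "(norm (D t))\<^sup>2 * exp (- (2 * K + 1) * t) \<le> \<beta>\<^sup>2"
    unfolding N_def by (simp add: D0 power2_norm_eq_inner algebra_simps)
      (smt (verit) exp_gt_zero zero_le_mult_iff zero_le_power2)
  then have "(norm (D t))\<^sup>2 * exp (- (2 * K + 1) * t) * exp ((2 * K + 1) * t) \<le> \<beta>\<^sup>2 * exp ((2 * K + 1) * t)"
    by (intro mult_right_mono) auto
  also have "(norm (D t))\<^sup>2 * exp (- (2 * K + 1) * t) * exp ((2 * K + 1) * t) = (norm (D t))\<^sup>2"
    by (simp add: mult.assoc exp_add[symmetric] algebra_simps)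
  also have "\<beta>\<^sup>2 * exp ((2 * K + 1) * t) \<le> \<beta>\<^sup>2 * exp (2 * ((K + 1) * t))"
    using t by (intro mult_left_mono) (auto simp: algebra_simps)
  also have "\<dots> = (\<beta> * exp ((K + 1) * t))\<^sup>2"
    by (simp add: power_mult_distrib exp_double)
  finally show ?thesis
    using \<beta> by (meson exp_ge_zero mult_nonneg_nonneg power2_le_imp_le)
qed

theorem lipschitz_ode_solution:
  fixes F :: "real \<Rightarrow> 'a::euclidean_space \<Rightarrow> 'a" and L :: real
  assumes cont: "continuous_on ({0..1} \<times> UNIV) (\<lambda>(t, x). F t x)"
    and lip: "\<And>t x y. t \<in> {0..1} \<Longrightarrow> norm (F t x - F t y) \<le> L * norm (x - y)"
  obtains X where "X 0 = a"
    "\<And>t. t \<in> {0..1} \<Longrightarrow> (X has_vector_derivative F t (X t)) (at t within {0..1})"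
proof -
  txt \<open>Picard iteration, written for \<open>exp (- 2 M t) X t\<close>, contracts the sup norm.\<close>
  define M where "M = \<bar>L\<bar> + 1"
  have M: "M > 0" "L \<le> M" unfolding M_def by auto
  \<comment> \<open>Bounded continuous functions form a type with domain all of R, so time is
    clamped to [0,1]; the iterates \<open>T0 g\<close> take all their values there and are bounded
    by compactness.\<close>
  define cl where "cl t = max 0 (min 1 t)" for t :: real
  have cl: "cl t \<in> {0..1}" for t unfolding cl_def by auto
  have cl_id: "t \<in> {0..1} \<Longrightarrow> cl t = t" for t unfolding cl_def by auto
  have cont_cl: "continuous_on S cl" for S unfolding cl_def by (intro continuous_intros)
  define H where "H g s = F s (exp (2 * M * s) *\<^sub>R apply_bcontfun g s)" for g :: "real \<Rightarrow>\<^sub>C 'a" and s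
  define T0 where "T0 g t = exp (- 2 * M * cl t) *\<^sub>R (a + integral {0..cl t} (H g))" for g t
  have contg: "continuous_on S (apply_bcontfun g)" for S and g :: "real \<Rightarrow>\<^sub>C 'a"
    by (meson continuous_on_apply_bcontfun continuous_on_subset top_greatest)
  have contH: "continuous_on {0..1} (H g)" for g
    unfolding H_def
    by (rule continuous_on_compose2[OF cont, of _ "\<lambda>s. (s, exp (2 * M * s) *\<^sub>R apply_bcontfun g s)", simplified])
      (auto intro!: continuous_intros contg)
  have contI: "continuous_on {0..1} (\<lambda>t. integral {0..t} (H g))" for g
    by (rule indefinite_integral_continuous_1[OF integrable_continuous_interval[OF contH]])
  have contT: "continuous_on UNIV (T0 g)" for g
    unfolding T0_def
    by (intro continuous_intros continuous_on_compose2[OF contI cont_cl] cont_cl) (use cl in auto)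
  have T_bcont: "T0 g \<in> bcontfun" for g
  proof -
    have "T0 g ` UNIV \<subseteq> T0 g ` {0..1}"
    proof safe
      fix t show "T0 g t \<in> T0 g ` {0..1}"
        using cl[of t] cl_id[OF cl[of t]] by (intro image_eqI[of _ _ "cl t"]) (auto simp: T0_def)
    qed
    moreover have "compact (T0 g ` {0..1})"
      by (intro compact_continuous_image continuous_on_subset[OF contT]) auto
    ultimately show ?thesis
      unfolding bcontfun_def using contT by (auto intro: bounded_subset compact_imp_bounded)
  qed
  define T where "T g = Bcontfun (T0 g)" for g
  have T: "apply_bcontfun (T g) = T0 g" for g
    unfolding T_def using T_bcont Bcontfun_inverse by blast
  have contr: "dist (T g) (T h) \<le> 1/2 * dist g h" for g h
  proof (rule dist_bound)
    fix t0 :: real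
    define t where "t = cl t0"
    have t: "t \<in> {0..1}" unfolding t_def by (rule cl)
    have int: "H g integrable_on {0..t}" "H h integrable_on {0..t}"
      using t by (auto intro!: integrable_continuous_interval intro: continuous_on_subset[OF contH])
    have bd: "norm (H g s - H h s) \<le> M * exp (2 * M * s) * dist g h" if "s \<in> {0..t}" for s
    proof -
      have "norm (H g s - H h s) \<le> L * norm (exp (2 * M * s) *\<^sub>R g s - exp (2 * M * s) *\<^sub>R h s)"
        unfolding H_def using that t by (intro lip) auto
      also have "\<dots> = L * (exp (2 * M * s) * norm (g s - h s))"
        by (simp flip: scaleR_diff_right)
      also have "\<dots> \<le> M * (exp (2 * M * s) * dist g h)"
        using M dist_bounded[of g s h] by (intro mult_mono) (auto simp: dist_norm)
      finally show ?thesis by (simp add: mult.assoc)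
    qed
    \<comment> \<open>The weight exp (2 M s) integrates to exp (2 M t) / (2 M) up to a constant;
      against the Lipschitz constant M this leaves the contraction factor 1/2.\<close>
    have hi: "((\<lambda>s. M * exp (2 * M * s) * dist g h) has_integral
        (exp (2 * M * t) * dist g h / 2 - exp (2 * M * 0) * dist g h / 2)) {0..t}"
    proof (rule fundamental_theorem_of_calculus)
      show "0 \<le> t" using t by simp
      fix s
      have "((\<lambda>t. exp (2 * M * t) * dist g h / 2) has_real_derivative M * exp (2 * M * s) * dist g h) (at s within {0..t})"
        by (auto intro!: derivative_eq_intros)
      then show "((\<lambda>t. exp (2 * M * t) * dist g h / 2) has_vector_derivative M * exp (2 * M * s) * dist g h) (at s within {0..t})"
        by (simp add: has_real_derivative_iff_has_vector_derivative)
    qed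
    have "norm (integral {0..t} (H g) - integral {0..t} (H h)) = norm (integral {0..t} (\<lambda>s. H g s - H h s))"
      using int by (simp add: integral_diff)
    also have "\<dots> \<le> integral {0..t} (\<lambda>s. M * exp (2 * M * s) * dist g h)"
      using int hi bd by (intro integral_norm_bound_integral integrable_diff) auto
    also have "\<dots> \<le> exp (2 * M * t) * dist g h / 2"
      using integral_unique[OF hi] by simp
    finally have I: "norm (integral {0..t} (H g) - integral {0..t} (H h)) \<le> exp (2 * M * t) * dist g h / 2" .
    have "dist (T g t0) (T h t0) = exp (-2 * M * t) * norm (integral {0..t} (H g) - integral {0..t} (H h))"
      by (simp add: T T0_def dist_norm t_def flip: scaleR_diff_right)
    also have "\<dots> \<le> exp (-2 * M * t) * (exp (2 * M * t) * dist g h / 2)"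
      using I by (intro mult_left_mono) auto
    also have "\<dots> = 1/2 * dist g h"
      by (simp add: exp_minus field_simps)
    finally show "dist (T g t0) (T h t0) \<le> 1/2 * dist g h" .
  qed
  obtain g where g: "T g = g"
    using banach_fix_type[of "1/2" T] contr by auto
  define X where "X t = exp (2 * M * t) *\<^sub>R g t" for t
  have HX: "H g s = F s (X s)" for s by (simp add: H_def X_def)
  have Xint: "X t = a + integral {0..t} (H g)" if "t \<in> {0..1}" for t
  proof -
    have "g t = exp (- 2 * M * t) *\<^sub>R (a + integral {0..t} (H g))"
      using that by (metis g T T0_def cl_id)
    then show ?thesis by (simp add: X_def exp_minus)
  qed
  show thesis
  proof
    show "X 0 = a" by (simp add: Xint)
    fix t :: real assume t: "t \<in> {0..1}"
    have "((\<lambda>u. integral {0..u} (H g)) has_vector_derivative H g t) (at t within {0..1})"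
      by (rule integral_has_vector_derivative[OF contH t])
    then have "((\<lambda>u. a + integral {0..u} (H g)) has_vector_derivative F t (X t)) (at t within {0..1})"
      by (auto intro!: derivative_eq_intros simp: HX)
    then show "(X has_vector_derivative F t (X t)) (at t within {0..1})"
      by (rule has_vector_derivative_transform[OF t, rotated]) (simp add: Xint)
  qed
qed

lemma continuous_on_solution:
  assumes "\<And>t. t \<in> S \<Longrightarrow> (X has_vector_derivative X' t) (at t within S)"
  shows "continuous_on S X"
  using assms by (meson continuous_on_eq_continuous_within has_vector_derivative_continuous)

text \<open>The nearest-point projection onto a closed convex set is 1-Lipschitz, so composing with
  it makes a field that is Lipschitz on \<open>K\<close> globally Lipschitz with the same constant.
  The solution solves the original equation as long as it stays in \<open>K\<close>.\<close>

lemma truncated_solution: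
  fixes G :: "'a::euclidean_space \<Rightarrow> 'a"
  assumes K: "convex K" "closed K" "K \<noteq> {}"
    and lip: "\<And>x y. x \<in> K \<Longrightarrow> y \<in> K \<Longrightarrow> norm (G x - G y) \<le> L * norm (x - y)"
    and L: "0 \<le> L"
  obtains X where "X 0 = a"
    "\<And>t. t \<in> {0..1} \<Longrightarrow> (X has_vector_derivative G (closest_point K (X t))) (at t within {0..1})"
proof -
  let ?F = "\<lambda>x. G (closest_point K x)"
  have F: "norm (?F x - ?F y) \<le> L * norm (x - y)" for x y
  proof -
    have "norm (?F x - ?F y) \<le> L * norm (closest_point K x - closest_point K y)"
      using K by (intro lip closest_point_in_set)
    also have "\<dots> \<le> L * norm (x - y)"
      using closest_point_lipschitz[OF K, of x y] L by (intro mult_left_mono) (auto simp: dist_norm)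
    finally show ?thesis .
  qed
  have "L-lipschitz_on UNIV ?F"
    using F L by (intro lipschitz_onI) (auto simp: dist_norm)
  then have "continuous_on UNIV ?F" by (rule lipschitz_on_continuous_on)
  then have "continuous_on ({0..1::real} \<times> UNIV) (\<lambda>(t, x). ?F x)"
    unfolding split_def by (rule continuous_on_compose2) (auto intro: continuous_intros)
  from lipschitz_ode_solution[of "\<lambda>_. ?F", OF this F, of a] show thesis
    using that by blast
qed

text \<open>A bootstrap: while the truncated solution is in \<open>K'\<close> it solves the true
  equation, so the a priori bound puts it into \<open>K\<close>. As \<open>K\<close> lies in the
  interior of \<open>K'\<close>, it then stays in \<open>K'\<close> a little longer, and the
  supremum of the times up to which it remains in \<open>K\<close> must be 1.\<close>

lemma continuation:
  fixes G :: "'a::euclidean_space \<Rightarrow> 'a"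
  assumes K': "convex K'" "closed K'"
    and K: "closed K" "K \<subseteq> interior K'" "a \<in> K"
    and lip: "\<And>x y. x \<in> K' \<Longrightarrow> y \<in> K' \<Longrightarrow> norm (G x - G y) \<le> L * norm (x - y)"
    and L: "0 \<le> L"
    and apriori: "\<And>T X t. T \<in> {0..1} \<Longrightarrow> X 0 = a \<Longrightarrow>
      (\<And>t. t \<in> {0..T} \<Longrightarrow> X t \<in> K' \<and> (X has_vector_derivative G (X t)) (at t within {0..T})) \<Longrightarrow>
      t \<in> {0..T} \<Longrightarrow> X t \<in> K"
  obtains X where "X 0 = a"
    "\<And>t. t \<in> {0..1} \<Longrightarrow> X t \<in> K \<and> (X has_vector_derivative G (X t)) (at t within {0..1})"
proof -
  have KK': "K \<subseteq> K'" using K(2) interior_subset by blast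
  then have ne: "K' \<noteq> {}" using K by blast
  obtain X where X: "X 0 = a"
    "\<And>t. t \<in> {0..1} \<Longrightarrow> (X has_vector_derivative G (closest_point K' (X t))) (at t within {0..1})"
    using truncated_solution[OF K' ne lip L] by blast
  have cont: "continuous_on {0..1} X" using X(2) by (rule continuous_on_solution)
  have der: "(X has_vector_derivative G (X t)) (at t within {0..T})"
    if "T \<in> {0..1}" "t \<in> {0..T}" "X t \<in> K'" for t T
  proof -
    have "closest_point K' (X t) = X t" using that(3) by (rule closest_point_self)
    then show ?thesis
      using X(2)[of t] that by (auto intro: has_vector_derivative_within_subset[of _ _ _ "{0..1}"])
  qed
  define S where "S = {t \<in> {0..1}. \<forall>s\<in>{0..t}. X s \<in> K}"
  define T where "T = Sup S"
  have S0: "0 \<in> S" using X(1) K(3) by (simp add: S_def)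
  have bdd: "bdd_above S" by (rule bdd_aboveI[of _ 1]) (auto simp: S_def)
  have T: "T \<in> {0..1}"
    using S0 bdd unfolding T_def by (auto intro: cSup_upper intro!: cSup_least simp: S_def)
  have below: "X s \<in> K" if s: "s \<in> {0..<T}" for s
  proof -
    obtain t where "t \<in> S" "s < t" using less_cSup_iff[of S s] S0 bdd s unfolding T_def by auto
    then show ?thesis using s by (auto simp: S_def)
  qed
  have TK: "X s \<in> K" if s: "s \<in> {0..T}" for s
  proof (cases "T = 0")
    case True then show ?thesis using that X(1) K(3) by simp
  next
    case False
    then have cl: "closure {0..<T} = {0..T}" using T by simp
    have "X ` closure {0..<T} \<subseteq> K"
    proof (rule image_closure_subset)
      show "continuous_on (closure {0..<T}) X"
        unfolding cl using T by (intro continuous_on_subset[OF cont]) auto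
      show "X ` {0..<T} \<subseteq> K" using below by blast
    qed (rule K(1))
    then show ?thesis using s cl by auto
  qed
  have "T = 1"
  proof (rule ccontr)
    assume "T \<noteq> 1"
    then have T1: "T < 1" using T by simp
    have "X T \<in> interior K'" using TK[of T] T K(2) by auto
    then obtain e where e: "e > 0" "ball (X T) e \<subseteq> K'"
      by (meson mem_interior)
    obtain d where d: "d > 0" "\<And>s. s \<in> {0..1} \<Longrightarrow> dist s T < d \<Longrightarrow> dist (X s) (X T) < e"
      using cont T e(1) unfolding continuous_on_iff by blast
    define T' where "T' = min 1 (T + d/2)"
    have T': "T' \<in> {0..1}" "T < T'" using T T1 d(1) by (auto simp: T'_def)
    have "X s \<in> K'" if "s \<in> {0..T'}" for s
    proof (cases "s \<le> T")
      case True then show ?thesis using TK[of s] that KK' by auto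
    next
      case False
      then have "dist s T < d" using that d(1) by (auto simp: T'_def dist_real_def)
      then have "X s \<in> ball (X T) e" using d(2)[of s] that T' by (auto simp: dist_commute)
      then show ?thesis using e by blast
    qed
    then have "\<And>s. s \<in> {0..T'} \<Longrightarrow> X s \<in> K"
      using apriori[of T' X] T'(1) X(1) der[OF T'(1)] by blast
    then have "T' \<in> S" using T' by (simp add: S_def)
    then have "T' \<le> T" unfolding T_def using bdd by (rule cSup_upper)
    then show False using T' by simp
  qed
  then have "X t \<in> K" if "t \<in> {0..1}" for t using TK that by simp
  then show thesis
    using that[of X] X(1) der[of 1] KK' by (simp add: subset_iff)
qed

text \<open>Gronwall compares the truncated solution for \<open>c\<close> with \<open>X0\<close>,
  which the projection fixes. The bound is within the tube radius \<open>\<eta>\<close>, and the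
  tube lies in \<open>K\<close>, so the truncation never acts.\<close>

lemma perturbed_solution:
  fixes G :: "'c::metric_space \<Rightarrow> 'a::euclidean_space \<Rightarrow> 'a"
  assumes K: "convex K" "closed K"
    and lip: "\<And>x y. x \<in> K \<Longrightarrow> y \<in> K \<Longrightarrow> norm (G c x - G c y) \<le> L * norm (x - y)"
    and L: "0 \<le> L"
    and X0: "\<And>t. t \<in> {0..1} \<Longrightarrow> (X0 has_vector_derivative G c0 (X0 t)) (at t within {0..1})"
    and in_K: "\<And>t. t \<in> {0..1} \<Longrightarrow> cball (X0 t) \<eta> \<subseteq> K" and \<eta>: "0 < \<eta>"
    and close: "\<And>x. x \<in> K \<Longrightarrow> norm (G c x - G c0 x) \<le> \<beta>"
    and \<beta>: "\<beta> * exp (L + 1) \<le> \<eta>"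
  obtains X where "X 0 = X0 0"
    "\<And>t. t \<in> {0..1} \<Longrightarrow> (X has_vector_derivative G c (X t)) (at t within {0..1})"
    "\<And>t. t \<in> {0..1} \<Longrightarrow> norm (X t - X0 t) \<le> \<beta> * exp (L + 1)"
proof -
  have X0K: "X0 t \<in> K" if "t \<in> {0..1}" for t
    using in_K[OF that] \<eta> by (auto simp: subset_iff)
  have \<beta>0: "0 \<le> \<beta>" using close[OF X0K[of 0]] by (smt (verit) atLeastAtMost_iff norm_ge_zero)
  have ne: "K \<noteq> {}" using X0K[of 0] by auto
  obtain X where X: "X 0 = X0 0"
    "\<And>t. t \<in> {0..1} \<Longrightarrow> (X has_vector_derivative G c (closest_point K (X t))) (at t within {0..1})"
    using truncated_solution[OF K ne lip L] by blast
  have bound: "norm (X t - X0 t) \<le> \<beta> * exp (L + 1)" if t: "t \<in> {0..1}" for t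
  proof -
    have "norm (X t - X0 t) \<le> \<beta> * exp ((L + 1) * t)"
    proof (rule gronwall_norm[OF _ _ _ \<beta>0 L t])
      fix s :: real assume s: "s \<in> {0..1}"
      show "((\<lambda>t. X t - X0 t) has_vector_derivative G c (closest_point K (X s)) - G c0 (X0 s)) (at s within {0..1})"
        using X(2)[OF s] X0[OF s] by (rule has_vector_derivative_diff)
      have "norm (G c (closest_point K (X s)) - G c (X0 s)) \<le> L * norm (closest_point K (X s) - X0 s)"
        using K ne X0K[OF s] by (intro lip closest_point_in_set)
      also have "\<dots> \<le> L * norm (X s - X0 s)"
        using closest_point_lipschitz[OF K ne, of "X s" "X0 s"] closest_point_self[OF X0K[OF s]] L
        by (intro mult_left_mono) (auto simp: dist_norm)
      finally show "norm (G c (closest_point K (X s)) - G c0 (X0 s)) \<le> L * norm (X s - X0 s) + \<beta>"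
        using close[OF X0K[OF s]]
          norm_triangle_ineq[of "G c (closest_point K (X s)) - G c (X0 s)" "G c (X0 s) - G c0 (X0 s)"]
        by simp
    qed (simp add: X(1))
    also have "\<dots> \<le> \<beta> * exp (L + 1)"
      using t L \<beta>0 by (intro mult_left_mono) (auto intro: mult_left_le)
    finally show ?thesis .
  qed
  have "X t \<in> K" if "t \<in> {0..1}" for t
    using in_K[OF that] bound[OF that] \<beta> by (auto simp: subset_iff dist_norm norm_minus_commute)
  then have "(X has_vector_derivative G c (X t)) (at t within {0..1})" if "t \<in> {0..1}" for t
    using X(2)[OF that] closest_point_self that by metis
  then show thesis using that X(1) bound by blast
qed

text \<open>The derivative is the time-one map of the linearised equation y' = A y + B d. Gronwall
  is used twice: for a Lipschitz bound of the solutions in the parameter, and then for the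
  remainder. Both parameters vary in the conclusion, so that local injectivity can be read off at
  one point.\<close>

theorem solution_strict_derivative:
  fixes G :: "'c::euclidean_space \<Rightarrow> 'a::euclidean_space \<Rightarrow> 'a"
    and A :: "real \<Rightarrow> 'a \<Rightarrow> 'a" and B :: "real \<Rightarrow> 'c \<Rightarrow> 'a"
  assumes sol: "\<And>c t. c \<in> U \<Longrightarrow> t \<in> {0..1} \<Longrightarrow>
      (X c has_vector_derivative G c (X c t)) (at t within {0..1})"
    and init: "\<And>c. c \<in> U \<Longrightarrow> X c 0 = a"
    and U: "open U" "c0 \<in> U"
    and close: "\<And>\<epsilon>. \<epsilon> > 0 \<Longrightarrow> \<exists>\<rho>>0. \<forall>c\<in>U. dist c0 c < \<rho> \<longrightarrow> (\<forall>t\<in>{0..1}. dist (X c0 t) (X c t) < \<epsilon>)"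
    and linA: "\<And>t. t \<in> {0..1} \<Longrightarrow> linear (A t)"
    and linB: "\<And>t. t \<in> {0..1} \<Longrightarrow> linear (B t)"
    and boundA: "\<And>t x. t \<in> {0..1} \<Longrightarrow> norm (A t x) \<le> M * norm x"
    and boundB: "\<And>t d. t \<in> {0..1} \<Longrightarrow> norm (B t d) \<le> M * norm d"
    and contA: "continuous_on ({0..1} \<times> UNIV) (\<lambda>(t, x). A t x)"
    and contB: "\<And>d. continuous_on {0..1} (\<lambda>t. B t d)"
    and strict: "\<And>\<epsilon>. \<epsilon> > 0 \<Longrightarrow> \<exists>\<rho>>0. \<forall>t\<in>{0..1}. \<forall>c c' x x'.
        dist c0 c < \<rho> \<longrightarrow> dist c0 c' < \<rho> \<longrightarrow> dist (X c0 t) x < \<rho> \<longrightarrow> dist (X c0 t) x' < \<rho> \<longrightarrow>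
        norm (G c' x' - G c x - (A t (x' - x) + B t (c' - c))) \<le> \<epsilon> * (norm (x' - x) + norm (c' - c))"
  obtains Y where "linear Y"
    "\<And>\<epsilon>. \<epsilon> > 0 \<Longrightarrow> \<exists>\<rho>>0. \<forall>c c'. dist c0 c < \<rho> \<longrightarrow> dist c0 c' < \<rho> \<longrightarrow>
        norm (X c' 1 - X c 1 - Y (c' - c)) \<le> \<epsilon> * norm (c' - c)"
proof -
  define M' where "M' = \<bar>M\<bar>"
  have M': "0 \<le> M'" by (simp add: M'_def)
  have boundA': "norm (A t x) \<le> M' * norm x" and boundB': "norm (B t d) \<le> M' * norm d"
    if "t \<in> {0..1}" for t x d
    unfolding M'_def
    by (rule order_trans[OF boundA[OF that]] order_trans[OF boundB[OF that]], simp add: mult_right_mono)+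
  have "\<exists>y. y 0 = 0 \<and> (\<forall>t\<in>{0..1}. (y has_vector_derivative A t (y t) + B t b) (at t within {0..1}))" for b
  proof -
    have cont: "continuous_on ({0..1} \<times> UNIV) (\<lambda>(t, x). A t x + B t b)"
      unfolding split_def
      by (intro continuous_intros continuous_on_compose2[OF contB] contA[unfolded split_def]) auto
    have "norm (A t x + B t b - (A t y + B t b)) \<le> M' * norm (x - y)" if "t \<in> {0..1}" for t x y
      using boundA'[OF that, of "x - y"] by (simp add: linear_diff[OF linA[OF that]])
    from lipschitz_ode_solution[OF cont this, of 0] show ?thesis by metis
  qed
  then obtain y where y: "\<And>b. y b 0 = 0"
    "\<And>b t. t \<in> {0..1} \<Longrightarrow> (y b has_vector_derivative A t (y b t) + B t b) (at t within {0..1})"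
    by metis
  \<comment> \<open>Superposing the solutions for the basis vectors makes linearity in
    \<open>d\<close> immediate, without an appeal to uniqueness for the linear equation.\<close>
  define Y where "Y t d = (\<Sum>b\<in>Basis. (d \<bullet> b) *\<^sub>R y b t)" for t d
  have linY: "linear (Y 1)"
    unfolding Y_def by (rule linearI) (simp_all add: inner_add_left scaleR_add_left sum.distrib scaleR_sum_right)
  have derY: "((\<lambda>t. Y t d) has_vector_derivative A t (Y t d) + B t d) (at t within {0..1})"
    if t: "t \<in> {0..1}" for t d
  proof -
    have "((\<lambda>t. Y t d) has_vector_derivative (\<Sum>b\<in>Basis. (d \<bullet> b) *\<^sub>R (A t (y b t) + B t b))) (at t within {0..1})"
      unfolding Y_def
      by (intro has_vector_derivative_sum bounded_linear.has_vector_derivative[OF bounded_linear_scaleR_right] y t)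
    also have "(\<Sum>b\<in>Basis. (d \<bullet> b) *\<^sub>R (A t (y b t) + B t b)) = A t (Y t d) + B t (\<Sum>b\<in>Basis. (d \<bullet> b) *\<^sub>R b)"
      unfolding Y_def
      by (simp add: linear_sum[OF linA[OF t]] linear_sum[OF linB[OF t]] linear_cmul[OF linA[OF t]]
          linear_cmul[OF linB[OF t]] scaleR_add_right sum.distrib)
    finally show ?thesis by (simp add: euclidean_representation)
  qed
  have Y0: "Y 0 d = 0" for d by (simp add: Y_def y)
  have near: "\<exists>\<rho>>0. \<forall>c. dist c0 c < \<rho> \<longrightarrow> c \<in> U \<and> (\<forall>t\<in>{0..1}. dist (X c0 t) (X c t) < \<epsilon>)"
    if e0: "\<epsilon> > 0" for \<epsilon>
  proof -
    obtain \<rho>1 where "\<rho>1 > 0" "ball c0 \<rho>1 \<subseteq> U" using U open_contains_ball by blast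
    moreover obtain \<rho>2 where "\<rho>2 > 0" "\<forall>c\<in>U. dist c0 c < \<rho>2 \<longrightarrow> (\<forall>t\<in>{0..1}. dist (X c0 t) (X c t) < \<epsilon>)"
      using close[OF e0] by blast
    ultimately show ?thesis by (intro exI[of _ "min \<rho>1 \<rho>2"]) (auto simp: subset_iff)
  qed
  have remainder: "\<exists>\<rho>>0. \<forall>c c'. dist c0 c < \<rho> \<longrightarrow> dist c0 c' < \<rho> \<longrightarrow> c \<in> U \<and> c' \<in> U \<and> (\<forall>t\<in>{0..1}.
        norm (G c' (X c' t) - G c (X c t) - (A t (X c' t - X c t) + B t (c' - c)))
          \<le> \<epsilon> * (norm (X c' t - X c t) + norm (c' - c)))"
    if e0: "\<epsilon> > 0" for \<epsilon>
  proof -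
    obtain \<rho>1 where \<rho>1: "\<rho>1 > 0" "\<forall>t\<in>{0..1}. \<forall>c c' x x'.
        dist c0 c < \<rho>1 \<longrightarrow> dist c0 c' < \<rho>1 \<longrightarrow> dist (X c0 t) x < \<rho>1 \<longrightarrow> dist (X c0 t) x' < \<rho>1 \<longrightarrow>
        norm (G c' x' - G c x - (A t (x' - x) + B t (c' - c))) \<le> \<epsilon> * (norm (x' - x) + norm (c' - c))"
      using strict[OF e0] by blast
    obtain \<rho>2 where "\<rho>2 > 0" "\<forall>c. dist c0 c < \<rho>2 \<longrightarrow> c \<in> U \<and> (\<forall>t\<in>{0..1}. dist (X c0 t) (X c t) < \<rho>1)"
      using near[OF \<rho>1(1)] by blast
    then show ?thesis using \<rho>1 by (intro exI[of _ "min \<rho>1 \<rho>2"]) auto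
  qed
  \<comment> \<open>Strictness with epsilon = 1 is already enough for the Lipschitz bound in the
    parameter.\<close>
  obtain \<rho>L where \<rho>L: "\<rho>L > 0" "\<And>c c' t. dist c0 c < \<rho>L \<Longrightarrow> dist c0 c' < \<rho>L \<Longrightarrow> t \<in> {0..1} \<Longrightarrow>
        norm (G c' (X c' t) - G c (X c t) - (A t (X c' t - X c t) + B t (c' - c)))
          \<le> 1 * (norm (X c' t - X c t) + norm (c' - c))"
    using remainder[of 1] by auto
  define L where "L = (M' + 1) * exp (M' + 2)"
  have derD: "((\<lambda>t. X c' t - X c t) has_vector_derivative (G c' (X c' t) - G c (X c t))) (at t within {0..1})"
    if "c \<in> U" "c' \<in> U" "t \<in> {0..1}" for c c' t
    using that sol by (intro has_vector_derivative_diff) auto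
  have expt: "exp (k * t) \<le> exp k" if "t \<in> {0..1}" "k \<ge> 0" for k t :: real
    using that by (simp add: mult_left_le)
  have lip: "norm (X c' t - X c t) \<le> L * norm (c' - c)"
    if c: "c \<in> U" "c' \<in> U" "dist c0 c < \<rho>L" "dist c0 c' < \<rho>L" and t: "t \<in> {0..1}" for c c' t
  proof -
    have "norm (X c' t - X c t) \<le> ((M' + 1) * norm (c' - c)) * exp ((M' + 1 + 1) * t)"
    proof (rule gronwall_norm[OF derD[OF c(1,2)] _ _ _ _ t])
      fix s :: real assume s: "s \<in> {0..1}"
      show "norm (G c' (X c' s) - G c (X c s)) \<le> (M' + 1) * norm (X c' s - X c s) + (M' + 1) * norm (c' - c)"
      proof -
        have "norm (A s (X c' s - X c s) + B s (c' - c)) \<le> M' * norm (X c' s - X c s) + M' * norm (c' - c)"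
          using boundA'[OF s] boundB'[OF s] by (intro norm_triangle_le add_mono)
        then have "norm (G c' (X c' s) - G c (X c s)) \<le> M' * norm (X c' s - X c s) + M' * norm (c' - c)
            + 1 * (norm (X c' s - X c s) + norm (c' - c))"
          using \<rho>L(2)[OF c(3,4) s] by (rule order_trans[OF norm_triangle_sub add_mono])
        then show ?thesis by (simp add: algebra_simps)
      qed
    qed (use M' c init in auto)
    also have "\<dots> \<le> ((M' + 1) * norm (c' - c)) * exp (M' + 1 + 1)"
      using t M' by (intro mult_left_mono expt) auto
    finally show ?thesis by (simp add: L_def algebra_simps)
  qed
  show thesis
  proof (rule that[OF linY])
    fix \<epsilon> :: real assume \<epsilon>: "\<epsilon> > 0"
    \<comment> \<open>The factor \<open>L + 1\<close> comes from estimating |X c' - X c| + |c' - c|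
      by |c' - c|, the factor \<open>exp (M' + 1)\<close> from Gronwall at time 1.\<close>
    define \<epsilon>' where "\<epsilon>' = \<epsilon> / ((L + 1) * exp (M' + 1))"
    have L0: "L \<ge> 0" using M' by (simp add: L_def)
    have \<epsilon>': "\<epsilon>' > 0" "\<epsilon>' * ((L + 1) * exp (M' + 1)) = \<epsilon>"
    proof -
      have "(L + 1) * exp (M' + 1) > 0" using L0 by (intro mult_pos_pos) auto
      then show "\<epsilon>' > 0" "\<epsilon>' * ((L + 1) * exp (M' + 1)) = \<epsilon>" using \<epsilon> L0 by (simp_all add: \<epsilon>'_def)
    qed
    obtain \<rho> where \<rho>: "\<rho> > 0" "\<And>c c'. dist c0 c < \<rho> \<Longrightarrow> dist c0 c' < \<rho> \<Longrightarrow> c \<in> U \<and> c' \<in> U \<and> (\<forall>t\<in>{0..1}.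
        norm (G c' (X c' t) - G c (X c t) - (A t (X c' t - X c t) + B t (c' - c)))
          \<le> \<epsilon>' * (norm (X c' t - X c t) + norm (c' - c)))"
      using remainder[OF \<epsilon>'(1)] by blast
    have "norm (X c' 1 - X c 1 - Y 1 (c' - c)) \<le> \<epsilon> * norm (c' - c)"
      if c: "dist c0 c < min \<rho> \<rho>L" "dist c0 c' < min \<rho> \<rho>L" for c c'
    proof -
      have cU: "c \<in> U" "c' \<in> U" using \<rho>(2)[of c c'] c by auto
      have "norm (X c' 1 - X c 1 - Y 1 (c' - c)) \<le> (\<epsilon>' * (L + 1) * norm (c' - c)) * exp ((M' + 1) * 1)"
      proof (rule gronwall_norm[where D="\<lambda>t. X c' t - X c t - Y t (c' - c)" and T=1])
        fix s :: real assume s: "s \<in> {0..1}"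
        show "((\<lambda>t. X c' t - X c t - Y t (c' - c)) has_vector_derivative
            (G c' (X c' s) - G c (X c s) - (A s (Y s (c' - c)) + B s (c' - c)))) (at s within {0..1})"
          using derD[OF cU s] derY[OF s] by (rule has_vector_derivative_diff)
        have "G c' (X c' s) - G c (X c s) - (A s (Y s (c' - c)) + B s (c' - c))
          = A s (X c' s - X c s - Y s (c' - c))
            + (G c' (X c' s) - G c (X c s) - (A s (X c' s - X c s) + B s (c' - c)))"
          by (simp add: linear_diff[OF linA[OF s]])
        also have "norm \<dots> \<le> M' * norm (X c' s - X c s - Y s (c' - c)) + \<epsilon>' * (norm (X c' s - X c s) + norm (c' - c))"
          using \<rho>(2)[of c c'] c s boundA'[OF s] by (intro norm_triangle_le add_mono) auto
        also have "\<epsilon>' * (norm (X c' s - X c s) + norm (c' - c)) \<le> \<epsilon>' * ((L + 1) * norm (c' - c))"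
          using \<epsilon>' lip[OF cU _ _ s] c by (intro mult_left_mono) (auto simp: algebra_simps)
        finally show "norm (G c' (X c' s) - G c (X c s) - (A s (Y s (c' - c)) + B s (c' - c)))
            \<le> M' * norm (X c' s - X c s - Y s (c' - c)) + \<epsilon>' * (L + 1) * norm (c' - c)"
          by (simp add: mult.assoc)
      qed (use M' cU init \<epsilon>' L0 Y0 in auto)
      also have "\<dots> = \<epsilon>' * ((L + 1) * exp (M' + 1)) * norm (c' - c)"
        by (simp add: algebra_simps)
      finally show ?thesis using \<epsilon>'(2) by simp
    qed
    then show "\<exists>\<rho>>0. \<forall>c c'. dist c0 c < \<rho> \<longrightarrow> dist c0 c' < \<rho> \<longrightarrow>
        norm (X c' 1 - X c 1 - Y 1 (c' - c)) \<le> \<epsilon> * norm (c' - c)"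
      using \<rho>(1) \<rho>L(1) by (intro exI[of _ "min \<rho> \<rho>L"]) auto
  qed
qed

lemma strict_derivative_imp_has_derivative:
  fixes f :: "'c::euclidean_space \<Rightarrow> 'a::euclidean_space"
  assumes "linear Y"
    and strict: "\<And>\<epsilon>. \<epsilon> > 0 \<Longrightarrow> \<exists>\<rho>>0. \<forall>c c'. dist c0 c < \<rho> \<longrightarrow> dist c0 c' < \<rho> \<longrightarrow>
        norm (f c' - f c - Y (c' - c)) \<le> \<epsilon> * norm (c' - c)"
  shows "(f has_derivative Y) (at c0)"
  unfolding has_derivative_at_alt
proof (intro conjI allI impI)
  show "bounded_linear Y" using assms(1) by (simp add: linear_conv_bounded_linear)
  fix \<epsilon> :: real assume "\<epsilon> > 0"
  then obtain \<rho> where \<rho>: "\<rho> > 0" "\<And>c c'. dist c0 c < \<rho> \<Longrightarrow> dist c0 c' < \<rho> \<Longrightarrow>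
        norm (f c' - f c - Y (c' - c)) \<le> \<epsilon> * norm (c' - c)" using strict by blast
  show "\<exists>d>0. \<forall>y. norm (y - c0) < d \<longrightarrow> norm (f y - f c0 - Y (y - c0)) \<le> \<epsilon> * norm (y - c0)"
    using \<rho>(1) \<rho>(2)[of c0] by (intro exI[of _ \<rho>]) (auto simp: dist_norm norm_minus_commute)
qed

text \<open>A linear injection satisfies B |x| <= |Y x|, and a remainder of at most (B/2) |x|
  between any two points near \<open>c0\<close> cannot cancel it.\<close>

lemma strict_derivative_imp_locally_inj:
  fixes f :: "'c::euclidean_space \<Rightarrow> 'a::euclidean_space"
  assumes Y: "linear Y" "inj Y"
    and strict: "\<And>\<epsilon>. \<epsilon> > 0 \<Longrightarrow> \<exists>\<rho>>0. \<forall>c c'. dist c0 c < \<rho> \<longrightarrow> dist c0 c' < \<rho> \<longrightarrow>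
        norm (f c' - f c - Y (c' - c)) \<le> \<epsilon> * norm (c' - c)"
  shows "\<exists>\<rho>>0. inj_on f (ball c0 \<rho>)"
proof -
  obtain B where B: "B > 0" "\<And>x. B * norm x \<le> norm (Y x)"
    using linear_inj_bounded_below_pos[OF Y] by blast
  obtain \<rho> where \<rho>: "\<rho> > 0" "\<And>c c'. dist c0 c < \<rho> \<Longrightarrow> dist c0 c' < \<rho> \<Longrightarrow>
        norm (f c' - f c - Y (c' - c)) \<le> (B / 2) * norm (c' - c)" using strict[of "B / 2"] B by auto
  have "inj_on f (ball c0 \<rho>)"
  proof
    fix c c' assume c: "c \<in> ball c0 \<rho>" "c' \<in> ball c0 \<rho>" "f c = f c'"
    then have "norm (Y (c' - c)) \<le> (B / 2) * norm (c' - c)" using \<rho>(2)[of c c'] by simp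
    then have "B * norm (c' - c) \<le> (B / 2) * norm (c' - c)" using B(2)[of "c' - c"] by linarith
    then show "c = c'" using B(1) by (simp add: field_simps)
  qed
  then show ?thesis using \<rho>(1) by blast
qed

lemma solution_unique:
  fixes G :: "'a::real_inner \<Rightarrow> 'a"
  assumes X: "\<And>t. t \<in> {a..b} \<Longrightarrow> X t \<in> K \<and> (X has_vector_derivative G (X t)) (at t within {a..b})"
    and Y: "\<And>t. t \<in> {a..b} \<Longrightarrow> Y t \<in> K \<and> (Y has_vector_derivative G (Y t)) (at t within {a..b})"
    and lip: "\<And>x y. x \<in> K \<Longrightarrow> y \<in> K \<Longrightarrow> norm (G x - G y) \<le> L * norm (x - y)" and L: "0 \<le> L"
    and s: "s \<in> {a..b}" "X s = Y s" and t: "t \<in> {a..b}"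
  shows "X t = Y t"
proof -
  \<comment> \<open>If t < s, time runs backwards from \<open>s\<close>: k = -1 reverses the field
    and leaves its Lipschitz constant unchanged. Gronwall with beta = 0 then gives equality.\<close>
  define k where "k = (if s \<le> t then 1 else -1 :: real)"
  define T where "T = \<bar>t - s\<bar>"
  have k: "\<bar>k\<bar> = 1" "s + k * T = t" by (auto simp: k_def T_def)
  have seg: "s + k * \<tau> \<in> {a..b}" if "\<tau> \<in> {0..T}" for \<tau>
    using that s t by (auto simp: k_def T_def split: if_splits)
  have der: "((Z \<circ> (\<lambda>\<tau>. s + k * \<tau>)) has_vector_derivative k *\<^sub>R G (Z (s + k * \<tau>))) (at \<tau> within {0..T})"
    if Z: "\<And>t. t \<in> {a..b} \<Longrightarrow> (Z has_vector_derivative G (Z t)) (at t within {a..b})"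
      and "\<tau> \<in> {0..T}" for Z \<tau>
  proof (rule vector_diff_chain_within)
    show "((\<lambda>\<tau>. s + k * \<tau>) has_vector_derivative k) (at \<tau> within {0..T})"
      by (auto intro!: derivative_eq_intros simp flip: has_real_derivative_iff_has_vector_derivative)
    show "(Z has_vector_derivative G (Z (s + k * \<tau>))) (at (s + k * \<tau>) within (\<lambda>\<tau>. s + k * \<tau>) ` {0..T})"
      using Z[OF seg[OF that(2)]] by (rule has_vector_derivative_within_subset) (use seg in auto)
  qed
  have "norm (X (s + k * T) - Y (s + k * T)) \<le> 0 * exp ((L + 1) * T)"
  proof (rule gronwall_norm[where D="\<lambda>\<tau>. X (s + k * \<tau>) - Y (s + k * \<tau>)"])
    fix \<tau> assume \<tau>: "\<tau> \<in> {0..T}"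
    show "((\<lambda>\<tau>. X (s + k * \<tau>) - Y (s + k * \<tau>)) has_vector_derivative
        k *\<^sub>R G (X (s + k * \<tau>)) - k *\<^sub>R G (Y (s + k * \<tau>))) (at \<tau> within {0..T})"
      using der[OF conjunct2[OF X] \<tau>] der[OF conjunct2[OF Y] \<tau>]
      unfolding o_def by (rule has_vector_derivative_diff)
    show "norm (k *\<^sub>R G (X (s + k * \<tau>)) - k *\<^sub>R G (Y (s + k * \<tau>))) \<le> L * norm (X (s + k * \<tau>) - Y (s + k * \<tau>)) + 0"
      using lip[of "X (s + k * \<tau>)" "Y (s + k * \<tau>)"] X[OF seg[OF \<tau>]] Y[OF seg[OF \<tau>]] k(1)
      by (simp flip: scaleR_diff_right)
  qed (use s L in \<open>auto simp: T_def\<close>)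
  then show ?thesis using k by simp
qed

section \<open>One-sided derivatives and scalar comparison arguments\<close>

lemma has_vector_derivative_Un:
  assumes "(f has_vector_derivative f') (at x within S)" "(f has_vector_derivative f') (at x within T)"
  shows "(f has_vector_derivative f') (at x within (S \<union> T))"
  using assms unfolding has_vector_derivative_def has_derivative_within
  by (auto simp: at_within_union intro: filterlim_sup)

lemma norm_Pair_le_sum: "norm (x :: real \<times> real) \<le> \<bar>fst x\<bar> + \<bar>snd x\<bar>"
  using norm_Pair_le[of "fst x" "snd x"] by simp

lemma abs_fst_le_norm: "\<bar>fst (x :: real \<times> real)\<bar> \<le> norm x" and abs_snd_le_norm: "\<bar>snd x\<bar> \<le> norm x"
  using norm_fst_le[of "fst x" "snd x"] norm_snd_le[of "snd x" "fst x"] by simp_all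

lemma abs_mult_le: "\<bar>x\<bar> \<le> a \<Longrightarrow> \<bar>y\<bar> \<le> b \<Longrightarrow> \<bar>x * y\<bar> \<le> a * b" for x y a b :: real
  unfolding abs_mult by (rule mult_mono) auto

lemma abs_mult_left_le: "0 \<le> k \<Longrightarrow> \<bar>x\<bar> \<le> y \<Longrightarrow> \<bar>k * x\<bar> \<le> k * y" for k x y :: real
  by (simp add: abs_mult mult_left_mono)

lemma has_vector_derivative_real_Pair:
  assumes "(u has_real_derivative a) (at t within S)" "(e has_real_derivative b) (at t within S)"
  shows "((\<lambda>t. (u t, e t)) has_vector_derivative (a, b)) (at t within S)"
  using assms unfolding has_real_derivative_iff_has_vector_derivative has_vector_derivative_def scaleR_Pair
  by (auto intro: has_derivative_Pair)

lemma deriv_le_imp_diff_le: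
  fixes f f' :: "real \<Rightarrow> real"
  assumes der: "\<And>t. t \<in> {a..b} \<Longrightarrow> (f has_real_derivative f' t) (at t within {a..b})"
    and le: "\<And>t. t \<in> {s..t'} \<Longrightarrow> f' t \<le> k" and st: "a \<le> s" "s \<le> t'" "t' \<le> b"
  shows "f t' - f s \<le> k * (t' - s)"
proof -
  have cont: "continuous_on {a..b} f" using der by (rule DERIV_continuous_on)
  have "f t' - k * t' \<le> f s - k * s"
  proof (rule DERIV_nonpos_imp_decreasing_open[of s t' "\<lambda>t. f t - k * t"])
    show "s \<le> t'" by (rule st)
    show "continuous_on {s..t'} (\<lambda>t. f t - k * t)"
      using st by (intro continuous_on_diff continuous_on_subset[OF cont] continuous_intros) auto
    fix t assume t: "s < t" "t < t'"
    then have "a < t" "t < b" using st by auto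
    then have "(f has_real_derivative f' t) (at t)" using der[of t] by (simp add: at_within_Icc_at)
    then have "((\<lambda>t. f t - k * t) has_real_derivative f' t - k) (at t)"
      by (auto intro!: derivative_eq_intros)
    then show "\<exists>y. ((\<lambda>t. f t - k * t) has_real_derivative y) (at t) \<and> y \<le> 0"
      using le[of t] t by (intro exI[of _ "f' t - k"]) auto
  qed
  then show ?thesis by (simp add: algebra_simps)
qed

lemma deriv_ge_imp_diff_ge:
  fixes f f' :: "real \<Rightarrow> real"
  assumes der: "\<And>t. t \<in> {a..b} \<Longrightarrow> (f has_real_derivative f' t) (at t within {a..b})"
    and ge: "\<And>t. t \<in> {s..t'} \<Longrightarrow> k \<le> f' t" and st: "a \<le> s" "s \<le> t'" "t' \<le> b"
  shows "k * (t' - s) \<le> f t' - f s"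
proof -
  have "- f t' - - f s \<le> - k * (t' - s)"
    by (rule deriv_le_imp_diff_le[OF DERIV_minus[OF der] _ st]) (use ge in auto)
  then show ?thesis by simp
qed

text \<open>The level \<open>m\<close> can only be crossed upwards: at the last time before
  \<open>t\<close> with f >= m the intermediate value theorem forces f = m, and there the positive
  derivative lifts \<open>f\<close> above \<open>m\<close> once more.\<close>

lemma barrier_forward:
  fixes f f' :: "real \<Rightarrow> real"
  assumes der: "\<And>t. t \<in> {a..b} \<Longrightarrow> (f has_real_derivative f' t) (at t within {a..b})"
    and pos: "\<And>t. t \<in> {s..b} \<Longrightarrow> f t = m \<Longrightarrow> f' t > 0" and init: "m \<le> f s"
    and st: "a \<le> s" "s \<le> t" "t \<le> b"
  shows "m \<le> f t"
proof (rule ccontr)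
  assume "\<not> m \<le> f t"
  then have t: "f t < m" by simp
  have "continuous_on {a..b} f" using der by (rule DERIV_continuous_on)
  then have cont: "continuous_on {s..t} f" by (rule continuous_on_subset) (use st in auto)
  define S where "S = {x \<in> {s..t}. m \<le> f x}"
  have "closed S" unfolding S_def
    using continuous_closed_preimage[OF cont closed_atLeastAtMost closed_atLeast, of m]
    by (simp add: vimage_def Int_def)
  moreover have sS: "s \<in> S" using init st by (simp add: S_def)
  moreover have bdd: "bdd_above S" by (rule bdd_aboveI[of _ t]) (simp add: S_def)
  ultimately have "Sup S \<in> S" by (intro closed_contains_Sup) auto
  define r where "r = Sup S"
  have r: "r \<in> {s..t}" "m \<le> f r" using \<open>Sup S \<in> S\<close> by (auto simp: r_def S_def)
  have above: "f x < m" if "r < x" "x \<le> t" for x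
  proof (rule ccontr)
    assume "\<not> f x < m"
    then have "x \<in> S" using that r by (simp add: S_def)
    then have "x \<le> r" unfolding r_def using bdd by (rule cSup_upper)
    then show False using that by simp
  qed
  have rt: "r < t" using r t by (cases "r = t") auto
  have "f r \<le> m"
  proof (rule ccontr)
    assume "\<not> f r \<le> m"
    then have "\<exists>x\<ge>r. x \<le> t \<and> f x = (f r + m) / 2"
      using t r rt by (intro IVT2' continuous_on_subset[OF cont]) auto
    then obtain x where "r \<le> x" "x \<le> t" "f x = (f r + m) / 2" by blast
    moreover then have "f x > m" using \<open>\<not> f r \<le> m\<close> by simp
    ultimately show False using above[of x] \<open>\<not> f r \<le> m\<close> by (cases "x = r") auto
  qed
  then have "f r = m" using r by simp
  then have "f' r > 0" using pos r st by auto
  moreover have "(f has_real_derivative f' r) (at r within {a..b})" using der r st by auto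
  ultimately obtain d where d: "d > 0" "\<And>h. 0 < h \<Longrightarrow> r + h \<in> {a..b} \<Longrightarrow> h < d \<Longrightarrow> f r < f (r + h)"
    using has_real_derivative_pos_inc_right by metis
  define h where "h = min (d / 2) (t - r)"
  have "0 < h" "r + h \<in> {a..b}" "h < d" "r < r + h" "r + h \<le> t" using d(1) rt r st by (auto simp: h_def)
  then have "f r < f (r + h)" "f (r + h) < m" using d(2) above by auto
  then show False using r by simp
qed

lemma barrier_backward:
  fixes f f' :: "real \<Rightarrow> real"
  assumes der: "\<And>t. t \<in> {a..b} \<Longrightarrow> (f has_real_derivative f' t) (at t within {a..b})"
    and neg: "\<And>t. t \<in> {a..b} \<Longrightarrow> f t = m \<Longrightarrow> f' t < 0" and init: "m \<le> f b" and t: "t \<in> {a..b}"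
  shows "m \<le> f t"
proof -
  let ?g = "\<lambda>s. a + b - s"
  have img: "?g ` {a..b} = {a..b}"
    by (auto simp: image_iff intro!: bexI[of _ "a + b - _"])
  have "((f \<circ> ?g) has_real_derivative f' (?g s) * (-1)) (at s within {a..b})" if "s \<in> {a..b}" for s
  proof (rule DERIV_image_chain)
    show "(f has_real_derivative f' (?g s)) (at (?g s) within ?g ` {a..b})"
      unfolding img using that by (intro der) auto
  qed (auto intro!: derivative_eq_intros)
  from barrier_forward[OF this, of a m "a + b - t"] show ?thesis
    using neg init t by (simp add: o_def)
qed

lemma interior_min_deriv_zero:
  fixes f :: "real \<Rightarrow> real"
  assumes "(f has_real_derivative l) (at t within {a..b})" "a < t" "t < b"
    and "\<And>s. s \<in> {a..b} \<Longrightarrow> f t \<le> f s"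
  shows "l = 0"
proof -
  have "(f has_real_derivative l) (at t)" using assms(1-3) by (simp add: at_within_Icc_at)
  then show ?thesis
  proof (rule DERIV_local_min)
    show "0 < min (t - a) (b - t)" using assms by simp
    show "\<forall>y. \<bar>t - y\<bar> < min (t - a) (b - t) \<longrightarrow> f t \<le> f y"
      by (intro allI impI assms(4)) (auto simp: abs_less_iff)
  qed
qed

section \<open>Proper locally injective maps\<close>

text \<open>A purely topological setting. Domain and range lie in the same Euclidean space, so
  invariance of domain lets local injectivity replace an invertible derivative. Convexity of
  \<open>S\<close> supplies its connectedness and the contraction of loops.\<close>

locale proper_local_injection =
  fixes C S :: "'a::euclidean_space set" and f :: "'a \<Rightarrow> 'a"
  assumes open_dom: "open C"
    and convex_range: "convex S"
    and cont: "continuous_on C f"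
    and range: "f ` C \<subseteq> S"
    and proper: "\<And>K. compact K \<Longrightarrow> K \<subseteq> S \<Longrightarrow> compact {x \<in> C. f x \<in> K}"
    and locally_inj: "\<And>x. x \<in> C \<Longrightarrow> \<exists>U. open U \<and> x \<in> U \<and> inj_on f (U \<inter> C)"
begin

lemma open_image:
  assumes "open V" "V \<subseteq> C"
  shows "open (f ` V)"
proof -
  have "\<exists>U. open U \<and> f x \<in> U \<and> U \<subseteq> f ` V" if x: "x \<in> V" for x
  proof -
    obtain U where U: "open U" "x \<in> U" "inj_on f (U \<inter> C)"
      using locally_inj[of x] x assms by auto
    have "open (f ` (U \<inter> V))"
    proof (rule invariance_of_domain)
      show "continuous_on (U \<inter> V) f" using assms by (intro continuous_on_subset[OF cont]) auto
      show "open (U \<inter> V)" using U assms by auto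
      show "inj_on f (U \<inter> V)" using assms by (intro inj_on_subset[OF U(3)]) auto
    qed
    then show ?thesis using U that by (intro exI[of _ "f ` (U \<inter> V)"]) auto
  qed
  then show ?thesis
    by (subst open_subopen) auto
qed

text \<open>Properness makes \<open>f\<close> a closed map into \<open>S\<close>; together with
  openness this yields the clopen argument for components and the choice of evenly covered
  sets.\<close>

lemma closedin_image:
  assumes F: "closedin (top_of_set C) F"
  shows "closedin (top_of_set S) (f ` F)"
  using range F proper
  by (intro proper_map[of C F S f]) (auto simp: vimage_def Int_def)

lemma clopen_image:
  assumes "openin (top_of_set C) D" "closedin (top_of_set C) D" "D \<noteq> {}"
  shows "f ` D = S"
proof -
  have "open D" "D \<subseteq> C" using assms open_dom by (auto simp: openin_open_eq)
  then have "openin (top_of_set S) (f ` D)"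
    using open_image range by (intro open_subset) auto
  moreover have "closedin (top_of_set S) (f ` D)" using closedin_image assms by blast
  moreover have "connected S" using convex_range by (rule convex_connected)
  ultimately show ?thesis using assms(3) unfolding connected_clopen by blast
qed

text \<open>Every component of \<open>C\<close> is clopen, hence mapped onto \<open>S\<close>, hence
  meets the fibre over \<open>b\<close> and with it the connected set \<open>R\<close>. So all
  components contain \<open>R\<close> and coincide.\<close>

lemma connected_dom:
  assumes "connected R" "R \<subseteq> C" "b \<in> S" "{x \<in> C. f x = b} \<subseteq> R"
  shows "connected C"
proof -
  have sub: "R \<subseteq> connected_component_set C x \<and> R \<noteq> {}" if "x \<in> C" for x
  proof -
    let ?D = "connected_component_set C x"
    have "openin (top_of_set C) ?D"
      using open_dom by (simp add: open_connected_component open_subset connected_component_subset)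
    moreover have "closedin (top_of_set C) ?D" by (rule closedin_connected_component)
    moreover have "x \<in> ?D" using that by simp
    ultimately have "f ` ?D = S" using clopen_image by blast
    then obtain z where "z \<in> ?D" "f z = b" using assms(3) by (metis imageE)
    moreover then have "z \<in> R" using assms(4) connected_component_subset by blast
    ultimately have "R \<subseteq> connected_component_set C z" "connected_component_set C z = ?D" "R \<noteq> {}"
      using connected_component_maximal[OF _ assms(1,2), of z] connected_component_eq[of z C x] by auto
    then show ?thesis by simp
  qed
  show ?thesis
    unfolding connected_iff_connected_component
  proof (intro ballI)
    fix x y assume "x \<in> C" "y \<in> C"
    then obtain z where "connected_component C x z" "connected_component C y z"
      using sub by blast
    then show "connected_component C x y"
      using connected_component_sym connected_component_trans by metis
  qed
qed

text \<open>The fibre is compact by properness and discrete by local injectivity.\<close>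

lemma finite_fibre:
  assumes "y \<in> S"
  shows "finite {x \<in> C. f x = y}"
proof -
  let ?F = "{x \<in> C. f x = y}"
  have "compact ?F" using proper[of "{y}"] assms by simp
  moreover obtain U where U: "\<And>x. x \<in> C \<Longrightarrow> open (U x) \<and> x \<in> U x \<and> inj_on f (U x \<inter> C)"
    using locally_inj by metis
  ultimately obtain G where G: "G \<subseteq> ?F" "finite G" "?F \<subseteq> (\<Union>x\<in>G. U x)"
    by (elim compactE_image[of _ ?F U]) blast+
  have "?F \<subseteq> G"
  proof
    fix z assume z: "z \<in> ?F"
    then obtain x where x: "x \<in> G" "z \<in> U x" using G by blast
    then have "x \<in> C" "f x = f z" using G z by auto
    then have "x = z" using U[of x] x z by (auto simp: inj_on_def)
    then show "z \<in> G" using x by simp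
  qed
  then show ?thesis using G finite_subset by blast
qed

text \<open>Disjoint balls of injectivity about the finitely many points of a fibre are the
  candidates for the sheets. Shrinking the neighbourhood of \<open>y\<close> removes the images of
  all points outside these balls, so that no further preimages occur.\<close>

lemma covering:
  assumes "C \<noteq> {}"
  shows "covering_space C f S"
proof
  show "continuous_on C f" by (rule cont)
  show "f ` C = S" using assms by (intro clopen_image) auto
  fix y assume y: "y \<in> S"
  let ?F = "{x \<in> C. f x = y}"
  have F: "finite ?F" by (rule finite_fibre[OF y])
  have "\<exists>r>0. ball x r \<subseteq> C \<and> inj_on f (ball x r) \<and> (\<forall>x'\<in>?F. x' \<noteq> x \<longrightarrow> 2 * r \<le> dist x x')"
    if x: "x \<in> ?F" for x
  proof -
    obtain U where U: "open U" "x \<in> U" "inj_on f (U \<inter> C)" using locally_inj x by blast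
    then obtain e where e: "e > 0" "ball x e \<subseteq> U \<inter> C"
      using open_dom x by (metis (no_types, lifting) Int_iff mem_Collect_eq open_Int open_contains_ball)
    obtain d where d: "d > 0" "\<And>x'. x' \<in> ?F \<Longrightarrow> x' \<noteq> x \<Longrightarrow> d \<le> dist x x'"
      using finite_set_avoid[OF F, of x] by auto
    have sub: "ball x (min e (d/2)) \<subseteq> U \<inter> C"
      using e(2) by (rule order_trans[rotated]) auto
    show ?thesis
    proof (intro exI[of _ "min e (d/2)"] conjI ballI impI)
      show "0 < min e (d/2)" using e d by simp
      show "ball x (min e (d/2)) \<subseteq> C" using sub by simp
      show "inj_on f (ball x (min e (d/2)))" using inj_on_subset[OF U(3) sub] .
      show "2 * min e (d/2) \<le> dist x x'" if "x' \<in> ?F" "x' \<noteq> x" for x'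
        using d(2)[OF that] by linarith
    qed
  qed
  then have "\<forall>x\<in>?F. \<exists>r. r > 0 \<and> ball x r \<subseteq> C \<and> inj_on f (ball x r) \<and>
      (\<forall>x'\<in>?F. x' \<noteq> x \<longrightarrow> 2 * r \<le> dist x x')"
    by blast
  from bchoice[OF this] obtain r where r: "\<And>x. x \<in> ?F \<Longrightarrow> r x > 0 \<and> ball x (r x) \<subseteq> C \<and> inj_on f (ball x (r x)) \<and>
      (\<forall>x'\<in>?F. x' \<noteq> x \<longrightarrow> 2 * r x \<le> dist x x')"
    by auto
  let ?V = "\<lambda>x. ball x (r x)"
  have disj: "disjnt (?V x) (?V x')" if "x \<in> ?F" "x' \<in> ?F" "x \<noteq> x'" for x x'
  proof -
    have "2 * r x \<le> dist x x'" "2 * r x' \<le> dist x' x"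
      using r[OF that(1)] r[OF that(2)] that by auto
    then show ?thesis
      unfolding disjnt_iff by (smt (verit) dist_commute dist_triangle mem_ball)
  qed
  \<comment> \<open>\<open>W\<close> is closed in \<open>S\<close> because \<open>f\<close> is a
    closed map, and it misses \<open>y\<close> because the whole fibre lies in the balls. Over
    \<open>T\<close> every preimage lies in one of the balls, and each ball contains a preimage of
    every point of \<open>T\<close>.\<close>
  define W where "W = f ` (C - (\<Union>x\<in>?F. ?V x))"
  define T where "T = (S - W) \<inter> (\<Inter>x\<in>?F. f ` ?V x)"
  have W: "closedin (top_of_set S) W"
    unfolding W_def using r
    by (intro closedin_image closedin_diff open_subset) auto
  have V: "open (f ` ?V x)" if "x \<in> ?F" for x using r[OF that] open_image by simp
  have "openin (top_of_set S) (S - W)" using W by (auto simp: openin_diff)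
  moreover have "open (\<Inter>x\<in>?F. f ` ?V x)" using V F by blast
  ultimately have T: "openin (top_of_set S) T"
    unfolding T_def by (simp add: openin_Int_open)
  have yT: "y \<in> T" unfolding T_def W_def using y r by (auto intro!: imageI)
  show "\<exists>T. y \<in> T \<and> openin (top_of_set S) T \<and>
       (\<exists>v. \<Union>v = C \<inter> f -` T \<and> (\<forall>u \<in> v. openin (top_of_set C) u) \<and>
           pairwise disjnt v \<and> (\<forall>u \<in> v. \<exists>q. homeomorphism u T f q))"
  proof (intro exI conjI)
    show "y \<in> T" "openin (top_of_set S) T" by fact+
    let ?v = "(\<lambda>x. ?V x \<inter> f -` T) ` ?F"
    show "\<Union>?v = C \<inter> f -` T"
    proof
      show "\<Union>?v \<subseteq> C \<inter> f -` T" using r by blast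
      show "C \<inter> f -` T \<subseteq> \<Union>?v" unfolding T_def W_def by blast
    qed
    have op: "openin (top_of_set C) (C \<inter> f -` T)"
      using T cont range by (metis Pi_I continuous_openin_preimage image_subset_iff)
    have eq: "?V x \<inter> f -` T = ?V x \<inter> (C \<inter> f -` T)" if "x \<in> ?F" for x using r[OF that] by blast
    show opv: "\<forall>u\<in>?v. openin (top_of_set C) u"
    proof
      fix u assume "u \<in> ?v"
      then obtain x where x: "x \<in> ?F" "u = ?V x \<inter> f -` T" by blast
      show "openin (top_of_set C) u"
        unfolding x(2) eq[OF x(1)] using openin_Int_open[OF op open_ball] by (simp add: Int_commute)
    qed
    show "pairwise disjnt ?v"
      using disj unfolding pairwise_def disjnt_iff by blast
    show "\<forall>u\<in>?v. \<exists>q. homeomorphism u T f q"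
    proof
      fix u assume "u \<in> ?v"
      then obtain x where x: "x \<in> ?F" "u = ?V x \<inter> f -` T" by blast
      have "f ` u = T" using x unfolding T_def by blast
      moreover have "open u" using opv \<open>u \<in> ?v\<close> open_dom by (auto simp: openin_open_eq)
      moreover have "u \<subseteq> ?V x" using x by blast
      then have "continuous_on u f" "inj_on f u"
        using r[OF x(1)] by (auto intro: continuous_on_subset[OF cont] inj_on_subset[of f "?V x"])
      ultimately show "\<exists>q. homeomorphism u T f q"
        using invariance_of_domain_homeomorphism[of u f] by blast
    qed
  qed
qed

text \<open>A path joining two preimages of one point is mapped to a loop, which convexity of
  \<open>S\<close> contracts along segments to the constant loop. By monodromy the path and the
  constant path, both lifts starting at \<open>a\<close>, have the same end.\<close>

theorem injective:
  assumes "connected C"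
  shows "inj_on f C"
proof
  fix a b assume ab: "a \<in> C" "b \<in> C" "f a = f b"
  have "path_connected C" using assms open_dom connected_open_path_connected by blast
  then obtain h where h: "path h" "path_image h \<subseteq> C" "pathstart h = a" "pathfinish h = b"
    using ab unfolding path_connected_def by blast
  let ?k = "\<lambda>t::real. a"
  have cov: "covering_space C f S" using covering ab by blast
  have p: "path (f \<circ> h)" using h cont by (intro path_continuous_image) (auto intro: continuous_on_subset)
  have pi: "path_image (f \<circ> h) \<subseteq> S" using h range by (auto simp: path_image_compose)
  have "homotopic_paths S (f \<circ> h) (f \<circ> ?k)"
  proof (rule homotopic_paths_linear)
    show "closed_segment ((f \<circ> h) t) ((f \<circ> ?k) t) \<subseteq> S" if "t \<in> {0..1}" for t
      using that pi range ab convex_range by (intro closed_segment_subset) (auto simp: path_image_def)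
  qed (use p ab h in \<open>auto simp: path_def pathstart_def pathfinish_def\<close>)
  then have "pathfinish h = pathfinish ?k"
    using h ab range
    by (intro covering_space_monodromy[OF cov p pi, of "f \<circ> ?k" h ?k])
      (auto simp: path_def pathstart_def pathfinish_def path_image_def)
  then show "a = b" using h by (simp add: pathfinish_def)
qed

end

section \<open>Orientation of injective planar maps\<close>

definition unit_loop :: "real \<Rightarrow> complex" where
  "unit_loop t = exp (2 * of_real pi * \<i> * of_real t)"

lemma norm_unit_loop [simp]: "norm (unit_loop t) = 1"
  by (simp add: unit_loop_def)

lemma unit_loop_01 [simp]: "unit_loop 0 = 1" "unit_loop 1 = 1"
  by (simp_all add: unit_loop_def exp_two_pi_i)

lemma continuous_unit_loop [continuous_intros]:
  "continuous_on T g \<Longrightarrow> continuous_on T (\<lambda>t. unit_loop (g t))"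
  unfolding unit_loop_def by (intro continuous_intros)

lemma cnj_unit_loop: "cnj (unit_loop t) = unit_loop (1 - t)"
proof -
  have "unit_loop (1 - t) = exp (2 * of_real pi * \<i> + - (2 * of_real pi * \<i> * of_real t))"
    unfolding unit_loop_def by (simp add: algebra_simps)
  also have "\<dots> = exp (- (2 * of_real pi * \<i> * of_real t))"
    unfolding exp_add exp_two_pi_i by simp
  finally show ?thesis unfolding unit_loop_def by (simp add: exp_cnj)
qed

lemma winding_number_unit_loop:
  assumes "k \<noteq> 0"
  shows "winding_number (\<lambda>t. k * unit_loop t) 0 = 1"
proof -
  \<comment> \<open>The curve exp (s Ln k) joins 1 to \<open>k\<close> without meeting 0, so the
    factor \<open>k\<close> can be deformed away.\<close>
  have "homotopic_loops (-{0}) (circlepath 0 1) (\<lambda>t. k * unit_loop t)"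
    unfolding homotopic_loops
  proof (intro exI[of _ "\<lambda>(s, t). exp (of_real s * Ln k) * unit_loop t"] conjI)
    show "continuous_on ({0..1} \<times> {0..1}) (\<lambda>(s, t). exp (of_real s * Ln k) * unit_loop t)"
      unfolding split_def by (intro continuous_intros)
  qed (use assms in \<open>auto simp: circlepath unit_loop_def pathstart_def pathfinish_def exp_two_pi_i\<close>)
  then have "winding_number (\<lambda>t. k * unit_loop t) 0 = winding_number (circlepath 0 1) 0"
    by (metis winding_number_homotopic_loops)
  then show ?thesis by (simp add: winding_number_circlepath)
qed

text \<open>Conjugation runs through the unit loop backwards.\<close>

lemma winding_number_cnj_unit_loop:
  assumes "k \<noteq> 0"
  shows "winding_number (\<lambda>t. k * cnj (unit_loop t)) 0 = -1"
proof -
  have "(\<lambda>t. k * cnj (unit_loop t)) = reversepath (\<lambda>t. k * unit_loop t)"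
    by (simp add: reversepath_def cnj_unit_loop fun_eq_iff)
  moreover have "path (\<lambda>t. k * unit_loop t)" unfolding path_def by (intro continuous_intros)
  moreover have "0 \<notin> path_image (\<lambda>t. k * unit_loop t)"
    using assms by (auto simp: path_image_def unit_loop_def)
  ultimately show ?thesis
    by (simp add: winding_number_reversepath winding_number_unit_loop[OF assms])
qed

text \<open>For \<open>f\<close> injective near \<open>c\<close> and small \<open>r\<close>, the
  winding number of this loop about 0 is the local degree of \<open>f\<close> at \<open>c\<close>,
  the invariant that carries the orientation.\<close>

definition local_loop :: "(complex \<Rightarrow> complex) \<Rightarrow> real \<Rightarrow> complex \<Rightarrow> real \<Rightarrow> complex" where
  "local_loop f r c t = f (c + of_real r * unit_loop t) - f c"

lemma local_loop_closed: "pathfinish (local_loop f r c) = pathstart (local_loop f r c)"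
  by (simp add: local_loop_def pathstart_def pathfinish_def)

text \<open>\<open>G\<close> is whichever of the complex-linear and antilinear parts of the
  derivative dominates. On small circles the other part and the remainder together stay smaller than
  \<open>G\<close>, so the loop winds about 0 as \<open>G\<close> does.\<close>

lemma winding_number_local_loop:
  assumes der: "(f has_derivative (\<lambda>z. a * z + b * cnj z)) (at c)"
    and D: "open D" "c \<in> D" "continuous_on D f"
    and G: "G \<in> {(\<lambda>t. a * unit_loop t), (\<lambda>t. b * cnj (unit_loop t))}"
    and W: "\<And>r. r > 0 \<Longrightarrow> winding_number (\<lambda>t. of_real r * G t) 0 = W"
    and small: "\<And>t. norm (a * unit_loop t + b * cnj (unit_loop t) - G t) < norm (G t)"
  shows "\<exists>R>0. \<forall>r. 0 < r \<and> r < R \<longrightarrow> winding_number (local_loop f r c) 0 = W"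
proof -
  have nG: "norm (G t) = norm (G 0)" "norm (a * unit_loop t + b * cnj (unit_loop t) - G t) = norm (a + b - G 0)" for t
    using G by (auto simp: norm_mult)
  have G1: "G 1 = G 0" using G by auto
  \<comment> \<open>By \<open>nG\<close> the gap between the dominant and the other part does not
    depend on \<open>t\<close>; half of it is granted to the remainder of the derivative.\<close>
  define \<epsilon> where "\<epsilon> = (norm (G 0) - norm (a + b - G 0)) / 2"
  have \<epsilon>: "\<epsilon> > 0" using small[of 0] unfolding \<epsilon>_def by simp
  obtain d where d: "d > 0" "\<And>z. norm (z - c) < d \<Longrightarrow>
      norm (f z - f c - (a * (z - c) + b * cnj (z - c))) \<le> \<epsilon> * norm (z - c)"
    using der \<epsilon> unfolding has_derivative_at_alt by blast
  obtain d' where d': "d' > 0" "ball c d' \<subseteq> D" using D open_contains_ball by blast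
  have "winding_number (local_loop f r c) 0 = W" if r: "0 < r" "r < min d d'" for r
  proof -
    have in_ball: "c + of_real r * unit_loop t \<in> ball c d'" for t
      using r by (simp add: dist_norm norm_mult)
    have "continuous_on {0..1} (\<lambda>t. c + of_real r * unit_loop t)"
      by (intro continuous_intros)
    then have "continuous_on {0..1} (\<lambda>t. f (c + of_real r * unit_loop t))"
      by (rule continuous_on_compose2[OF D(3)]) (use in_ball d' in blast)
    then have "continuous_on {0..1} (local_loop f r c)"
      unfolding local_loop_def by (intro continuous_intros)
    moreover have "continuous_on {0..1} (\<lambda>t. of_real r * G t)"
      using G by (auto intro!: continuous_intros)
    moreover have "norm (local_loop f r c t - of_real r * G t) < norm (of_real r * G t - 0)" for t
    proof -
      define z where "z = of_real r * unit_loop t"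
      have z: "norm z = r" unfolding z_def using r by (simp add: norm_mult)
      have "norm (f (c + z) - f c - (a * z + b * cnj z)) \<le> \<epsilon> * r"
        using d(2)[of "c + z"] z r by simp
      moreover have "norm (a * z + b * cnj z - of_real r * G t) = r * norm (a + b - G 0)"
      proof -
        have "a * z + b * cnj z - of_real r * G t = of_real r * (a * unit_loop t + b * cnj (unit_loop t) - G t)"
          by (simp add: z_def algebra_simps)
        then show ?thesis using r by (simp add: norm_mult nG(2)[of t])
      qed
      ultimately have "norm (f (c + z) - f c - of_real r * G t) \<le> \<epsilon> * r + r * norm (a + b - G 0)"
        using norm_diff_triangle_le[of "f (c + z) - f c" "a * z + b * cnj z" "\<epsilon> * r" "of_real r * G t"]
        by simp
      also have "\<dots> = r * ((norm (G 0) + norm (a + b - G 0)) / 2)"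
        by (simp add: \<epsilon>_def field_simps)
      also have "\<dots> < r * norm (G 0)"
        using r small[of 0] by simp
      finally show ?thesis using r by (simp add: local_loop_def z_def norm_mult nG(1)[of t])
    qed
    moreover have "pathfinish (\<lambda>t. of_real r * G t) = pathstart (\<lambda>t. of_real r * G t)"
      unfolding pathstart_def pathfinish_def G1 ..
    ultimately have "winding_number (local_loop f r c) 0 = winding_number (\<lambda>t. of_real r * G t) 0"
      unfolding path_def[symmetric] using local_loop_closed by (intro winding_number_nearby_loops_eq)
    then show ?thesis using W[OF r(1)] by simp
  qed
  then show ?thesis using d(1) d'(1) by (intro exI[of _ "min d d'"]) auto
qed

text \<open>Moving the centre along the path is a homotopy of loops. Injectivity keeps it off 0,
  because f (c + z) = f c is impossible for z of modulus r > 0.\<close>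

lemma winding_number_local_loop_path:
  assumes f: "continuous_on D f" "inj_on f D"
    and g: "path g" and r: "0 < r" and D: "\<And>s. s \<in> {0..1} \<Longrightarrow> cball (g s) r \<subseteq> D"
  shows "winding_number (local_loop f r (pathstart g)) 0 = winding_number (local_loop f r (pathfinish g)) 0"
proof (rule winding_number_homotopic_loops)
  have in_ball: "g s + of_real r * unit_loop t \<in> D" "g s \<in> D" if "s \<in> {0..1}" for s t
    using r D[OF that] by (auto simp: dist_norm norm_mult subset_iff)
  show "homotopic_loops (-{0}) (local_loop f r (pathstart g)) (local_loop f r (pathfinish g))"
    unfolding homotopic_loops
  proof (intro exI[of _ "\<lambda>(s, t). local_loop f r (g s) t"] conjI)
    have cg: "continuous_on ({0..1} \<times> {0..1}) (\<lambda>x. g (fst x))"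
      using g unfolding path_def by (rule continuous_on_compose2) (auto intro!: continuous_intros)
    show "continuous_on ({0..1} \<times> {0..1}) (\<lambda>(s, t). local_loop f r (g s) t)"
      unfolding split_def local_loop_def
      by (intro continuous_intros continuous_on_compose2[OF f(1)] cg) (use in_ball in auto)
    show "(\<lambda>(s, t). local_loop f r (g s) t) \<in> {0..1} \<times> {0..1} \<rightarrow> - {0}"
    proof safe
      fix s t :: real assume s: "s \<in> {0..1}" and "local_loop f r (g s) t = 0"
      then have "g s + of_real r * unit_loop t = g s"
        using inj_onD[OF f(2) _ in_ball(1)[OF s] in_ball(2)[OF s]] unfolding local_loop_def by simp
      then have "norm (of_real r * unit_loop t) = 0" unfolding norm_eq_zero by (metis add_cancel_right_right)
      then show False using r by (simp add: norm_mult)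
    qed
  qed (auto simp: local_loop_def pathstart_def pathfinish_def)
qed

theorem injective_orientation_complex:
  assumes D: "open D" "connected D" and f: "continuous_on D f" "inj_on f D"
    and p: "p \<in> D" "(f has_derivative (\<lambda>z. a * z + b * cnj z)) (at p)" "norm b < norm a"
    and q: "q \<in> D" "(f has_derivative (\<lambda>z. a' * z + b' * cnj z)) (at q)" "norm a' < norm b'"
  shows False
proof -
  obtain g where g: "path g" "path_image g \<subseteq> D" "pathstart g = p" "pathfinish g = q"
    using D p(1) q(1) connected_open_path_connected unfolding path_connected_def by blast
  have "a \<noteq> 0" "b' \<noteq> 0" using p(3) q(3) by auto
  then have wa: "winding_number (\<lambda>t. of_real r * (a * unit_loop t)) 0 = 1"
    and wb: "winding_number (\<lambda>t. of_real r * (b' * cnj (unit_loop t))) 0 = -1" if "r > 0" for r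
    using that winding_number_unit_loop[of "of_real r * a"] winding_number_cnj_unit_loop[of "of_real r * b'"]
    by (simp_all add: mult.assoc)
  obtain R where R: "R > 0" "\<And>r. 0 < r \<Longrightarrow> r < R \<Longrightarrow>
      winding_number (local_loop f r p) 0 = 1"
    using winding_number_local_loop[OF p(2) D(1) p(1) f(1), of "\<lambda>t. a * unit_loop t" 1] p(3) wa
    by (auto simp: norm_mult)
  obtain R' where R': "R' > 0" "\<And>r. 0 < r \<Longrightarrow> r < R' \<Longrightarrow>
      winding_number (local_loop f r q) 0 = - 1"
    using winding_number_local_loop[OF q(2) D(1) q(1) f(1), of "\<lambda>t. b' * cnj (unit_loop t)" "-1"] q(3) wb
    by (auto simp: norm_mult)
  obtain e where e: "e > 0" "(\<Union>x\<in>path_image g. cball x e) \<subseteq> D"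
    using compact_subset_open_imp_cball_epsilon_subset[OF compact_path_image[OF g(1)] D(1) g(2)] by blast
  \<comment> \<open>Small enough for both derivative estimates and for a tube about the path inside
    \<open>D\<close>; the half makes the comparison with \<open>R\<close> and \<open>R'\<close>
    strict.\<close>
  define r where "r = min e (min R R' / 2)"
  have r: "0 < r" "r < R" "r < R'" "r \<le> e" unfolding r_def using e R R' by auto
  have "cball (g s) r \<subseteq> D" if "s \<in> {0..1}" for s
    using e(2) that r(4) subset_cball[of r e "g s"] unfolding path_image_def by blast
  then have "winding_number (local_loop f r p) 0 = winding_number (local_loop f r q) 0"
    using winding_number_local_loop_path[OF f g(1) r(1)] g by simp
  then show False using R(2) R'(2) r by simp
qed

definition complex_of_vec :: "real^2 \<Rightarrow> complex" where
  "complex_of_vec v = Complex (v$1) (v$2)"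

definition vec_of_complex :: "complex \<Rightarrow> real^2" where
  "vec_of_complex z = vector [Re z, Im z]"

lemma complex_vec_inverse [simp]:
  "vec_of_complex (complex_of_vec v) = v" "complex_of_vec (vec_of_complex z) = z"
  by (simp_all add: complex_of_vec_def vec_of_complex_def vec_eq_iff forall_2)

lemma bounded_linear_complex_of_vec: "bounded_linear complex_of_vec"
  by (rule linear_conv_bounded_linear[THEN iffD1], rule linearI)
    (auto simp: complex_of_vec_def complex_eq_iff)

lemma bounded_linear_vec_of_complex: "bounded_linear vec_of_complex"
  by (rule linear_conv_bounded_linear[THEN iffD1], rule linearI)
    (auto simp: vec_of_complex_def vec_eq_iff forall_2)

theorem injective_orientation:
  fixes f :: "real^2 \<Rightarrow> real^2"
  assumes D: "open D" "connected D" and f: "continuous_on D f" "inj_on f D"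
    and p: "p \<in> D" "(f has_derivative ((*v) A)) (at p)" "det A > 0"
    and q: "q \<in> D" "(f has_derivative ((*v) B)) (at q)" "det B < 0"
  shows False
proof -
  let ?E = "vec_of_complex -` D"
  let ?F = "complex_of_vec \<circ> f \<circ> vec_of_complex"
  txt \<open>The complex-linear and antilinear parts of a real matrix.\<close>
  define \<kappa> \<mu> :: "real^2^2 \<Rightarrow> complex"
    where "\<kappa> M = Complex (M$1$1 + M$2$2) (M$2$1 - M$1$2) / 2"
      and "\<mu> M = Complex (M$1$1 - M$2$2) (M$2$1 + M$1$2) / 2" for M
  have lin: "complex_of_vec (M *v vec_of_complex z) = \<kappa> M * z + \<mu> M * cnj z" for M z
    by (simp add: complex_eq_iff complex_of_vec_def vec_of_complex_def matrix_vector_mult_def sum_2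
        \<kappa>_def \<mu>_def field_simps)
  \<comment> \<open>Hence the sign of the determinant decides which of the two parts
    dominates.\<close>
  have nrm: "(norm (\<kappa> M))\<^sup>2 - (norm (\<mu> M))\<^sup>2 = det M" for M
    unfolding cmod_power2 \<kappa>_def \<mu>_def det_2 by (simp add: field_simps power2_eq_square)
  have im: "complex_of_vec ` D = ?E"
    by (auto simp: image_iff) (metis complex_vec_inverse(2))
  have c1: "continuous_on S complex_of_vec" and c2: "continuous_on T vec_of_complex" for S T
    by (simp_all add: bounded_linear_complex_of_vec bounded_linear_vec_of_complex linear_continuous_on)
  have der: "(?F has_derivative (\<lambda>z. \<kappa> M * z + \<mu> M * cnj z)) (at (complex_of_vec x))"
    if "(f has_derivative ((*v) M)) (at x)" for M x
  proof -
    have "(f has_derivative ((*v) M)) (at (vec_of_complex (complex_of_vec x)))" using that by simp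
    then have "((\<lambda>z. f (vec_of_complex z)) has_derivative (\<lambda>z. M *v vec_of_complex z)) (at (complex_of_vec x))"
      by (rule has_derivative_compose[OF bounded_linear_imp_has_derivative[OF bounded_linear_vec_of_complex]])
    then have "((\<lambda>z. complex_of_vec (f (vec_of_complex z))) has_derivative (\<lambda>z. complex_of_vec (M *v vec_of_complex z)))
        (at (complex_of_vec x))"
      by (rule bounded_linear.has_derivative[OF bounded_linear_complex_of_vec])
    then show ?thesis by (simp add: lin o_def)
  qed
  have "open ?E" using D(1) c2[of UNIV] by (simp add: open_vimage)
  moreover have "connected ?E" unfolding im[symmetric] by (intro connected_continuous_image D c1)
  moreover have "continuous_on ?E ?F"
    by (intro continuous_on_compose c1 c2) (auto intro: continuous_on_subset[OF f(1)])
  moreover have "inj_on ?F ?E"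
    using f(2) unfolding inj_on_def by (auto dest!: arg_cong[of _ _ vec_of_complex]) (metis complex_vec_inverse(2))
  moreover have "complex_of_vec p \<in> ?E" "complex_of_vec q \<in> ?E" using p q by auto
  moreover have "norm (\<mu> A) < norm (\<kappa> A)" "norm (\<kappa> B) < norm (\<mu> B)"
    using nrm[of A] nrm[of B] p(3) q(3) by (auto intro: power2_less_imp_less)
  ultimately show False
    using injective_orientation_complex[of ?E ?F] der[OF p(2)] der[OF q(2)] by blast
qed

section \<open>The profile problem\<close>

locale profile_data =
  fixes \<Gamma> \<alpha> \<nu> u0 e0 :: real
  assumes pos: "\<Gamma> > 0" "\<alpha> > 0" "\<nu> > 0" "u0 > 0" "e0 > 0"
begin

section \<open>The right-hand side of the profile equations and its divided differences\<close>

definition field :: "real^2 \<Rightarrow> real \<times> real \<Rightarrow> real \<times> real" where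
  "field c x = (u0 / \<alpha> * (c$1 + fst x + \<Gamma> * (snd x / fst x)),
     u0 / \<nu> * (c$2 - c$1 * fst x - 1/2 * (fst x)^2 + snd x))"

text \<open>Exact divided differences of the right-hand side in the state and in \<open>c\<close>; at
  \<open>u = u'\<close> they are its partial derivatives.\<close>

definition field_dx :: "real^2 \<Rightarrow> real \<Rightarrow> real \<Rightarrow> real \<Rightarrow> real \<times> real \<Rightarrow> real \<times> real" where
  "field_dx c u u' e p = (u0 / \<alpha> * ((1 - \<Gamma> * (e / (u * u'))) * fst p + \<Gamma> / u' * snd p),
     u0 / \<nu> * (snd p - (c$1 + (u + u') / 2) * fst p))"

definition field_dc :: "real \<Rightarrow> real^2 \<Rightarrow> real \<times> real" where
  "field_dc u d = (u0 / \<alpha> * d$1, u0 / \<nu> * (d$2 - u * d$1))"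

text \<open>The state is changed first at fixed \<open>c\<close>, then \<open>c\<close> at the new
  state. As the identity has no remainder, the Lipschitz bound and strict differentiability both
  reduce to estimates of coefficients.\<close>

lemma field_diff:
  assumes "fst x > 0" "fst x' > 0"
  shows "field c' x' - field c x = field_dx c (fst x) (fst x') (snd x) (x' - x) + field_dc (fst x') (c' - c)"
proof -
  obtain u e u' e' where x: "x = (u, e)" "x' = (u', e')" by (metis prod.exhaust)
  have "\<Gamma> * (e' / u') - \<Gamma> * (e / u) = \<Gamma> / u' * (e' - e) - \<Gamma> * (e / (u * u')) * (u' - u)"
    using assms x by (simp add: field_simps)
  then have "(c'$1 + u' + \<Gamma> * (e' / u')) - (c$1 + u + \<Gamma> * (e / u))
      = (1 - \<Gamma> * (e / (u * u'))) * (u' - u) + \<Gamma> / u' * (e' - e) + (c'$1 - c$1)"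
    by (simp only: left_diff_distrib) simp
  then have 1: "u0 / \<alpha> * ((c'$1 + u' + \<Gamma> * (e' / u')) - (c$1 + u + \<Gamma> * (e / u)))
      = u0 / \<alpha> * ((1 - \<Gamma> * (e / (u * u'))) * (u' - u) + \<Gamma> / u' * (e' - e) + (c'$1 - c$1))"
    by simp
  have "(c'$2 - c'$1 * u' - 1/2 * u'^2 + e') - (c$2 - c$1 * u - 1/2 * u^2 + e)
      = (e' - e) - (c$1 + (u + u') / 2) * (u' - u) + ((c'$2 - c$2) - u' * (c'$1 - c$1))"
    by (simp add: field_simps power2_eq_square)
  then have 2: "u0 / \<nu> * ((c'$2 - c'$1 * u' - 1/2 * u'^2 + e') - (c$2 - c$1 * u - 1/2 * u^2 + e))
      = u0 / \<nu> * ((e' - e) - (c$1 + (u + u') / 2) * (u' - u) + ((c'$2 - c$2) - u' * (c'$1 - c$1)))"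
    by simp
  show ?thesis
    using 1 2 by (simp add: x field_def field_dx_def field_dc_def right_diff_distrib distrib_left)
qed

lemma norm_field_dx_le:
  assumes "0 < \<delta>" "\<delta> \<le> u" "u \<le> R" "\<delta> \<le> u'" "u' \<le> R" "\<bar>e\<bar> \<le> R"
  shows "norm (field_dx c u u' e p)
    \<le> (u0 / \<alpha> * (1 + \<Gamma> * R / \<delta>\<^sup>2 + \<Gamma> / \<delta>) + u0 / \<nu> * (1 + norm c + R)) * norm p"
proof -
  have "\<bar>e / (u * u')\<bar> \<le> R / \<delta>\<^sup>2"
    unfolding abs_divide power2_eq_square using assms
    by (intro frac_le) (auto simp: abs_mult intro!: mult_mono)
  then have 1: "\<bar>1 - \<Gamma> * (e / (u * u'))\<bar> \<le> 1 + \<Gamma> * R / \<delta>\<^sup>2"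
    using pos abs_triangle_ineq4[of 1 "\<Gamma> * (e / (u * u'))"] mult_left_mono[of "\<bar>e / (u * u')\<bar>" "R / \<delta>\<^sup>2" \<Gamma>]
    by (simp add: abs_mult)
  have 2: "\<bar>\<Gamma> / u'\<bar> \<le> \<Gamma> / \<delta>" using assms pos by (simp add: frac_le)
  have "\<bar>c$1\<bar> \<le> norm c" by (rule component_le_norm_cart)
  then have 3: "\<bar>c$1 + (u + u') / 2\<bar> \<le> norm c + R" unfolding abs_le_iff using assms by (auto simp: field_simps)
  have A: "\<bar>(1 - \<Gamma> * (e / (u * u'))) * fst p + \<Gamma> / u' * snd p\<bar> \<le> (1 + \<Gamma> * R / \<delta>\<^sup>2) * norm p + \<Gamma> / \<delta> * norm p"
    by (rule order_trans[OF abs_triangle_ineq])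
      (intro add_mono abs_mult_le 1 2 abs_fst_le_norm abs_snd_le_norm)
  have B: "\<bar>snd p - (c$1 + (u + u') / 2) * fst p\<bar> \<le> norm p + (norm c + R) * norm p"
    by (rule order_trans[OF abs_triangle_ineq4])
      (intro add_mono abs_mult_le 3 abs_fst_le_norm abs_snd_le_norm)
  have "norm (field_dx c u u' e p) \<le> u0 / \<alpha> * ((1 + \<Gamma> * R / \<delta>\<^sup>2) * norm p + \<Gamma> / \<delta> * norm p)
      + u0 / \<nu> * (norm p + (norm c + R) * norm p)"
    using pos A B by (intro order_trans[OF norm_Pair_le_sum] add_mono)
      (auto simp: field_dx_def abs_mult divide_right_mono mult_left_mono)
  then show ?thesis by (simp add: algebra_simps add_divide_distrib)
qed

lemma norm_field_dc_le:
  assumes "\<bar>u\<bar> \<le> R"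
  shows "norm (field_dc u d) \<le> (u0 / \<alpha> + u0 / \<nu> * (1 + R)) * norm d"
proof -
  have "\<bar>u * d$1\<bar> \<le> R * norm d"
    using assms component_le_norm_cart[of d 1] by (auto simp: abs_mult intro!: mult_mono)
  then have "\<bar>d$2 - u * d$1\<bar> \<le> norm d + R * norm d"
    using component_le_norm_cart[of d 2] abs_triangle_ineq4[of "d$2" "u * d$1"] by linarith
  then have "norm (field_dc u d) \<le> u0 / \<alpha> * norm d + u0 / \<nu> * (norm d + R * norm d)"
    using pos component_le_norm_cart[of d 1] by (intro order_trans[OF norm_Pair_le_sum] add_mono)
      (auto simp: field_dc_def abs_mult divide_right_mono mult_left_mono)
  then show ?thesis by (simp add: algebra_simps add_divide_distrib)
qed

text \<open>The factor in \<open>norm_field_dx_le\<close> with \<open>norm c\<close> replaced by an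
  upper bound \<open>M\<close>. The singularity at u = 0 enters through \<open>\<delta>\<close>, the
  lower bound on u.\<close>

definition field_lip :: "real \<Rightarrow> real \<Rightarrow> real \<Rightarrow> real" where
  "field_lip \<delta> R M = u0 / \<alpha> * (1 + \<Gamma> * R / \<delta>\<^sup>2 + \<Gamma> / \<delta>) + u0 / \<nu> * (1 + M + R)"

lemma field_lip_nonneg: "0 < \<delta> \<Longrightarrow> 0 \<le> R \<Longrightarrow> 0 \<le> M \<Longrightarrow> 0 \<le> field_lip \<delta> R M"
  unfolding field_lip_def using pos by (intro add_nonneg_nonneg mult_nonneg_nonneg divide_nonneg_nonneg) auto

lemma field_lipschitz:
  assumes "0 < \<delta>" "x \<in> cbox (\<delta>, -R) (R, R)" "y \<in> cbox (\<delta>, -R) (R, R)" "norm c \<le> M"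
  shows "norm (field c x - field c y) \<le> field_lip \<delta> R M * norm (x - y)"
proof -
  have "field c x - field c y = field_dx c (fst y) (fst x) (snd y) (x - y)"
    using field_diff[of y x c c] assms by (auto simp: cbox_Pair_eq field_dc_def zero_prod_def)
  also have "norm \<dots> \<le> field_lip \<delta> R (norm c) * norm (x - y)"
    unfolding field_lip_def using assms by (intro norm_field_dx_le) (auto simp: cbox_Pair_eq)
  also have "\<dots> \<le> field_lip \<delta> R M * norm (x - y)"
    unfolding field_lip_def using assms pos
    by (intro mult_right_mono add_mono mult_left_mono) auto
  finally show ?thesis .
qed

section \<open>Solutions on intervals, their uniqueness, and maximal solutions\<close>

definition solves :: "real^2 \<Rightarrow> real set \<Rightarrow> (real \<Rightarrow> real \<times> real) \<Rightarrow> bool" where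
  "solves c I X \<longleftrightarrow> is_interval I \<and> 0 \<in> I \<and> X 0 = (u0, e0) \<and>
    (\<forall>t\<in>I. fst (X t) > 0 \<and> (X has_vector_derivative field c (X t)) (at t within I))"

lemma profile_solution_iff:
  "profile_solution \<Gamma> \<alpha> \<nu> u0 e0 c I u e \<longleftrightarrow> solves c I (\<lambda>t. (u t, e t))"
proof -
  have "((\<lambda>t. (u t, e t)) has_vector_derivative (a, b)) F \<longleftrightarrow>
      (u has_real_derivative a) F \<and> (e has_real_derivative b) F" if "F = at t within I" for a b F t
  proof
    assume "((\<lambda>t. (u t, e t)) has_vector_derivative (a, b)) F"
    from bounded_linear.has_vector_derivative[OF bounded_linear_fst this]
      bounded_linear.has_vector_derivative[OF bounded_linear_snd this]
    show "(u has_real_derivative a) F \<and> (e has_real_derivative b) F"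
      by (simp add: has_real_derivative_iff_has_vector_derivative)
  next
    assume "(u has_real_derivative a) F \<and> (e has_real_derivative b) F"
    then show "((\<lambda>t. (u t, e t)) has_vector_derivative (a, b)) F"
      unfolding that using has_vector_derivative_real_Pair by blast
  qed
  then show ?thesis
    unfolding profile_solution_def solves_def field_def by auto
qed

lemma solves_continuous: "solves c I X \<Longrightarrow> continuous_on I X"
  unfolding solves_def by (rule continuous_on_solution) auto

lemma solves_subset:
  assumes "solves c I X" "J \<subseteq> I" "is_interval J" "0 \<in> J"
  shows "solves c J X"
  using assms unfolding solves_def
  by (auto intro!: has_vector_derivative_within_subset[OF _ assms(2)])

lemma compact_range_in_box:
  assumes "compact S" "continuous_on S (X :: real \<Rightarrow> real \<times> real)" "\<And>t. t \<in> S \<Longrightarrow> fst (X t) > 0"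
  obtains \<delta> R where "0 < \<delta>" "\<delta> \<le> R" "\<And>t. t \<in> S \<Longrightarrow> X t \<in> cbox (\<delta>, -R) (R, R)"
proof (cases "S = {}")
  case True then show thesis using that[of 1 1] by auto
next
  case False
  obtain s where s: "s \<in> S" "\<And>t. t \<in> S \<Longrightarrow> fst (X s) \<le> fst (X t)"
    using continuous_attains_inf[OF assms(1) False continuous_on_fst[OF assms(2)]] by blast
  obtain B where B: "\<And>t. t \<in> S \<Longrightarrow> norm (X t) \<le> B"
    using compact_imp_bounded[OF compact_continuous_image[OF assms(2,1)]] by (auto simp: bounded_iff)
  show thesis
  proof (rule that[of "fst (X s)" "B"])
    show "0 < fst (X s)" using assms(3) s by simp
    show "fst (X s) \<le> B" using B[OF s(1)] abs_fst_le_norm[of "X s"] by linarith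
    fix t assume t: "t \<in> S"
    show "X t \<in> cbox (fst (X s), - B) (B, B)"
      using B[OF t] s(2)[OF t] abs_fst_le_norm[of "X t"] abs_snd_le_norm[of "X t"]
      by (cases "X t") (auto simp: cbox_Pair_eq)
  qed
qed

text \<open>Both ranges are compact with u > 0, so one box away from u = 0 contains them and its
  Lipschitz constant applies. The common value may occur at any time \<open>s\<close>; this is later
  used backwards, from a zero of e to time 0.\<close>

lemma field_solution_unique:
  assumes X: "\<And>t. t \<in> {a..b} \<Longrightarrow> fst (X t) > 0 \<and> (X has_vector_derivative field c (X t)) (at t within {a..b})"
    and Y: "\<And>t. t \<in> {a..b} \<Longrightarrow> fst (Y t) > 0 \<and> (Y has_vector_derivative field c (Y t)) (at t within {a..b})"
    and s: "s \<in> {a..b}" "X s = Y s" and t: "t \<in> {a..b}"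
  shows "X t = Y t"
proof -
  have cont: "continuous_on {a..b} X" "continuous_on {a..b} Y"
    by (rule continuous_on_solution, use X Y in blast)+
  obtain \<delta> R where X': "0 < \<delta>" "\<delta> \<le> R" "\<And>t. t \<in> {a..b} \<Longrightarrow> X t \<in> cbox (\<delta>, -R) (R, R)"
    using compact_range_in_box[OF compact_Icc cont(1)] X by metis
  obtain \<delta>' R' where Y': "0 < \<delta>'" "\<delta>' \<le> R'" "\<And>t. t \<in> {a..b} \<Longrightarrow> Y t \<in> cbox (\<delta>', -R') (R', R')"
    using compact_range_in_box[OF compact_Icc cont(2)] Y by metis
  let ?\<delta> = "min \<delta> \<delta>'" and ?R = "max R R'"
  let ?K = "cbox (?\<delta>, - ?R) (?R, ?R)"
  show ?thesis
  proof (rule solution_unique[where K="?K" and G="field c" and L="field_lip ?\<delta> ?R (norm c)"])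
    show "X t \<in> ?K \<and> (X has_vector_derivative field c (X t)) (at t within {a..b})"
      "Y t \<in> ?K \<and> (Y has_vector_derivative field c (Y t)) (at t within {a..b})" if "t \<in> {a..b}" for t
      using X[OF that] Y[OF that] X'(3)[OF that] Y'(3)[OF that] by (auto simp: cbox_Pair_eq mem_Times_iff)
    show "norm (field c x - field c y) \<le> field_lip ?\<delta> ?R (norm c) * norm (x - y)" if "x \<in> ?K" "y \<in> ?K" for x y
      using X'(1) Y'(1) that by (intro field_lipschitz) auto
    show "0 \<le> field_lip ?\<delta> ?R (norm c)"
      using X'(1,2) Y'(1,2) by (intro field_lip_nonneg) auto
  qed (fact s t)+
qed

lemma solves_unique:
  assumes "solves c I X" "solves c J Y" "t \<in> I" "t \<in> J"
  shows "X t = Y t"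
proof -
  let ?S = "{min 0 t..max 0 t}"
  have sub: "{min 0 t..max 0 t} \<subseteq> A" if "is_interval A" "0 \<in> A" "t \<in> A" for A :: "real set"
  proof
    fix z assume "z \<in> {min 0 t..max 0 t}"
    then show "z \<in> A"
      using that mem_is_interval_1_I[of A 0 t z] mem_is_interval_1_I[of A t 0 z] by (cases "0 \<le> t") auto
  qed
  have sub: "?S \<subseteq> I" "?S \<subseteq> J"
    using assms sub[of I] sub[of J] unfolding solves_def by blast+
  have "solves c ?S X" "solves c ?S Y"
    using solves_subset[OF assms(1) sub(1)] solves_subset[OF assms(2) sub(2)] by (auto simp: is_interval_cc)
  then show ?thesis
    unfolding solves_def by (intro field_solution_unique[of "min 0 t" "max 0 t" X c Y 0 t]) auto
qed

text \<open>The value of the map is described through maximal solutions, so one has to exist.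
  Solutions agree where they overlap and glue to a solution on the union of all their domains, which
  admits no proper extension.\<close>

lemma maximal_solution_exists:
  assumes "solves c I X"
  shows "\<exists>J u e. maximal_profile_solution \<Gamma> \<alpha> \<nu> u0 e0 c J u e \<and> I \<subseteq> J"
proof -
  define Fam where "Fam = {J. \<exists>Y. solves c J Y}"
  define M where "M = \<Union>Fam"
  define Z where "Z t = (SOME z. \<exists>J Y. solves c J Y \<and> t \<in> J \<and> z = Y t)" for t
  have Z: "Z t = Y t" if "solves c J Y" "t \<in> J" for J Y t
  proof -
    have "\<exists>z. \<exists>J Y. solves c J Y \<and> t \<in> J \<and> z = Y t" using that by blast
    then obtain J' Y' where "solves c J' Y'" "t \<in> J'" "Z t = Y' t"
      using someI_ex[of "\<lambda>z. \<exists>J Y. solves c J Y \<and> t \<in> J \<and> z = Y t"] unfolding Z_def by blast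
    then show ?thesis using solves_unique that by metis
  qed
  have Fam: "is_interval J" "0 \<in> J" "J \<subseteq> M" if "J \<in> Fam" for J
    using that unfolding Fam_def M_def solves_def by auto
  have IF: "I \<in> Fam" using assms by (auto simp: Fam_def)
  have M: "is_interval M"
    unfolding is_interval_connected_1 M_def
  proof (rule connected_Union)
    show "connected J" if "J \<in> Fam" for J using Fam(1)[OF that] by (simp add: is_interval_connected_1)
    show "\<Inter>Fam \<noteq> {}" using Fam(2) by blast
  qed
  \<comment> \<open>A single member of \<open>Fam\<close> may end at \<open>t\<close> and so fail to
    be a neighbourhood of \<open>t\<close> in \<open>M\<close>. Therefore one member is found that
    covers \<open>M\<close> just to the right of \<open>t\<close>, and below another one that covers
    it just to the left.\<close>
  have right: "\<exists>J\<in>Fam. \<exists>\<epsilon>>0. t \<in> J \<and> M \<inter> {t..<t + \<epsilon>} \<subseteq> J" if t: "t \<in> M" for t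
  proof -
    obtain J where J: "J \<in> Fam" "t \<in> J" using t unfolding M_def by blast
    consider "t < 0" | "0 \<le> t" "\<exists>y\<in>M. t < y" | "\<forall>y\<in>M. y \<le> t" using leI by blast
    then show ?thesis
    proof cases
      case 1
      have "M \<inter> {t..<t + (- t)} \<subseteq> J" using mem_is_interval_1_I[OF Fam(1)[OF J(1)] J(2) Fam(2)[OF J(1)]] by auto
      then show ?thesis using J 1 by (intro bexI[of _ J] exI[of _ "- t"]) auto
    next
      case 2
      then obtain y K where y: "K \<in> Fam" "y \<in> K" "t < y" unfolding M_def by blast
      have "{0..y} \<subseteq> K" using mem_is_interval_1_I[OF Fam(1)[OF y(1)] Fam(2)[OF y(1)] y(2)] by auto
      then show ?thesis using y 2 by (intro bexI[of _ K] exI[of _ "y - t"]) auto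
    next
      case 3
      then have "M \<inter> {t..<t + 1} \<subseteq> {t}" by auto
      then show ?thesis using J by (intro bexI[of _ J] exI[of _ 1]) auto
    qed
  qed
  have left: "\<exists>J\<in>Fam. \<exists>\<epsilon>>0. t \<in> J \<and> M \<inter> {t - \<epsilon><..t} \<subseteq> J" if t: "t \<in> M" for t
  proof -
    obtain J where J: "J \<in> Fam" "t \<in> J" using t unfolding M_def by blast
    consider "t > 0" | "t \<le> 0" "\<exists>y\<in>M. y < t" | "\<forall>y\<in>M. t \<le> y" using leI by blast
    then show ?thesis
    proof cases
      case 1
      have "M \<inter> {t - t<..t} \<subseteq> J" using mem_is_interval_1_I[OF Fam(1)[OF J(1)] Fam(2)[OF J(1)] J(2)] by auto
      then show ?thesis using J 1 by (intro bexI[of _ J] exI[of _ t]) auto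
    next
      case 2
      then obtain y K where y: "K \<in> Fam" "y \<in> K" "y < t" unfolding M_def by blast
      have "{y..0} \<subseteq> K" using mem_is_interval_1_I[OF Fam(1)[OF y(1)] y(2) Fam(2)[OF y(1)]] by auto
      then show ?thesis using y 2 by (intro bexI[of _ K] exI[of _ "t - y"]) auto
    next
      case 3
      then have "M \<inter> {t - 1<..t} \<subseteq> {t}" by auto
      then show ?thesis using J by (intro bexI[of _ J] exI[of _ 1]) auto
    qed
  qed
  have derJ: "(Z has_vector_derivative field c (Z t)) (at t within J)" if J: "J \<in> Fam" "t \<in> J" for J t
  proof -
    obtain Y where Y: "solves c J Y" using J by (auto simp: Fam_def)
    then have "(Y has_vector_derivative field c (Z t)) (at t within J)"
      using Z[OF Y J(2)] J(2) unfolding solves_def by simp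
    then show ?thesis
      by (rule has_vector_derivative_transform[OF J(2), rotated]) (rule Z[OF Y])
  qed
  have "solves c M Z"
    unfolding solves_def
  proof (intro conjI ballI)
    show "is_interval M" by (rule M)
    show "0 \<in> M" using Fam[OF IF] by blast
    show "Z 0 = (u0, e0)" using Z[OF assms] assms by (auto simp: solves_def)
    fix t assume t: "t \<in> M"
    obtain J1 \<epsilon>1 where J1: "J1 \<in> Fam" "\<epsilon>1 > 0" "t \<in> J1" "M \<inter> {t..<t + \<epsilon>1} \<subseteq> J1" using right[OF t] by blast
    obtain J2 \<epsilon>2 where J2: "J2 \<in> Fam" "\<epsilon>2 > 0" "t \<in> J2" "M \<inter> {t - \<epsilon>2<..t} \<subseteq> J2" using left[OF t] by blast
    obtain Y where Y: "solves c J1 Y" using J1 by (auto simp: Fam_def)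
    show "0 < fst (Z t)" using Z[OF Y J1(3)] Y J1(3) by (auto simp: solves_def)
    have "(Z has_vector_derivative field c (Z t)) (at t within (J1 \<union> J2))"
      using derJ J1 J2 by (intro has_vector_derivative_Un) auto
    moreover have "at t within M = at t within (J1 \<union> J2)"
    proof (rule at_within_nhd)
      show "t \<in> {t - \<epsilon>2<..<t + \<epsilon>1}" using J1 J2 by auto
      show "M \<inter> {t - \<epsilon>2<..<t + \<epsilon>1} - {t} = (J1 \<union> J2) \<inter> {t - \<epsilon>2<..<t + \<epsilon>1} - {t}"
      proof -
        have "M \<inter> {t - \<epsilon>2<..<t + \<epsilon>1} \<subseteq> (M \<inter> {t..<t + \<epsilon>1}) \<union> (M \<inter> {t - \<epsilon>2<..t})"
          using linear[of t] by auto
        then have "M \<inter> {t - \<epsilon>2<..<t + \<epsilon>1} \<subseteq> J1 \<union> J2" using J1(4) J2(4) by blast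
        then show ?thesis using Fam(3)[OF J1(1)] Fam(3)[OF J2(1)] by blast
      qed
    qed auto
    ultimately show "(Z has_vector_derivative field c (Z t)) (at t within M)" by simp
  qed
  moreover have "J = M" if "solves c J Y" "M \<subseteq> J" for J Y
    using that Fam(3)[of J] by (auto simp: Fam_def)
  ultimately have "maximal_profile_solution \<Gamma> \<alpha> \<nu> u0 e0 c M (\<lambda>t. fst (Z t)) (\<lambda>t. snd (Z t))"
    unfolding maximal_profile_solution_def profile_solution_iff by (simp, blast)
  then show ?thesis using Fam(3)[OF IF] by blast
qed

section \<open>Feasible parameters, their flow, and continuity of the map\<close>

definition feasible :: "real^2 \<Rightarrow> (real \<Rightarrow> real \<times> real) \<Rightarrow> bool" where
  "feasible c X \<longleftrightarrow> solves c {0..1} X \<and> (\<forall>t\<in>{0..1}. snd (X t) > 0)"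

text \<open>Meaningful only for feasible \<open>c\<close>.\<close>

definition flow :: "real^2 \<Rightarrow> real \<Rightarrow> real \<times> real" where
  "flow c = (SOME X. feasible c X)"

abbreviation "Feas \<equiv> feasible_set \<Gamma> \<alpha> \<nu> u0 e0"

abbreviation "Psi \<equiv> cauchy_to_boundary \<Gamma> \<alpha> \<nu> u0 e0"

lemma feasible_iff: "c \<in> Feas \<longleftrightarrow> (\<exists>X. feasible c X)"
proof
  assume "c \<in> Feas"
  then obtain u e where "feasible c (\<lambda>t. (u t, e t))"
    unfolding feasible_set_def feasible_def profile_solution_iff by auto
  then show "\<exists>X. feasible c X" by blast
next
  assume "\<exists>X. feasible c X"
  then obtain X where "feasible c (\<lambda>t. (fst (X t), snd (X t)))" by auto
  then show "c \<in> Feas"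
    unfolding feasible_set_def feasible_def profile_solution_iff by (auto simp del: prod.collapse)
qed

lemma feasible_flow: "c \<in> Feas \<Longrightarrow> feasible c (flow c)"
  unfolding flow_def feasible_iff using someI_ex[of "feasible c"] by simp

lemma feasible_flow_eq: "feasible c X \<Longrightarrow> t \<in> {0..1} \<Longrightarrow> X t = flow c t"
  using solves_unique[of c "{0..1}" X "{0..1}" "flow c" t] feasible_flow[of c]
  unfolding feasible_iff feasible_def[of c] by blast

definition vec_of_pair :: "real \<times> real \<Rightarrow> real^2" where
  "vec_of_pair p = vector [fst p, snd p]"

lemma vec_of_pair_nth [simp]: "vec_of_pair p $ 1 = fst p" "vec_of_pair p $ 2 = snd p"
  by (simp_all add: vec_of_pair_def)

lemma inj_vec_of_pair: "vec_of_pair p = vec_of_pair q \<longleftrightarrow> p = q"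
  by (auto simp: vec_eq_iff forall_2 prod_eq_iff)

lemma bounded_linear_vec_of_pair: "bounded_linear vec_of_pair"
  by (rule linear_conv_bounded_linear[THEN iffD1], rule linearI) (auto simp: vec_eq_iff forall_2)

text \<open>Functions representing a maximal solution are arbitrary outside its interval and hence
  not unique. The definite description ranges over the value at 1 only, and that value is determined
  by uniqueness on [0,1].\<close>

lemma Psi_eq_flow:
  assumes "c \<in> Feas"
  shows "Psi c = vec_of_pair (flow c 1)"
  unfolding cauchy_to_boundary_def
proof (rule the_equality)
  have s: "solves c {0..1} (flow c)" using feasible_flow[OF assms] by (simp add: feasible_def)
  have val: "vector [u 1, e 1] = vec_of_pair (flow c 1)"
    if "maximal_profile_solution \<Gamma> \<alpha> \<nu> u0 e0 c I u e" "1 \<in> I" for I u e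
  proof -
    have "solves c I (\<lambda>t. (u t, e t))"
      using that by (simp add: maximal_profile_solution_def profile_solution_iff)
    then have "(u 1, e 1) = flow c 1" using solves_unique[OF _ s that(2)] by simp
    from this[symmetric] show ?thesis by (simp add: vec_of_pair_def)
  qed
  obtain I u e where "maximal_profile_solution \<Gamma> \<alpha> \<nu> u0 e0 c I u e" "{0..1} \<subseteq> I"
    using maximal_solution_exists[OF s] by blast
  moreover have "1 \<in> I" using \<open>{0..1} \<subseteq> I\<close> by (rule subsetD) simp
  ultimately have "maximal_profile_solution \<Gamma> \<alpha> \<nu> u0 e0 c I u e \<and> 1 \<in> I \<and> vec_of_pair (flow c 1) = vector [u 1, e 1]"
    using val[of I u e] by simp
  then show "\<exists>I u e. maximal_profile_solution \<Gamma> \<alpha> \<nu> u0 e0 c I u e \<and> 1 \<in> I \<and> vec_of_pair (flow c 1) = vector [u 1, e 1]"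
    by blast
  fix b :: "real^2" assume "\<exists>I u e. maximal_profile_solution \<Gamma> \<alpha> \<nu> u0 e0 c I u e \<and> 1 \<in> I \<and> b = vector [u 1, e 1]"
  then show "b = vec_of_pair (flow c 1)" by (elim exE conjE) (simp add: val)
qed

lemma flow_range:
  assumes "c \<in> Feas"
  obtains m R where "0 < m" "m \<le> R" "\<And>t. t \<in> {0..1} \<Longrightarrow> flow c t \<in> cbox (m, m) (R, R)"
proof -
  have f: "feasible c (flow c)" using feasible_flow[OF assms] .
  then have cont: "continuous_on {0..1} (flow c)" using solves_continuous unfolding feasible_def by blast
  \<comment> \<open>\<open>compact_range_in_box\<close> bounds the first component away from 0; with
    the components swapped it gives a positive lower bound for e.\<close>
  have swap: "continuous_on {0..1} (\<lambda>t. (snd (flow c t), fst (flow c t)))"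
    using cont by (intro continuous_on_Pair continuous_on_fst continuous_on_snd)
  have p1: "fst (flow c t) > 0" and p2: "fst (snd (flow c t), fst (flow c t)) > 0" if "t \<in> {0..1}" for t
    using f that unfolding feasible_def solves_def fst_conv by blast+
  obtain \<delta>' R' where 2: "0 < \<delta>'" "\<delta>' \<le> R'"
      "\<And>t. t \<in> {0..1} \<Longrightarrow> (snd (flow c t), fst (flow c t)) \<in> cbox (\<delta>', -R') (R', R')"
    using compact_range_in_box[OF compact_Icc swap p2] by blast
  obtain \<delta> R where 1: "0 < \<delta>" "\<delta> \<le> R" "\<And>t. t \<in> {0..1} \<Longrightarrow> flow c t \<in> cbox (\<delta>, -R) (R, R)"
    using compact_range_in_box[OF compact_Icc cont p1] by blast
  show thesis
  proof (rule that[of "min \<delta> \<delta>'" "max R R'"])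
    fix t :: real assume "t \<in> {0..1}"
    from 1(3)[OF this] 2(3)[OF this] show "flow c t \<in> cbox (min \<delta> \<delta>', min \<delta> \<delta>') (max R R', max R R')"
      by (auto simp: cbox_Pair_eq mem_Times_iff)
  qed (use 1 2 in auto)
qed

text \<open>Serves both openness of \<open>Feas\<close> and continuity of the flow: the perturbed
  solution stays so close to the given one that it inherits positivity.\<close>

lemma flow_near:
  assumes c0: "c0 \<in> Feas" and \<epsilon>: "\<epsilon> > 0"
  shows "\<exists>\<rho>>0. \<forall>c. dist c0 c < \<rho> \<longrightarrow> c \<in> Feas \<and> (\<forall>t\<in>{0..1}. dist (flow c0 t) (flow c t) < \<epsilon>)"
proof -
  obtain m R where mR: "0 < m" "m \<le> R" "\<And>t. t \<in> {0..1} \<Longrightarrow> flow c0 t \<in> cbox (m, m) (R, R)"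
    using flow_range[OF c0] by blast
  \<comment> \<open>In a tube of radius \<open>\<eta>\<close> about the given solution u and e are
    still at least \<open>m / 2\<close>. Half of epsilon is taken because the final estimate is
    strict.\<close>
  define \<delta> R' \<eta> where "\<delta> = m / 2" and "R' = R + m" and "\<eta> = min (m / 2) (\<epsilon> / 2)"
  define L where "L = field_lip \<delta> R' (norm c0 + 1)"
  define M where "M = u0 / \<alpha> + u0 / \<nu> * (1 + R')"
  have M: "M > 0" unfolding M_def using pos mR by (simp add: R'_def add_pos_pos)
  have \<eta>: "\<eta> > 0" "\<eta> < \<epsilon>" "\<eta> \<le> m / 2" using mR \<epsilon> by (auto simp: \<eta>_def)
  \<comment> \<open>Here \<open>M\<close> is the Lipschitz constant in \<open>c\<close>, and the
    second bound keeps the Gronwall estimate \<open>M * norm (c - c0) * exp (L + 1)\<close> within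
    \<open>\<eta>\<close>. The bound 1 makes \<open>L\<close> valid for all these
    \<open>c\<close>.\<close>
  define \<rho> where "\<rho> = min 1 (\<eta> / (M * exp (L + 1)))"
  have L: "L \<ge> 0" unfolding L_def using mR by (intro field_lip_nonneg) (auto simp: \<delta>_def R'_def)
  have \<rho>: "\<rho> > 0" using \<eta> M by (simp add: \<rho>_def)
  let ?K = "cbox (\<delta>, - R') (R', R')"
  have f0: "feasible c0 (flow c0)" using feasible_flow[OF c0] .
  have coord: "\<bar>fst x - fst y\<bar> \<le> r \<and> \<bar>snd x - snd y\<bar> \<le> r" if "norm (x - y) \<le> r" for x y :: "real \<times> real" and r
    using that abs_fst_le_norm[of "x - y"] abs_snd_le_norm[of "x - y"] by simp
  have "c \<in> Feas \<and> (\<forall>t\<in>{0..1}. dist (flow c0 t) (flow c t) < \<epsilon>)" if c: "dist c0 c < \<rho>" for c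
  proof -
    have nc: "norm (c - c0) < \<rho>" using c by (simp add: dist_norm norm_minus_commute)
    have bd: "M * norm (c - c0) * exp (L + 1) \<le> \<eta>"
    proof -
      have "norm (c - c0) \<le> \<eta> / (M * exp (L + 1))" using nc by (simp add: \<rho>_def)
      then have "norm (c - c0) * (M * exp (L + 1)) \<le> \<eta>" using M by (simp add: pos_le_divide_eq)
      then show ?thesis by (simp add: algebra_simps)
    qed
    have "\<exists>X. X 0 = flow c0 0 \<and> (\<forall>t\<in>{0..1}. (X has_vector_derivative field c (X t)) (at t within {0..1}) \<and>
        norm (X t - flow c0 t) \<le> M * norm (c - c0) * exp (L + 1))"
    proof (rule perturbed_solution[where G=field and ?c0.0=c0 and c=c and K="?K" and L=L
          and ?X0.0="flow c0" and \<eta>=\<eta> and \<beta>="M * norm (c - c0)"])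
      show "norm (field c x - field c y) \<le> L * norm (x - y)" if "x \<in> ?K" "y \<in> ?K" for x y
      proof -
        have "norm c \<le> norm c0 + 1" using nc norm_triangle_sub[of c c0] by (simp add: \<rho>_def)
        then show ?thesis unfolding L_def using that mR by (intro field_lipschitz) (auto simp: \<delta>_def)
      qed
      show "norm (field c x - field c0 x) \<le> M * norm (c - c0)" if "x \<in> ?K" for x
      proof -
        have "0 < fst x" "\<bar>fst x\<bar> \<le> R'" using that mR by (auto simp: cbox_Pair_eq mem_Times_iff \<delta>_def)
        moreover then have "field c x - field c0 x = field_dc (fst x) (c - c0)"
          using field_diff[of x x c c0] by (simp add: field_dx_def zero_prod_def)
        ultimately show ?thesis unfolding M_def using norm_field_dc_le by simp
      qed
      show "cball (flow c0 t) \<eta> \<subseteq> ?K" if "t \<in> {0..1}" for t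
      proof
        fix y assume "y \<in> cball (flow c0 t) \<eta>"
        then have "norm (flow c0 t - y) \<le> \<eta>" by (simp add: dist_norm)
        from coord[OF this] show "y \<in> ?K"
          using mR(1,2) mR(3)[OF that] \<eta> unfolding cbox_Pair_eq mem_Times_iff \<delta>_def R'_def
          by (auto simp: abs_le_iff)
      qed
      show "(flow c0 has_vector_derivative field c0 (flow c0 t)) (at t within {0..1})" if "t \<in> {0..1}" for t
        using f0 that unfolding feasible_def solves_def by blast
      show "convex ?K" "closed ?K" "0 \<le> L" "0 < \<eta>" "M * norm (c - c0) * exp (L + 1) \<le> \<eta>"
        using L \<eta> bd by (simp_all add: closed_cbox)
      fix X assume "X 0 = flow c0 0"
        "\<And>t. t \<in> {0..1} \<Longrightarrow> (X has_vector_derivative field c (X t)) (at t within {0..1})"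
        "\<And>t. t \<in> {0..1} \<Longrightarrow> norm (X t - flow c0 t) \<le> M * norm (c - c0) * exp (L + 1)"
      then show "\<exists>X. X 0 = flow c0 0 \<and> (\<forall>t\<in>{0..1}. (X has_vector_derivative field c (X t)) (at t within {0..1}) \<and>
        norm (X t - flow c0 t) \<le> M * norm (c - c0) * exp (L + 1))" by blast
    qed
    then obtain X where X: "X 0 = flow c0 0"
      "\<And>t. t \<in> {0..1} \<Longrightarrow> (X has_vector_derivative field c (X t)) (at t within {0..1})"
      "\<And>t. t \<in> {0..1} \<Longrightarrow> norm (X t - flow c0 t) \<le> M * norm (c - c0) * exp (L + 1)" by blast
    have close: "norm (X t - flow c0 t) \<le> \<eta>" if "t \<in> {0..1}" for t using X(3)[OF that] bd by linarith
    have "feasible c X"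
      unfolding feasible_def solves_def
    proof (intro conjI ballI)
      show "X 0 = (u0, e0)" using X(1) f0 by (simp add: feasible_def solves_def)
      fix t :: real assume t: "t \<in> {0..1}"
      show "fst (X t) > 0" "snd (X t) > 0"
        using coord[OF close[OF t]] mR(1) mR(3)[OF t] \<eta> by (auto simp: cbox_Pair_eq mem_Times_iff abs_le_iff)
      show "(X has_vector_derivative field c (X t)) (at t within {0..1})" by (rule X(2)[OF t])
    qed (auto simp: is_interval_cc)
    then have "c \<in> Feas" and eq: "\<And>t. t \<in> {0..1} \<Longrightarrow> X t = flow c t"
      using feasible_iff feasible_flow_eq by blast+
    moreover have "dist (flow c0 t) (flow c t) < \<epsilon>" if "t \<in> {0..1}" for t
      using close[OF that] eq[OF that] \<eta>(2) by (simp add: dist_norm norm_minus_commute)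
    ultimately show ?thesis by blast
  qed
  then show ?thesis using \<rho> by blast
qed

lemma open_Feas: "open Feas"
  unfolding open_contains_ball subset_iff mem_ball using flow_near[OF _ zero_less_one] by meson

lemma continuous_Psi: "continuous_on Feas Psi"
proof -
  have "isCont (\<lambda>c. flow c 1) c" if "c \<in> Feas" for c
    unfolding continuous_at_eps_delta
  proof (intro allI impI)
    fix \<epsilon> :: real assume "\<epsilon> > 0"
    from flow_near[OF that this] obtain \<rho> where "\<rho> > 0"
      "\<And>c'. dist c c' < \<rho> \<Longrightarrow> (\<forall>t\<in>{0..1}. dist (flow c t) (flow c' t) < \<epsilon>)" by blast
    then show "\<exists>d>0. \<forall>x'. dist x' c < d \<longrightarrow> dist (flow x' 1) (flow c 1) < \<epsilon>"
      by (intro exI[of _ \<rho>]) (auto simp: dist_commute)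
  qed
  then have "continuous_on Feas (\<lambda>c. vec_of_pair (flow c 1))"
    by (intro bounded_linear.continuous_on[OF bounded_linear_vec_of_pair] continuous_at_imp_continuous_on) auto
  then show ?thesis by (rule continuous_on_eq) (simp add: Psi_eq_flow)
qed

section \<open>Strict differentiability of the flow and of the map\<close>

lemma linear_field_dx: "linear (field_dx c u u' e)"
  by (rule linearI) (auto simp: field_dx_def algebra_simps add_divide_distrib)

lemma linear_field_dc: "linear (field_dc u)"
  by (rule linearI) (auto simp: field_dc_def algebra_simps add_divide_distrib)

text \<open>The coefficients e/(u u') and 1/u' are the only ones that are not polynomial, so
  closeness is assumed for them directly; the remaining coefficients are affine in
  \<open>c$1\<close>, u and u'.\<close>

lemma field_dx_diff_le:
  assumes "\<bar>e / (u * u') - e2 / (v * v)\<bar> \<le> \<epsilon>" "\<bar>1 / u' - 1 / v\<bar> \<le> \<epsilon>"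
    and "\<bar>c$1 - c2$1\<bar> \<le> \<epsilon>" "\<bar>u - v\<bar> \<le> \<epsilon>" "\<bar>u' - v\<bar> \<le> \<epsilon>"
  shows "norm (field_dx c u u' e p - field_dx c2 v v e2 p) \<le> (2 * \<Gamma> * u0 / \<alpha> + 2 * u0 / \<nu>) * \<epsilon> * norm p"
proof -
  have 1: "fst (field_dx c u u' e p - field_dx c2 v v e2 p)
      = u0 / \<alpha> * \<Gamma> * ((1 / u' - 1 / v) * snd p - (e / (u * u') - e2 / (v * v)) * fst p)"
    by (simp add: field_dx_def algebra_simps)
  have "(snd p - (c$1 + (u + u') / 2) * fst p) - (snd p - (c2$1 + (v + v) / 2) * fst p)
      = ((v - u) / 2 + (v - u') / 2 - (c$1 - c2$1)) * fst p"
    by (simp add: field_simps)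
  then have 2: "snd (field_dx c u u' e p - field_dx c2 v v e2 p)
      = u0 / \<nu> * (((v - u) / 2 + (v - u') / 2 - (c$1 - c2$1)) * fst p)"
    unfolding field_dx_def snd_diff snd_conv right_diff_distrib[symmetric]
    by simp
  have "\<bar>(1 / u' - 1 / v) * snd p - (e / (u * u') - e2 / (v * v)) * fst p\<bar> \<le> \<epsilon> * norm p + \<epsilon> * norm p"
    by (rule order_trans[OF abs_triangle_ineq4])
      (intro add_mono abs_mult_le assms abs_fst_le_norm abs_snd_le_norm)
  then have A: "\<bar>fst (field_dx c u u' e p - field_dx c2 v v e2 p)\<bar> \<le> u0 / \<alpha> * \<Gamma> * (\<epsilon> * norm p + \<epsilon> * norm p)"
    unfolding 1 using pos by (intro abs_mult_left_le) auto
  have "\<bar>(v - u) / 2 + (v - u') / 2 - (c$1 - c2$1)\<bar> \<le> 2 * \<epsilon>" using assms(3-5) unfolding abs_le_iff by (auto simp: field_simps)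
  then have "\<bar>((v - u) / 2 + (v - u') / 2 - (c$1 - c2$1)) * fst p\<bar> \<le> 2 * \<epsilon> * norm p"
    by (intro abs_mult_le abs_fst_le_norm)
  then have B: "\<bar>snd (field_dx c u u' e p - field_dx c2 v v e2 p)\<bar> \<le> u0 / \<nu> * (2 * \<epsilon> * norm p)"
    unfolding 2 using pos by (intro abs_mult_left_le) auto
  show ?thesis
    using order_trans[OF norm_Pair_le_sum add_mono[OF A B]] by (simp add: algebra_simps)
qed

lemma field_dc_diff_le:
  assumes "\<bar>u - v\<bar> \<le> \<epsilon>"
  shows "norm (field_dc u d - field_dc v d) \<le> u0 / \<nu> * \<epsilon> * norm d"
proof -
  have "norm (field_dc u d - field_dc v d) \<le> \<bar>u0 / \<nu> * ((v - u) * d$1)\<bar>"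
  proof -
    have "snd (field_dc u d - field_dc v d) = u0 / \<nu> * ((v - u) * d$1)"
      unfolding field_dc_def snd_diff snd_conv right_diff_distrib[symmetric] by (simp add: algebra_simps)
    moreover have "fst (field_dc u d - field_dc v d) = 0" by (simp add: field_dc_def)
    ultimately show ?thesis using norm_Pair_le_sum[of "field_dc u d - field_dc v d"] by simp
  qed
  also have "\<bar>(v - u) * d$1\<bar> \<le> \<epsilon> * norm d"
    using assms by (intro abs_mult_le component_le_norm_cart) (simp add: abs_minus_commute)
  then have "\<bar>u0 / \<nu> * ((v - u) * d$1)\<bar> \<le> u0 / \<nu> * (\<epsilon> * norm d)"
    using pos by (intro abs_mult_left_le) auto
  finally show ?thesis by (simp add: mult.assoc)
qed

text \<open>By \<open>field_diff\<close> the remainder is exactly the change of the coefficients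
  from the base point to the actual points. Their uniform continuity on a compact box gives one
  radius for all \<open>y\<close>.\<close>

lemma field_strict:
  assumes R: "0 < m" "m \<le> R" and \<epsilon>: "\<epsilon> > 0"
  shows "\<exists>\<rho>>0. \<forall>y\<in>cbox (m, m) (R, R). \<forall>c c' x x'.
      dist c0 c < \<rho> \<longrightarrow> dist c0 c' < \<rho> \<longrightarrow> dist y x < \<rho> \<longrightarrow> dist y x' < \<rho> \<longrightarrow>
      norm (field c' x' - field c x - (field_dx c0 (fst y) (fst y) (snd y) (x' - x) + field_dc (fst y) (c' - c)))
        \<le> \<epsilon> * (norm (x' - x) + norm (c' - c))"
proof -
  define K where "K = 2 * \<Gamma> * u0 / \<alpha> + 2 * u0 / \<nu>"
  have K: "K > 0" "u0 / \<nu> \<le> K" unfolding K_def using pos by (auto intro!: add_nonneg_pos simp: field_simps)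
  define \<epsilon>' where "\<epsilon>' = \<epsilon> / K"
  have \<epsilon>': "\<epsilon>' > 0" "K * \<epsilon>' = \<epsilon>" using \<epsilon> K by (auto simp: \<epsilon>'_def)
  \<comment> \<open>A margin of at least \<open>m / 2\<close> around the given box keeps the
    perturbed triples (u, u', e) in \<open>Q\<close> and the denominators away from 0. The three
    coordinates account for the bound \<open>d / 3\<close> on the radius below.\<close>
  define Q where "Q = cbox (m / 2, m / 2, 0) (R + m, R + m, R + m)"
  define q where "q = (\<lambda>z :: real \<times> real \<times> real. (snd (snd z) / (fst z * fst (snd z)), 1 / fst (snd z)))"
  have "continuous_on Q q"
    unfolding q_def Q_def using R by (intro continuous_intros) (auto simp: cbox_Pair_eq mem_Times_iff)
  then have "uniformly_continuous_on Q q"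
    by (rule compact_uniformly_continuous) (simp add: Q_def compact_cbox)
  then obtain d where d: "d > 0" "\<And>z w. z \<in> Q \<Longrightarrow> w \<in> Q \<Longrightarrow> dist w z < d \<Longrightarrow> dist (q w) (q z) < \<epsilon>'"
    unfolding uniformly_continuous_on_def using \<epsilon>'(1) by metis
  define \<rho> where "\<rho> = min (min \<epsilon>' (m / 2)) (d / 3)"
  have \<rho>: "\<rho> > 0" "\<rho> \<le> \<epsilon>'" "\<rho> \<le> m / 2" "\<rho> \<le> d / 3" using d R \<epsilon>' by (auto simp: \<rho>_def)
  have "norm (field c' x' - field c x - (field_dx c0 (fst y) (fst y) (snd y) (x' - x) + field_dc (fst y) (c' - c)))
        \<le> \<epsilon> * (norm (x' - x) + norm (c' - c))"
    if y: "y \<in> cbox (m, m) (R, R)" and c: "dist c0 c < \<rho>" and x: "dist y x < \<rho>" "dist y x' < \<rho>" for y c c' x x'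
  proof -
    obtain v e2 u e u' e' where eqs: "y = (v, e2)" "x = (u, e)" "x' = (u', e')" by (metis prod.exhaust)
    have co: "\<bar>v - u\<bar> < \<rho>" "\<bar>e2 - e\<bar> < \<rho>" "\<bar>v - u'\<bar> < \<rho>"
      using x abs_fst_le_norm[of "y - x"] abs_snd_le_norm[of "y - x"] abs_fst_le_norm[of "y - x'"]
      by (auto simp: eqs dist_norm)
    have bounds: "m \<le> v" "v \<le> R" "m \<le> e2" "e2 \<le> R" using y by (auto simp: eqs cbox_Pair_eq)
    have inQ: "(v, v, e2) \<in> Q" "(u, u', e) \<in> Q"
      using bounds co \<rho>(3) R by (auto simp: Q_def cbox_Pair_eq)
    have "dist (u, u', e) (v, v, e2) \<le> \<bar>u - v\<bar> + (\<bar>u' - v\<bar> + \<bar>e - e2\<bar>)"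
      unfolding dist_norm using norm_Pair_le[of "u - v" "(u' - v, e - e2)"] norm_Pair_le[of "u' - v" "e - e2"] by simp
    also have "\<dots> < d" using co \<rho>(4) by linarith
    finally have "dist (q (u, u', e)) (q (v, v, e2)) < \<epsilon>'" using d(2) inQ by blast
    then have q: "\<bar>e / (u * u') - e2 / (v * v)\<bar> \<le> \<epsilon>'" "\<bar>1 / u' - 1 / v\<bar> \<le> \<epsilon>'"
      using abs_fst_le_norm[of "q (u, u', e) - q (v, v, e2)"] abs_snd_le_norm[of "q (u, u', e) - q (v, v, e2)"]
      by (auto simp: q_def dist_norm)
    have "\<bar>c$1 - c0$1\<bar> \<le> \<epsilon>'"
      using c \<rho>(2) component_le_norm_cart[of "c - c0" 1] by (simp add: dist_norm norm_minus_commute)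
    then have 1: "norm (field_dx c u u' e (x' - x) - field_dx c0 v v e2 (x' - x)) \<le> K * \<epsilon>' * norm (x' - x)"
      unfolding K_def using q co \<rho>(2) by (intro field_dx_diff_le) auto
    have "norm (field_dc u' (c' - c) - field_dc v (c' - c)) \<le> u0 / \<nu> * \<epsilon>' * norm (c' - c)"
      using co \<rho>(2) by (intro field_dc_diff_le) auto
    also have "\<dots> \<le> K * \<epsilon>' * norm (c' - c)"
      using K \<epsilon>'(1) by (intro mult_right_mono) auto
    finally have 2: "norm (field_dc u' (c' - c) - field_dc v (c' - c)) \<le> K * \<epsilon>' * norm (c' - c)" .
    have pos': "fst x > 0" "fst x' > 0" using bounds co \<rho>(3) R by (auto simp: eqs)
    have "field c' x' - field c x - (field_dx c0 v v e2 (x' - x) + field_dc v (c' - c))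
      = (field_dx c u u' e (x' - x) - field_dx c0 v v e2 (x' - x)) + (field_dc u' (c' - c) - field_dc v (c' - c))"
      unfolding field_diff[OF pos'] by (simp add: eqs add_diff_add)
    then have "norm (field c' x' - field c x - (field_dx c0 v v e2 (x' - x) + field_dc v (c' - c)))
      \<le> K * \<epsilon>' * norm (x' - x) + K * \<epsilon>' * norm (c' - c)"
      using norm_triangle_mono[OF 1 2] by (simp only:)
    then show ?thesis unfolding \<epsilon>'(2) by (simp add: eqs distrib_left)
  qed
  then show ?thesis using \<rho>(1) by (intro exI[of _ \<rho>]) blast
qed

lemma flow_strict_derivative:
  assumes c0: "c0 \<in> Feas"
  obtains Y where "linear Y"
    "\<And>\<epsilon>. \<epsilon> > 0 \<Longrightarrow> \<exists>\<rho>>0. \<forall>c c'. dist c0 c < \<rho> \<longrightarrow> dist c0 c' < \<rho> \<longrightarrow>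
        norm (flow c' 1 - flow c 1 - Y (c' - c)) \<le> \<epsilon> * norm (c' - c)"
proof -
  obtain m R where R: "0 < m" "m \<le> R" and range: "\<And>t. t \<in> {0..1} \<Longrightarrow> flow c0 t \<in> cbox (m, m) (R, R)"
    using flow_range[OF c0] by blast
  have rng: "m \<le> fst (flow c0 t)" "fst (flow c0 t) \<le> R" "\<bar>snd (flow c0 t)\<bar> \<le> R" if "t \<in> {0..1}" for t
    using range[OF that] R by (auto simp: cbox_Pair_eq mem_Times_iff)
  define A where "A t = field_dx c0 (fst (flow c0 t)) (fst (flow c0 t)) (snd (flow c0 t))" for t
  define B where "B t = field_dc (fst (flow c0 t))" for t
  define M1 where "M1 = u0 / \<alpha> * (1 + \<Gamma> * R / m\<^sup>2 + \<Gamma> / m) + u0 / \<nu> * (1 + norm c0 + R)"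
  define M2 where "M2 = u0 / \<alpha> + u0 / \<nu> * (1 + R)"
  have sol: "feasible c (flow c)" if "c \<in> Feas" for c using feasible_flow[OF that] .
  have cont: "continuous_on {0..1} (flow c0)"
    using solves_continuous sol[OF c0] unfolding feasible_def by blast
  have boundA: "norm (A t x) \<le> max M1 M2 * norm x" if "t \<in> {0..1}" for t x
  proof -
    have "norm (A t x) \<le> M1 * norm x" unfolding A_def M1_def using R rng[OF that] by (intro norm_field_dx_le)
    also have "\<dots> \<le> max M1 M2 * norm x" by (intro mult_right_mono) auto
    finally show ?thesis .
  qed
  have boundB: "norm (B t d) \<le> max M1 M2 * norm d" if "t \<in> {0..1}" for t d
  proof -
    have "norm (B t d) \<le> M2 * norm d" unfolding B_def M2_def using R rng[OF that] by (intro norm_field_dc_le) auto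
    also have "\<dots> \<le> max M1 M2 * norm d" by (intro mult_right_mono) auto
    finally show ?thesis .
  qed
  have contA: "continuous_on ({0..1} \<times> UNIV) (\<lambda>(t, x). A t x)"
  proof -
    have f: "continuous_on ({0..1} \<times> UNIV) (\<lambda>z :: real \<times> (real \<times> real). flow c0 (fst z))"
      by (rule continuous_on_compose2[OF cont continuous_on_fst[OF continuous_on_id]]) auto
    have g: "continuous_on ({0..1} \<times> UNIV) (\<lambda>z :: real \<times> (real \<times> real). snd z)"
      by (rule continuous_on_snd[OF continuous_on_id])
    have nz: "\<forall>z \<in> {0..1} \<times> (UNIV :: (real \<times> real) set). fst (flow c0 (fst z)) \<noteq> 0"
      using rng(1) R(1) by fastforce
    show ?thesis
      unfolding A_def field_dx_def split_def using nz
      by (intro continuous_on_Pair continuous_on_mult continuous_on_add continuous_on_diff continuous_on_divide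
          continuous_on_const continuous_on_fst[OF f] continuous_on_snd[OF f] continuous_on_fst[OF g] continuous_on_snd[OF g])
        auto
  qed
  have contB: "continuous_on {0..1} (\<lambda>t. B t d)" for d
    unfolding B_def field_dc_def
    by (intro continuous_on_Pair continuous_on_mult continuous_on_diff continuous_on_const continuous_on_fst[OF cont])
  show thesis
  proof (rule solution_strict_derivative[where U=Feas and X=flow and G=field and ?c0.0=c0 and a="(u0, e0)"
        and A=A and B=B and M="max M1 M2"])
    show "(flow c has_vector_derivative field c (flow c t)) (at t within {0..1})" if "c \<in> Feas" "t \<in> {0..1}" for c t
      using sol[OF that(1)] that(2) unfolding feasible_def solves_def by blast
    show "flow c 0 = (u0, e0)" if "c \<in> Feas" for c
      using sol[OF that(1)] unfolding feasible_def solves_def by blast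
    show "open Feas" "c0 \<in> Feas" by (rule open_Feas, rule c0)
    show "\<exists>\<rho>>0. \<forall>c\<in>Feas. dist c0 c < \<rho> \<longrightarrow> (\<forall>t\<in>{0..1}. dist (flow c0 t) (flow c t) < \<epsilon>)" if "\<epsilon> > 0" for \<epsilon>
      using flow_near[OF c0 that] by blast
    show "linear (A t)" "linear (B t)" for t unfolding A_def B_def by (rule linear_field_dx, rule linear_field_dc)
    show "\<exists>\<rho>>0. \<forall>t\<in>{0..1}. \<forall>c c' x x'.
        dist c0 c < \<rho> \<longrightarrow> dist c0 c' < \<rho> \<longrightarrow> dist (flow c0 t) x < \<rho> \<longrightarrow> dist (flow c0 t) x' < \<rho> \<longrightarrow>
        norm (field c' x' - field c x - (A t (x' - x) + B t (c' - c))) \<le> \<epsilon> * (norm (x' - x) + norm (c' - c))"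
      if \<epsilon>: "\<epsilon> > 0" for \<epsilon>
    proof -
      obtain \<rho> where "\<rho> > 0" and \<rho>: "\<forall>y\<in>cbox (m, m) (R, R). \<forall>c c' x x'.
          dist c0 c < \<rho> \<longrightarrow> dist c0 c' < \<rho> \<longrightarrow> dist y x < \<rho> \<longrightarrow> dist y x' < \<rho> \<longrightarrow>
          norm (field c' x' - field c x - (field_dx c0 (fst y) (fst y) (snd y) (x' - x) + field_dc (fst y) (c' - c)))
            \<le> \<epsilon> * (norm (x' - x) + norm (c' - c))"
        using field_strict[OF R \<epsilon>] by blast
      then show ?thesis
        using \<rho>[rule_format, OF range] unfolding A_def B_def by (intro exI[of _ \<rho>]) blast
    qed
  qed (fact boundA boundB contA contB that)+
qed

lemma norm_vec_of_pair: "norm (vec_of_pair p) = norm p"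
  by (simp add: norm_vec_def L2_set_def sum_2 norm_prod_def)

lemma Psi_strict_derivative:
  assumes c0: "c0 \<in> Feas"
  obtains Y where "linear Y"
    "\<And>\<epsilon>. \<epsilon> > 0 \<Longrightarrow> \<exists>\<rho>>0. \<forall>c c'. dist c0 c < \<rho> \<longrightarrow> dist c0 c' < \<rho> \<longrightarrow>
        norm (Psi c' - Psi c - Y (c' - c)) \<le> \<epsilon> * norm (c' - c)"
proof -
  obtain Y where Y: "linear Y"
    "\<And>\<epsilon>. \<epsilon> > 0 \<Longrightarrow> \<exists>\<rho>>0. \<forall>c c'. dist c0 c < \<rho> \<longrightarrow> dist c0 c' < \<rho> \<longrightarrow>
        norm (flow c' 1 - flow c 1 - Y (c' - c)) \<le> \<epsilon> * norm (c' - c)"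
    using flow_strict_derivative[OF c0] by blast
  \<comment> \<open>\<open>Psi\<close> is known to be given by the flow on \<open>Feas\<close>, so
    the estimate is confined to a ball inside it.\<close>
  obtain r where r: "r > 0" "ball c0 r \<subseteq> Feas" using open_Feas c0 open_contains_ball by blast
  have lin: "linear vec_of_pair" using bounded_linear_vec_of_pair by (rule bounded_linear.linear)
  show thesis
  proof (rule that)
    show "linear (vec_of_pair \<circ> Y)" using Y(1) lin by (rule linear_compose)
    fix \<epsilon> :: real assume "\<epsilon> > 0"
    then obtain \<rho> where \<rho>: "\<rho> > 0" "\<And>c c'. dist c0 c < \<rho> \<Longrightarrow> dist c0 c' < \<rho> \<Longrightarrow>
        norm (flow c' 1 - flow c 1 - Y (c' - c)) \<le> \<epsilon> * norm (c' - c)"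
      using Y(2) by blast
    have "norm (Psi c' - Psi c - (vec_of_pair \<circ> Y) (c' - c)) \<le> \<epsilon> * norm (c' - c)"
      if "dist c0 c < min \<rho> r" "dist c0 c' < min \<rho> r" for c c'
    proof -
      have "c \<in> Feas" "c' \<in> Feas" using r(2) that by auto
      then have "Psi c' - Psi c - (vec_of_pair \<circ> Y) (c' - c) = vec_of_pair (flow c' 1 - flow c 1 - Y (c' - c))"
        by (simp add: Psi_eq_flow linear_diff[OF lin])
      then show ?thesis using \<rho>(2) that by (simp add: norm_vec_of_pair)
    qed
    then show "\<exists>\<rho>>0. \<forall>c c'. dist c0 c < \<rho> \<longrightarrow> dist c0 c' < \<rho> \<longrightarrow>
        norm (Psi c' - Psi c - (vec_of_pair \<circ> Y) (c' - c)) \<le> \<epsilon> * norm (c' - c)"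
      using \<rho>(1) r(1) by (intro exI[of _ "min \<rho> r"]) auto
  qed
qed

lemma Psi_has_derivative:
  assumes "c \<in> Feas"
  shows "(Psi has_derivative ((*v) (jacobian Psi (at c)))) (at c)"
proof -
  obtain Y where "linear Y" "\<And>\<epsilon>. \<epsilon> > 0 \<Longrightarrow> \<exists>\<rho>>0. \<forall>c1 c'. dist c c1 < \<rho> \<longrightarrow> dist c c' < \<rho> \<longrightarrow>
        norm (Psi c' - Psi c1 - Y (c' - c1)) \<le> \<epsilon> * norm (c' - c1)"
    using Psi_strict_derivative[OF assms] by blast
  then have "(Psi has_derivative Y) (at c)" by (rule strict_derivative_imp_has_derivative)
  then have "Psi differentiable (at c)" unfolding differentiable_def by blast
  then show ?thesis by (simp add: jacobian_works)
qed

lemma Psi_locally_inj: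
  assumes c: "c \<in> Feas" and det: "profile_jacobian_det \<Gamma> \<alpha> \<nu> u0 e0 c \<noteq> 0"
  shows "\<exists>\<rho>>0. inj_on Psi (ball c \<rho>)"
proof -
  obtain Y where Y: "linear Y" "\<And>\<epsilon>. \<epsilon> > 0 \<Longrightarrow> \<exists>\<rho>>0. \<forall>c1 c'. dist c c1 < \<rho> \<longrightarrow> dist c c' < \<rho> \<longrightarrow>
        norm (Psi c' - Psi c1 - Y (c' - c1)) \<le> \<epsilon> * norm (c' - c1)"
    using Psi_strict_derivative[OF c] by blast
  then have "(Psi has_derivative Y) (at c)" by (rule strict_derivative_imp_has_derivative)
  \<comment> \<open>The strict derivative is the Frechet derivative from which
    \<open>jacobian\<close> is formed, so the determinant hypothesis says that it is
    injective.\<close>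
  then have "Y = frechet_derivative Psi (at c)" by (rule frechet_derivative_at)
  then have "det (matrix Y) \<noteq> 0" using det by (simp add: profile_jacobian_det_def jacobian_def)
  then have "inj Y" using det_nz_iff_inj[OF Y(1)] by blast
  then show ?thesis using strict_derivative_imp_locally_inj[OF Y(1) _ Y(2)] by blast
qed

lemma has_derivative_components:
  assumes "(X has_vector_derivative field c (X t)) F"
  shows "((\<lambda>t. fst (X t)) has_real_derivative u0 / \<alpha> * (c$1 + fst (X t) + \<Gamma> * (snd (X t) / fst (X t)))) F"
    "((\<lambda>t. snd (X t)) has_real_derivative u0 / \<nu> * (c$2 - c$1 * fst (X t) - 1/2 * (fst (X t))^2 + snd (X t))) F"
  using bounded_linear.has_vector_derivative[OF bounded_linear_fst assms]
    bounded_linear.has_vector_derivative[OF bounded_linear_snd assms]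
  by (simp_all add: has_real_derivative_iff_has_vector_derivative field_def)

section \<open>The energy and a priori bounds\<close>

definition energy :: "real \<times> real \<Rightarrow> real" where
  "energy x = \<nu> * snd x + \<alpha> / 2 * (fst x)^2"

text \<open>Multiplication by u turns the quotient e/u of the first equation into e, and its term c1
  u cancels against the one in the second equation.\<close>

lemma energy_derivative:
  assumes "(X has_vector_derivative field c (X t)) (at t within I)" "fst (X t) > 0"
  shows "((\<lambda>t. energy (X t)) has_real_derivative u0 * (c$2 + (fst (X t))^2 / 2 + (1 + \<Gamma>) * snd (X t))) (at t within I)"
proof -
  have "((\<lambda>t. energy (X t)) has_real_derivative
      \<nu> * (u0 / \<nu> * (c$2 - c$1 * fst (X t) - 1/2 * (fst (X t))^2 + snd (X t)))
      + \<alpha> / 2 * (2 * fst (X t) * (u0 / \<alpha> * (c$1 + fst (X t) + \<Gamma> * (snd (X t) / fst (X t)))))) (at t within I)"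
    unfolding energy_def
    by (rule derivative_eq_intros has_derivative_components[OF assms(1)] refl | simp)+
  also have "\<nu> * (u0 / \<nu> * (c$2 - c$1 * fst (X t) - 1/2 * (fst (X t))^2 + snd (X t)))
      + \<alpha> / 2 * (2 * fst (X t) * (u0 / \<alpha> * (c$1 + fst (X t) + \<Gamma> * (snd (X t) / fst (X t)))))
      = u0 * (c$2 + (fst (X t))^2 / 2 + (1 + \<Gamma>) * snd (X t))"
    using pos assms(2) by (simp add: field_simps power2_eq_square)
  finally show ?thesis .
qed

text \<open>The least constant for which u^2/2 and (1 + Gamma) e are each at most this multiple of
  their own share of the energy, when e >= 0.\<close>

definition rate :: real where "rate = max (1 / \<alpha>) ((1 + \<Gamma>) / \<nu>)"

lemma rate_pos: "rate > 0" unfolding rate_def using pos by (simp add: less_max_iff_disj)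

lemma energy_growth_le:
  assumes "snd x \<ge> 0"
  shows "(fst x)^2 / 2 + (1 + \<Gamma>) * snd x \<le> rate * energy x"
proof -
  have "(fst x)^2 / 2 = 1 / \<alpha> * (\<alpha> / 2 * (fst x)^2)" "(1 + \<Gamma>) * snd x = (1 + \<Gamma>) / \<nu> * (\<nu> * snd x)"
    using pos by simp_all
  moreover have "1 / \<alpha> * (\<alpha> / 2 * (fst x)^2) \<le> rate * (\<alpha> / 2 * (fst x)^2)"
    using pos by (intro mult_right_mono) (auto simp: rate_def)
  moreover have "(1 + \<Gamma>) / \<nu> * (\<nu> * snd x) \<le> rate * (\<nu> * snd x)"
    using pos assms by (intro mult_right_mono) (auto simp: rate_def)
  ultimately show ?thesis by (simp add: energy_def distrib_left)
qed

abbreviation "w0 \<equiv> energy (u0, e0)"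

text \<open>If c2 <= p and e >= 0, the energy satisfies w' <= u0 (p + rate w). With equality the
  value at time 1 would be this expression minus p/rate, a summand that is dropped.\<close>

definition energy_bound :: "real \<Rightarrow> real" where
  "energy_bound p = (w0 + p / rate) * exp (rate * u0)"

lemma w0_pos: "w0 > 0" using pos by (simp add: energy_def add_pos_pos)

lemma energy_bound_ge: "0 \<le> p \<Longrightarrow> w0 \<le> energy_bound p"
proof -
  assume "0 \<le> p"
  then have "w0 * 1 \<le> (w0 + p / rate) * exp (rate * u0)"
    using w0_pos rate_pos pos by (intro mult_mono) auto
  then show ?thesis by (simp add: energy_bound_def)
qed

text \<open>Stated on [0,T] and for e >= 0, because it also acts as an a priori bound before a
  solution on all of [0,1] is known.\<close>

lemma energy_le:
  assumes X: "solves c {0..T} X" and nonneg: "\<And>t. t \<in> {0..T} \<Longrightarrow> snd (X t) \<ge> 0"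
    and p: "c$2 \<le> p" "0 \<le> p" and T: "T \<le> 1" "t \<in> {0..T}"
  shows "energy (X t) \<le> energy_bound p"
proof -
  \<comment> \<open>The integrating factor of w' <= u0 (p + rate w), which makes
    \<open>\<phi>\<close> nonincreasing.\<close>
  define \<phi> where "\<phi> t = (energy (X t) + p / rate) * exp (- (rate * u0) * t)" for t
  define \<phi>' where "\<phi>' t = u0 * (c$2 + (fst (X t))^2 / 2 + (1 + \<Gamma>) * snd (X t)) * exp (- (rate * u0) * t)
      + (energy (X t) + p / rate) * (exp (- (rate * u0) * t) * (- (rate * u0)))" for t
  have sol: "(X has_vector_derivative field c (X s)) (at s within {0..T})" "fst (X s) > 0" if "s \<in> {0..T}" for s
    using X that unfolding solves_def by blast+
  have "\<phi> t - \<phi> 0 \<le> 0 * (t - 0)"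
  proof (rule deriv_le_imp_diff_le[of 0 T])
    fix s assume s: "s \<in> {0..T}"
    show "(\<phi> has_real_derivative \<phi>' s) (at s within {0..T})"
      unfolding \<phi>_def \<phi>'_def
      by (rule derivative_eq_intros energy_derivative[OF sol[OF s]] refl | simp)+
  next
    fix s assume "s \<in> {0..t}"
    then have s: "s \<in> {0..T}" using T by auto
    have "c$2 + (fst (X s))^2 / 2 + (1 + \<Gamma>) * snd (X s) \<le> rate * (energy (X s) + p / rate)"
      using energy_growth_le[OF nonneg[OF s]] p rate_pos by (simp add: distrib_left)
    then have "u0 * (c$2 + (fst (X s))^2 / 2 + (1 + \<Gamma>) * snd (X s)) \<le> u0 * (rate * (energy (X s) + p / rate))"
      using pos by (intro mult_left_mono) auto
    moreover have "A * E + W * (E * (- (rate * u0))) = (A - u0 * (rate * W)) * E" for A E W :: real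
      by (simp add: algebra_simps)
    ultimately have "\<phi>' s = (u0 * (c$2 + (fst (X s))^2 / 2 + (1 + \<Gamma>) * snd (X s)) - u0 * (rate * (energy (X s) + p / rate)))
        * exp (- (rate * u0) * s)" "u0 * (c$2 + (fst (X s))^2 / 2 + (1 + \<Gamma>) * snd (X s)) - u0 * (rate * (energy (X s) + p / rate)) \<le> 0"
      unfolding \<phi>'_def by (simp_all only: diff_le_0_iff_le)
    moreover from this(2) have "(u0 * (c$2 + (fst (X s))^2 / 2 + (1 + \<Gamma>) * snd (X s)) - u0 * (rate * (energy (X s) + p / rate)))
        * exp (- (rate * u0) * s) \<le> 0"
      by (intro mult_nonpos_nonneg) auto
    ultimately show "\<phi>' s \<le> 0" by (simp only:)
  qed (use T in auto)
  moreover have "\<phi> 0 = w0 + p / rate" using X by (simp add: \<phi>_def solves_def)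
  ultimately have "(energy (X t) + p / rate) * exp (- (rate * u0) * t) \<le> w0 + p / rate" by (simp add: \<phi>_def)
  then have "(energy (X t) + p / rate) * exp (- (rate * u0) * t) * exp (rate * u0 * t) \<le> (w0 + p / rate) * exp (rate * u0 * t)"
    by (intro mult_right_mono) auto
  then have "energy (X t) + p / rate \<le> (w0 + p / rate) * exp (rate * u0 * t)"
    by (simp add: mult.assoc exp_add[symmetric])
  also have "\<dots> \<le> energy_bound p"
    unfolding energy_bound_def using T rate_pos pos w0_pos p
    by (intro mult_left_mono) (auto intro!: mult_left_le)
  finally show ?thesis using p rate_pos by (smt (verit) divide_nonneg_pos)
qed

definition u_bound :: "real \<Rightarrow> real" where "u_bound p = sqrt (2 * energy_bound p / \<alpha>)"
definition e_bound :: "real \<Rightarrow> real" where "e_bound p = energy_bound p / \<nu>"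

lemma energy_le_imp_components_le:
  assumes "energy x \<le> energy_bound p" "fst x \<ge> 0" "snd x \<ge> 0"
  shows "fst x \<le> u_bound p" "snd x \<le> e_bound p"
proof -
  have "\<alpha> / 2 * (fst x)^2 \<le> energy_bound p" "\<nu> * snd x \<le> energy_bound p"
    using assms pos unfolding energy_def by (smt (verit) mult_nonneg_nonneg divide_nonneg_nonneg zero_le_power2)+
  then show "fst x \<le> u_bound p" "snd x \<le> e_bound p"
    unfolding u_bound_def e_bound_def using pos assms by (auto intro!: real_le_rsqrt simp: field_simps)
qed

lemma feasible_facts:
  assumes "c \<in> Feas" "t \<in> {0..1}"
  shows "fst (flow c t) > 0" "snd (flow c t) > 0"
    "(flow c has_vector_derivative field c (flow c t)) (at t within {0..1})"
    "flow c 0 = (u0, e0)" "solves c {0..1} (flow c)"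
  using feasible_flow[OF assms(1)] assms(2) unfolding feasible_def solves_def by blast+

lemma flow_components_le:
  assumes "c \<in> Feas" "c$2 \<le> p" "0 \<le> p" "t \<in> {0..1}"
  shows "energy (flow c t) \<le> energy_bound p" "fst (flow c t) \<le> u_bound p" "snd (flow c t) \<le> e_bound p"
proof -
  show 1: "energy (flow c t) \<le> energy_bound p"
  proof (rule energy_le[OF feasible_facts(5)[OF assms(1,4)] _ assms(2,3) order_refl assms(4)])
    show "0 \<le> snd (flow c s)" if "s \<in> {0..1}" for s using feasible_facts(2)[OF assms(1) that] by simp
  qed
  show "fst (flow c t) \<le> u_bound p" "snd (flow c t) \<le> e_bound p"
    using energy_le_imp_components_le[OF 1] feasible_facts[OF assms(1,4)] by auto
qed

text \<open>The energy starts positive and its derivative is at least u0 c2.\<close>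

lemma c2_le:
  assumes c: "c \<in> Feas"
  shows "c$2 \<le> energy (flow c 1) / u0"
proof -
  have "u0 * c$2 * (1 - 0) \<le> energy (flow c 1) - energy (flow c 0)"
  proof (rule deriv_ge_imp_diff_ge[of 0 1])
    fix t :: real assume t: "t \<in> {0..1}"
    show "((\<lambda>t. energy (flow c t)) has_real_derivative
        u0 * (c$2 + (fst (flow c t))^2 / 2 + (1 + \<Gamma>) * snd (flow c t))) (at t within {0..1})"
      using energy_derivative feasible_facts[OF c t] by blast
    show "u0 * c$2 \<le> u0 * (c$2 + (fst (flow c t))^2 / 2 + (1 + \<Gamma>) * snd (flow c t))"
      using pos feasible_facts[OF c t] by (intro mult_left_mono) auto
  qed auto
  then have "u0 * c$2 \<le> energy (flow c 1)" using feasible_facts[OF c, of 0] w0_pos by auto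
  then show ?thesis using pos by (simp add: field_simps)
qed

text \<open>The energy has to stay positive, while its derivative is at most u0 (c2 + rate W) with W
  the energy bound; a very negative c2 would use up the initial energy.\<close>

lemma c2_ge:
  assumes c: "c \<in> Feas" and p: "c$2 \<le> p" "0 \<le> p"
  shows "- w0 / u0 - rate * energy_bound p \<le> c$2"
proof -
  have "energy (flow c 1) - energy (flow c 0) \<le> u0 * (c$2 + rate * energy_bound p) * (1 - 0)"
  proof (rule deriv_le_imp_diff_le[of 0 1])
    fix t :: real assume t: "t \<in> {0..1}"
    show "((\<lambda>t. energy (flow c t)) has_real_derivative
        u0 * (c$2 + (fst (flow c t))^2 / 2 + (1 + \<Gamma>) * snd (flow c t))) (at t within {0..1})"
      using energy_derivative feasible_facts[OF c t] by blast
    have "rate * energy (flow c t) \<le> rate * energy_bound p"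
      using flow_components_le(1)[OF c p t] rate_pos by simp
    then show "u0 * (c$2 + (fst (flow c t))^2 / 2 + (1 + \<Gamma>) * snd (flow c t)) \<le> u0 * (c$2 + rate * energy_bound p)"
      using pos energy_growth_le[of "flow c t"] feasible_facts[OF c t] by (intro mult_left_mono) auto
  qed auto
  moreover have "energy (flow c 1) > 0"
    using feasible_facts[OF c, of 1] pos by (simp add: energy_def add_pos_pos)
  moreover have "energy (flow c 0) = w0" using feasible_facts[OF c, of 0] by simp
  ultimately have "- w0 \<le> u0 * (c$2 + rate * energy_bound p)" by simp
  then show ?thesis using pos by (simp add: field_simps)
qed

text \<open>The other terms of u' are positive and u starts positive, so u(1) exceeds u0 c1 /
  alpha.\<close>

lemma c1_le:
  assumes c: "c \<in> Feas"
  shows "c$1 \<le> \<alpha> / u0 * fst (flow c 1)"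
proof -
  have "u0 / \<alpha> * c$1 * (1 - 0) \<le> fst (flow c 1) - fst (flow c 0)"
  proof (rule deriv_ge_imp_diff_ge[of 0 1])
    fix t :: real assume t: "t \<in> {0..1}"
    show "((\<lambda>t. fst (flow c t)) has_real_derivative
        u0 / \<alpha> * (c$1 + fst (flow c t) + \<Gamma> * (snd (flow c t) / fst (flow c t)))) (at t within {0..1})"
      using has_derivative_components(1)[OF feasible_facts(3)[OF c t]] .
    show "u0 / \<alpha> * c$1 \<le> u0 / \<alpha> * (c$1 + fst (flow c t) + \<Gamma> * (snd (flow c t) / fst (flow c t)))"
      using pos feasible_facts[OF c t] by (intro mult_left_mono) auto
  qed auto
  then have "u0 / \<alpha> * c$1 \<le> fst (flow c 1)" using feasible_facts[OF c, of 0] pos by auto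
  then show ?thesis using pos by (simp add: field_simps)
qed

text \<open>Otherwise u' <= - u0 wherever u >= u(1), since there e/u is at most
  \<open>e_bound p\<close> / u(1); the summand alpha is what produces this slope. The backward
  barrier at level u(1) extends the slope to all of [0,1], and u would drop by \<open>u0\<close>, to
  u(1) <= 0.\<close>

lemma c1_ge:
  assumes c: "c \<in> Feas" and p: "c$2 \<le> p" "0 \<le> p"
  shows "- (u_bound p + \<Gamma> * e_bound p / fst (flow c 1) + \<alpha>) \<le> c$1"
proof (rule ccontr)
  let ?u = "\<lambda>t. fst (flow c t)"
  let ?u' = "\<lambda>t. u0 / \<alpha> * (c$1 + fst (flow c t) + \<Gamma> * (snd (flow c t) / fst (flow c t)))"
  assume "\<not> - (u_bound p + \<Gamma> * e_bound p / fst (flow c 1) + \<alpha>) \<le> c$1"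
  then have c1: "c$1 + u_bound p + \<Gamma> * e_bound p / ?u 1 < - \<alpha>" by simp
  have der: "(?u has_real_derivative ?u' t) (at t within {0..1})" if "t \<in> {0..1}" for t
    using has_derivative_components(1)[OF feasible_facts(3)[OF c that]] .
  have slope: "?u' t \<le> - u0" if t: "t \<in> {0..1}" "?u 1 \<le> ?u t" for t
  proof -
    have "snd (flow c t) / ?u t \<le> e_bound p / ?u 1"
      using flow_components_le(3)[OF c p t(1)] feasible_facts[OF c t(1)] feasible_facts[OF c, of 1] t(2)
      by (intro frac_le) auto
    then have "\<Gamma> * (snd (flow c t) / ?u t) \<le> \<Gamma> * e_bound p / ?u 1"
      using pos by (metis less_imp_le mult_left_mono times_divide_eq_right)
    then have "c$1 + ?u t + \<Gamma> * (snd (flow c t) / ?u t) \<le> - \<alpha>"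
      using flow_components_le(2)[OF c p t(1)] c1 by linarith
    then have "?u' t \<le> u0 / \<alpha> * (- \<alpha>)" using pos by (intro mult_left_mono) auto
    then show ?thesis using pos by simp
  qed
  have ge: "?u 1 \<le> ?u t" if "t \<in> {0..1}" for t
  proof (rule barrier_backward[of 0 1 ?u ?u', OF der _ order_refl that])
    fix s :: real assume "s \<in> {0..1}" "?u s = ?u 1"
    then show "?u' s < 0" using slope[of s] pos by auto
  qed
  have "?u 1 - ?u 0 \<le> - u0 * (1 - 0)"
    by (rule deriv_le_imp_diff_le[of 0 1 ?u ?u', OF der]) (use slope ge in auto)
  then show False using feasible_facts[OF c, of 0] feasible_facts(1)[OF c, of 1] by simp
qed

lemma bounded_on_compact:
  assumes "0 < \<delta>"
  obtains N where "\<And>c t. c \<in> Feas \<Longrightarrow> flow c 1 \<in> cbox (\<delta>, \<delta>) (R, R) \<Longrightarrow> t \<in> {0..1} \<Longrightarrow>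
    \<bar>c$1\<bar> \<le> N \<and> \<bar>c$2\<bar> \<le> N \<and> fst (flow c t) \<le> N \<and> snd (flow c t) \<le> N"
proof -
  \<comment> \<open>The largest c2 that \<open>c2_le\<close> permits for end values in the box; the
    other bounds are then expressed through this \<open>p\<close>, \<open>\<delta>\<close> and
    \<open>R\<close>.\<close>
  define p where "p = (\<nu> * R + \<alpha> / 2 * R^2) / u0"
  define N where "N = Max {p, w0 / u0 + rate * energy_bound p, \<alpha> / u0 * R,
    u_bound p + \<Gamma> * e_bound p / \<delta> + \<alpha>, u_bound p, e_bound p}"
  have N: "p \<le> N" "w0 / u0 + rate * energy_bound p \<le> N" "\<alpha> / u0 * R \<le> N"
    "u_bound p + \<Gamma> * e_bound p / \<delta> + \<alpha> \<le> N" "u_bound p \<le> N" "e_bound p \<le> N"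
    unfolding N_def by (rule Max_ge; simp)+
  show thesis
  proof (rule that[of N])
    fix c t assume c: "c \<in> Feas" and end1: "flow c 1 \<in> cbox (\<delta>, \<delta>) (R, R)" and t: "t \<in> {0..1::real}"
    have b: "\<delta> \<le> fst (flow c 1)" "fst (flow c 1) \<le> R" "snd (flow c 1) \<le> R"
      using end1 by (auto simp: cbox_Pair_eq mem_Times_iff)
    then have R: "0 < R" using assms by simp
    have p0: "0 \<le> p" using pos R by (simp add: p_def)
    have "(fst (flow c 1))^2 \<le> R^2" using b assms by (intro power_mono) auto
    then have "energy (flow c 1) \<le> \<nu> * R + \<alpha> / 2 * R^2"
      unfolding energy_def using pos b by (intro add_mono mult_left_mono) auto
    then have "energy (flow c 1) / u0 \<le> p" using pos by (simp add: p_def divide_right_mono)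
    then have p: "c$2 \<le> p" using c2_le[OF c] by simp
    have 1: "- N \<le> c$2" using c2_ge[OF c p p0] N(2) by simp
    have "\<alpha> / u0 * fst (flow c 1) \<le> \<alpha> / u0 * R" using b pos by (intro mult_left_mono) auto
    then have 2: "c$1 \<le> N" using c1_le[OF c] N(3) by simp
    have "e_bound p \<ge> 0" using flow_components_le(3)[OF c p p0 t] feasible_facts[OF c t] by simp
    then have "\<Gamma> * e_bound p / fst (flow c 1) \<le> \<Gamma> * e_bound p / \<delta>"
      using b assms pos by (intro divide_left_mono) auto
    then have 3: "- N \<le> c$1" using c1_ge[OF c p p0] N(4) by simp
    show "\<bar>c$1\<bar> \<le> N \<and> \<bar>c$2\<bar> \<le> N \<and> fst (flow c t) \<le> N \<and> snd (flow c t) \<le> N"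
      using 1 2 3 p N flow_components_le[OF c p p0 t] by auto
  qed
qed

section \<open>Limits of feasible solutions and properness of the map\<close>

lemma constant_solution:
  assumes "c$1 + v = 0" "c$2 = c$1 * v + v^2 / 2" "v > 0"
  shows "((\<lambda>t. (v, 0)) has_vector_derivative field c (v, 0)) (at t within I)"
proof -
  have "field c (v, 0) = 0" using assms by (simp add: field_def zero_prod_def)
  then show ?thesis by simp
qed

text \<open>The first unknown is passed to \<open>z = u\<^sup>2\<close>, whose equation is regular at \<open>z = 0\<close>.\<close>

lemma nonnegative_limit_feasible:
  assumes der_z: "\<And>t. t \<in> {0..1} \<Longrightarrow>
      (z has_real_derivative 2 * u0 / \<alpha> * (c$1 * sqrt (z t) + z t + \<Gamma> * e t)) (at t within {0..1})"
    and der_e: "\<And>t. t \<in> {0..1} \<Longrightarrow>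
      (e has_real_derivative u0 / \<nu> * (c$2 - c$1 * sqrt (z t) - z t / 2 + e t)) (at t within {0..1})"
    and nonneg: "\<And>t. t \<in> {0..1} \<Longrightarrow> 0 \<le> z t \<and> 0 \<le> e t"
    and init: "z 0 = u0^2" "e 0 = e0" and final: "z 1 > 0" "e 1 > 0"
  shows "feasible c (\<lambda>t. (sqrt (z t), e t))"
proof -
  let ?X = "\<lambda>t. (sqrt (z t), e t)"
  \<comment> \<open>A zero of the nonnegative z is interior, so z' = 0 there and hence e = 0; this
    in turn is a minimum of e, so e' = 0 and hence c2 = 0. Then the energy is nondecreasing and
    cannot fall from its positive initial value to 0.\<close>
  have z_pos: "z t > 0" if t: "t \<in> {0..1}" for t
  proof (rule ccontr)
    assume "\<not> z t > 0"
    then have zt: "z t = 0" using nonneg[OF t] by simp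
    then have "t \<noteq> 0" "t \<noteq> 1" using init final pos by auto
    then have t01: "0 < t" "t < 1" using t by auto
    have "2 * u0 / \<alpha> * (c$1 * sqrt (z t) + z t + \<Gamma> * e t) = 0"
      by (rule interior_min_deriv_zero[OF der_z[OF t] t01]) (use nonneg zt in auto)
    then have et: "e t = 0" using zt pos by simp
    have "u0 / \<nu> * (c$2 - c$1 * sqrt (z t) - z t / 2 + e t) = 0"
      by (rule interior_min_deriv_zero[OF der_e[OF t] t01]) (use nonneg et in auto)
    then have c2: "c$2 = 0" using zt et pos by simp
    let ?w = "\<lambda>s. \<nu> * e s + \<alpha> / 2 * z s"
    have "0 * (t - 0) \<le> ?w t - ?w 0"
    proof (rule deriv_ge_imp_diff_ge[of 0 1])
      fix s :: real assume s: "s \<in> {0..1}"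
      have "(?w has_real_derivative \<nu> * (u0 / \<nu> * (c$2 - c$1 * sqrt (z s) - z s / 2 + e s))
          + \<alpha> / 2 * (2 * u0 / \<alpha> * (c$1 * sqrt (z s) + z s + \<Gamma> * e s))) (at s within {0..1})"
        by (intro DERIV_add DERIV_cmult der_e[OF s] der_z[OF s])
      moreover have "\<nu> * (u0 / \<nu> * (c$2 - c$1 * sqrt (z s) - z s / 2 + e s))
          + \<alpha> / 2 * (2 * u0 / \<alpha> * (c$1 * sqrt (z s) + z s + \<Gamma> * e s)) = u0 * (z s / 2 + (1 + \<Gamma>) * e s)"
        using pos by (simp add: c2 field_simps)
      ultimately show "(?w has_real_derivative u0 * (z s / 2 + (1 + \<Gamma>) * e s)) (at s within {0..1})" by simp
    next
      fix s assume "s \<in> {0..t}"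
      then show "0 \<le> u0 * (z s / 2 + (1 + \<Gamma>) * e s)"
        using nonneg[of s] t pos by (intro mult_nonneg_nonneg add_nonneg_nonneg) auto
    qed (use t in auto)
    then have "\<nu> * e0 + \<alpha> / 2 * u0^2 \<le> 0" using init zt et by simp
    moreover have "\<nu> * e0 + \<alpha> / 2 * u0^2 > 0" using pos by (intro add_pos_pos) auto
    ultimately show False by simp
  qed
  have der_u: "((\<lambda>t. sqrt (z t)) has_real_derivative u0 / \<alpha> * (c$1 + sqrt (z t) + \<Gamma> * (e t / sqrt (z t)))) (at t within {0..1})"
    if t: "t \<in> {0..1}" for t
  proof -
    have "((\<lambda>t. sqrt (z t)) has_real_derivative (inverse (sqrt (z t)) / 2) *
        (2 * u0 / \<alpha> * (c$1 * sqrt (z t) + z t + \<Gamma> * e t))) (at t within {0..1})"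
      by (rule DERIV_chain2[OF DERIV_real_sqrt[OF z_pos[OF t]] der_z[OF t]])
    moreover have "(inverse (sqrt (z t)) / 2) * (2 * u0 / \<alpha> * (c$1 * sqrt (z t) + z t + \<Gamma> * e t))
        = u0 / \<alpha> * (c$1 + sqrt (z t) + \<Gamma> * (e t / sqrt (z t)))"
    proof -
      define v where "v = sqrt (z t)"
      have "v > 0" "z t = v * v" using z_pos[OF t] by (auto simp: v_def)
      then show ?thesis unfolding v_def[symmetric] using pos by (simp add: field_simps)
    qed
    ultimately show ?thesis by (simp only:)
  qed
  have der_X: "(?X has_vector_derivative field c (?X t)) (at t within {0..1})" if t: "t \<in> {0..1}" for t
  proof -
    have "field c (?X t) = (u0 / \<alpha> * (c$1 + sqrt (z t) + \<Gamma> * (e t / sqrt (z t))),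
        u0 / \<nu> * (c$2 - c$1 * sqrt (z t) - z t / 2 + e t))"
      using z_pos[OF t] by (simp add: field_def)
    then show ?thesis
      using has_vector_derivative_real_Pair[OF der_u[OF t] der_e[OF t]] by (simp only:)
  qed
  have e_pos: "e t > 0" if t: "t \<in> {0..1}" for t
  proof (rule ccontr)
    assume "\<not> e t > 0"
    then have et: "e t = 0" using nonneg[OF t] by simp
    then have "t \<noteq> 0" "t \<noteq> 1" using init final pos by auto
    then have t01: "0 < t" "t < 1" using t by auto
    have "u0 / \<nu> * (c$2 - c$1 * sqrt (z t) - z t / 2 + e t) = 0"
      by (rule interior_min_deriv_zero[OF der_e[OF t] t01]) (use nonneg et in auto)
    then have q0: "c$2 - c$1 * sqrt (z t) - z t / 2 = 0" using et pos by simp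
    define v where "v = sqrt (z t)"
    have v: "v > 0" "z t = v^2" using z_pos[OF t] by (auto simp: v_def)
    have q1: "c$2 - c$1 * v - z t / 2 = 0" using q0 by (simp only: v_def)
    show False
    \<comment> \<open>If c1 + v = 0, then (v, 0) is a rest point and uniqueness traced back to time
      0 contradicts e0 > 0. Otherwise e has negative second derivative at its zero.\<close>
    proof (cases "c$1 + v = 0")
      case True
      have "c$2 = c$1 * v + v^2 / 2" using q1 v(2) by simp
      note const = constant_solution[OF True this v(1)]
      have "?X 0 = (v, 0)"
      proof (rule field_solution_unique[of 0 1 ?X c "\<lambda>_. (v, 0)" t 0])
        show "0 < fst (?X s) \<and> (?X has_vector_derivative field c (?X s)) (at s within {0..1})" if "s \<in> {0..1}" for s
          using der_X[OF that] z_pos[OF that] by simp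
        show "0 < fst (v, 0::real) \<and> ((\<lambda>_. (v, 0)) has_vector_derivative field c (v, 0)) (at s within {0..1})" for s
          using const v(1) by simp
        show "?X t = (v, 0)" by (simp add: et v_def)
      qed (use t in auto)
      then show False using init pos by simp
    next
      case False
      \<comment> \<open>This is e' up to the factor u0 / nu. At \<open>t\<close> it vanishes with
        derivative - (u0 / alpha) (c1 + v)^2 < 0, so e decreases just after \<open>t\<close> and
        becomes negative.\<close>
      define q where "q s = c$2 - c$1 * sqrt (z s) - z s / 2 + e s" for s
      have dq: "(q has_real_derivative 0 - c$1 * (u0 / \<alpha> * (c$1 + sqrt (z t) + \<Gamma> * (e t / sqrt (z t))))
          - (2 * u0 / \<alpha> * (c$1 * sqrt (z t) + z t + \<Gamma> * e t)) / 2
          + u0 / \<nu> * (c$2 - c$1 * sqrt (z t) - z t / 2 + e t)) (at t within {0..1})"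
        unfolding q_def
        by (intro DERIV_add DERIV_diff DERIV_const DERIV_cmult DERIV_cdivide der_u der_z der_e t)
      have lq: "0 - c$1 * (u0 / \<alpha> * (c$1 + sqrt (z t) + \<Gamma> * (e t / sqrt (z t))))
          - (2 * u0 / \<alpha> * (c$1 * sqrt (z t) + z t + \<Gamma> * e t)) / 2
          + u0 / \<nu> * (c$2 - c$1 * sqrt (z t) - z t / 2 + e t) = - (u0 / \<alpha> * (c$1 + v)^2)"
      proof -
        have "c$2 = c$1 * v + v^2 / 2" using q1 v(2) by simp
        then show ?thesis
          unfolding v_def[symmetric] using et v pos by (simp add: field_simps power2_eq_square)
      qed
      have "- (u0 / \<alpha> * (c$1 + v)^2) < 0" using pos False by simp
      from has_real_derivative_neg_dec_right[OF dq[unfolded lq] this]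
      obtain d where d: "d > 0" "\<And>h. 0 < h \<Longrightarrow> t + h \<in> {0..1} \<Longrightarrow> h < d \<Longrightarrow> q t > q (t + h)"
        by blast
      have qt: "q t = 0" using q0 et by (simp add: q_def)
      define h where "h = min (d / 2) (1 - t)"
      have h: "0 < h" "h < d" "t + h \<le> 1" using d(1) t01 by (auto simp: h_def)
      have neg: "q s < 0" if "t < s" "s \<le> t + h" for s
        using d(2)[of "s - t"] that h t qt by auto
      have "continuous_on {0..1} e" using der_e by (rule DERIV_continuous_on)
      have "e (t + h) < e t"
      proof (rule DERIV_neg_imp_decreasing_open[of t "t + h" e])
        show "t < t + h" using h by simp
        show "continuous_on {t..t + h} e"
          using \<open>continuous_on {0..1} e\<close> by (rule continuous_on_subset) (use h t in auto)
        fix s assume s: "t < s" "s < t + h"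
        then have "0 < s" "s < 1" using h t by auto
        then have "(e has_real_derivative u0 / \<nu> * q s) (at s)"
          using der_e[of s] by (simp add: at_within_Icc_at q_def)
        moreover have "u0 / \<nu> * q s < 0" using neg[of s] s pos by (intro mult_pos_neg) auto
        ultimately show "\<exists>y. (e has_real_derivative y) (at s) \<and> y < 0" by blast
      qed
      then show False using et nonneg[of "t + h"] h t by simp
    qed
  qed
  show ?thesis
    unfolding feasible_def solves_def
    using der_X e_pos z_pos init pos by (auto simp: is_interval_cc)
qed

text \<open>The system satisfied by (u^2, e). Having no quotient, it stays bounded on bounded sets
  up to z = 0, but its square root prevents a Lipschitz bound there.\<close>

definition square_field :: "real^2 \<Rightarrow> real \<times> real \<Rightarrow> real \<times> real" where
  "square_field c y = (2 * u0 / \<alpha> * (c$1 * sqrt (fst y) + fst y + \<Gamma> * snd y),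
     u0 / \<nu> * (c$2 - c$1 * sqrt (fst y) - fst y / 2 + snd y))"

lemma square_derivative:
  assumes c: "c \<in> Feas" and t: "t \<in> {0..1}"
  shows "((\<lambda>t. ((fst (flow c t))^2, snd (flow c t))) has_vector_derivative
    square_field c ((fst (flow c t))^2, snd (flow c t))) (at t within {0..1})"
proof -
  define u e where "u = fst (flow c t)" and "e = snd (flow c t)"
  have u: "u > 0" using feasible_facts[OF c t] by (simp add: u_def)
  have "((\<lambda>t. (fst (flow c t))^2) has_real_derivative
      2 * fst (flow c t) * (u0 / \<alpha> * (c$1 + fst (flow c t) + \<Gamma> * (snd (flow c t) / fst (flow c t))))) (at t within {0..1})"
    by (rule derivative_eq_intros has_derivative_components[OF feasible_facts(3)[OF c t]] refl | simp)+
  moreover have 1: "2 * u * (u0 / \<alpha> * (c$1 + u + \<Gamma> * (e / u))) = 2 * u0 / \<alpha> * (c$1 * sqrt (u^2) + u^2 + \<Gamma> * e)"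
    using u pos by (simp add: field_simps power2_eq_square)
  moreover have 2: "u0 / \<nu> * (c$2 - c$1 * u - 1/2 * u^2 + e) = u0 / \<nu> * (c$2 - c$1 * sqrt (u^2) - u^2 / 2 + e)"
    using u by simp
  ultimately show ?thesis
    using has_vector_derivative_real_Pair[OF _ has_derivative_components(2)[OF feasible_facts(3)[OF c t]]]
    unfolding u_def[symmetric] e_def[symmetric] square_field_def fst_conv snd_conv 1 2
    by blast
qed

abbreviation "Quadrant \<equiv> {b :: real^2. b$1 > 0 \<and> b$2 > 0}"

text \<open>\<open>sqrt\<close> is extended to negative arguments as an odd function and is
  continuous on all of R, so \<open>S\<close> may be any set.\<close>

lemma square_field_continuous:
  "continuous_on S (\<lambda>(c, y). square_field c y)"
  unfolding square_field_def split_def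
  by (intro continuous_on_Pair continuous_on_mult continuous_on_add continuous_on_diff continuous_on_divide
      continuous_on_const continuous_on_real_sqrt continuous_on_fst continuous_on_snd continuous_on_id
      continuous_on_component) auto

lemma compact_Quadrant_subset:
  assumes K: "compact K" "K \<subseteq> Quadrant"
  obtains \<delta> R where "0 < \<delta>" "\<And>b. b \<in> K \<Longrightarrow> \<delta> \<le> b$1 \<and> \<delta> \<le> b$2 \<and> b$1 \<le> R \<and> b$2 \<le> R"
proof (cases "K = {}")
  case True then show thesis using that[of 1 1] by auto
next
  case False
  obtain b1 where b1: "b1 \<in> K" "\<And>b. b \<in> K \<Longrightarrow> b1$1 \<le> b$1"
    using continuous_attains_inf[OF K(1) False continuous_on_component[OF continuous_on_id], of 1] by auto
  obtain b2 where b2: "b2 \<in> K" "\<And>b. b \<in> K \<Longrightarrow> b2$2 \<le> b$2"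
    using continuous_attains_inf[OF K(1) False continuous_on_component[OF continuous_on_id], of 2] by auto
  obtain R where R: "\<And>b. b \<in> K \<Longrightarrow> norm b \<le> R"
    using compact_imp_bounded[OF K(1)] by (auto simp: bounded_iff)
  show thesis
  proof (rule that[of "min (b1$1) (b2$2)" R])
    show "0 < min (b1$1) (b2$2)" using b1(1) b2(1) K(2) by auto
    fix b assume b: "b \<in> K"
    have "b$1 \<le> R" "b$2 \<le> R"
      using R[OF b] component_le_norm_cart[of b 1] component_le_norm_cart[of b 2] by linarith+
    then show "min (b1$1) (b2$2) \<le> b$1 \<and> min (b1$1) (b2$2) \<le> b$2 \<and> b$1 \<le> R \<and> b$2 \<le> R"
      using b1(2)[OF b] b2(2)[OF b] by linarith
  qed
qed

text \<open>Arzela-Ascoli for the pairs (u^2, e): their derivatives are bounded uniformly in n even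
  if u comes close to 0, whereas no such bound is at hand for u itself. The limit solves the squared
  system for the limit parameter, and \<open>nonnegative_limit_feasible\<close> returns it to the
  original one.\<close>

lemma feasible_subsequence:
  assumes \<delta>: "0 < \<delta>" and c: "\<And>n. c n \<in> Feas"
    and end1: "\<And>n. flow (c n) 1 \<in> cbox (\<delta>, \<delta>) (R, R)"
  obtains l r where "l \<in> Feas" "strict_mono (r :: nat \<Rightarrow> nat)" "(c \<circ> r) \<longlonglongrightarrow> l"
proof -
  obtain N where N: "\<And>n t. t \<in> {0..1} \<Longrightarrow> \<bar>c n$1\<bar> \<le> N \<and> \<bar>c n$2\<bar> \<le> N \<and> fst (flow (c n) t) \<le> N \<and> snd (flow (c n) t) \<le> N"
    using bounded_on_compact[OF \<delta>, of R] c end1 by metis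
  \<comment> \<open>The radius \<open>2 * N\<close> bounds the sum of the two components of
    \<open>c n\<close>. On the compact set \<open>D1 \<times> D2\<close>, which contains all
    parameters and states, the squared field is bounded and uniformly continuous.\<close>
  define D1 where "D1 = cball (0 :: real^2) (2 * N)"
  define D2 where "D2 = cbox (0, 0) (N^2, N)"
  have cD: "c n \<in> D1" for n
  proof -
    have "norm (c n) \<le> \<bar>c n$1\<bar> + \<bar>c n$2\<bar>" using norm_le_l1_cart[of "c n"] by (simp add: sum_2)
    then show ?thesis using N[of 0 n] by (simp add: D1_def)
  qed
  define y where "y n t = ((fst (flow (c n) t))^2, snd (flow (c n) t))" for n t
  have yD: "y n t \<in> D2" if "t \<in> {0..1}" for n t
  proof -
    have b: "0 < fst (flow (c n) t)" "0 < snd (flow (c n) t)" "fst (flow (c n) t) \<le> N" "snd (flow (c n) t) \<le> N"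
      using N[OF that, of n] feasible_facts(1,2)[OF c that, of n] by auto
    then have "(fst (flow (c n) t))^2 \<le> N^2" by (intro power_mono) auto
    then show ?thesis using b by (simp add: y_def D2_def cbox_Pair_eq)
  qed
  have der: "(y n has_vector_derivative square_field (c n) (y n t)) (at t within {0..1})" if "t \<in> {0..1}" for n t
    using square_derivative[OF c that] unfolding y_def .
  have compactD: "compact (D1 \<times> D2)" unfolding D1_def D2_def by (intro compact_Times compact_cball compact_cbox)
  have "bounded ((\<lambda>(c, y). square_field c y) ` (D1 \<times> D2))"
    by (intro compact_imp_bounded compact_continuous_image square_field_continuous compactD)
  then obtain \<Lambda> where \<Lambda>: "\<And>c y. c \<in> D1 \<Longrightarrow> y \<in> D2 \<Longrightarrow> norm (square_field c y) \<le> \<Lambda>"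
    unfolding bounded_iff by fastforce
  have ucont: "uniformly_continuous_on (D1 \<times> D2) (\<lambda>(c, y). square_field c y)"
    by (rule compact_uniformly_continuous[OF square_field_continuous compactD])
  have lip: "norm (y n s - y n t) \<le> \<Lambda> * norm (s - t)" if "s \<in> {0..1}" "t \<in> {0..1}" for n s t
  proof (rule differentiable_bound[where S="{0..1}" and f'="\<lambda>t h. h *\<^sub>R square_field (c n) (y n t)"])
    show "(y n has_derivative (\<lambda>h. h *\<^sub>R square_field (c n) (y n t))) (at t within {0..1})" if "t \<in> {0..1}" for t
      using der[OF that] unfolding has_vector_derivative_def .
    show "onorm (\<lambda>h. h *\<^sub>R square_field (c n) (y n t)) \<le> \<Lambda>" if "t \<in> {0..1}" for t
    proof (rule onorm_le)
      fix h :: real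
      show "norm (h *\<^sub>R square_field (c n) (y n t)) \<le> \<Lambda> * norm h"
        unfolding norm_scaleR mult.commute[of \<Lambda>] real_norm_def
        by (rule mult_left_mono[OF \<Lambda>[OF cD yD[OF that]]]) simp
    qed
  qed (use that in auto)
  obtain l r1 where l: "l \<in> D1" "strict_mono (r1 :: nat \<Rightarrow> nat)" "(c \<circ> r1) \<longlonglongrightarrow> l"
  proof -
    have "seq_compact D1" unfolding D1_def by (intro compact_imp_seq_compact compact_cball)
    from seq_compactE[OF this allI[OF cD]] show thesis using that .
  qed
  have equi: "\<exists>d>0. \<forall>n t. t \<in> {0..1} \<and> norm (s - t) < d \<longrightarrow> norm (y (r1 n) s - y (r1 n) t) < e"
    if "s \<in> {0..1}" "0 < e" for s e
  proof (intro exI[of _ "e / (\<bar>\<Lambda>\<bar> + 1)"] conjI allI impI)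
    show "0 < e / (\<bar>\<Lambda>\<bar> + 1)" using that by (simp add: divide_pos_pos)
    fix n t assume t: "t \<in> {0..1} \<and> norm (s - t) < e / (\<bar>\<Lambda>\<bar> + 1)"
    have "norm (y (r1 n) s - y (r1 n) t) \<le> \<Lambda> * norm (s - t)" using lip that t by blast
    also have "\<dots> \<le> (\<bar>\<Lambda>\<bar> + 1) * norm (s - t)" by (intro mult_right_mono) auto
    also have "\<dots> < e" using t by (simp add: pos_less_divide_eq mult.commute)
    finally show "norm (y (r1 n) s - y (r1 n) t) < e" .
  qed
  obtain By where By: "\<And>y. y \<in> D2 \<Longrightarrow> norm y \<le> By"
    using compact_imp_bounded[OF compact_cbox] unfolding D2_def bounded_iff by blast
  have yB: "norm (y (r1 n) t) \<le> By" if "t \<in> {0..1}" for n t using By[OF yD[OF that]] .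
  obtain g r2 where g: "continuous_on {0..1} g" "strict_mono (r2 :: nat \<Rightarrow> nat)"
    "\<And>e. 0 < e \<Longrightarrow> \<exists>M. \<forall>n t. n \<ge> M \<and> t \<in> {0..1} \<longrightarrow> norm (y (r1 (r2 n)) t - g t) < e"
    using Arzela_Ascoli[OF compact_Icc yB equi] by blast
  define r where "r = r1 \<circ> r2"
  have r: "strict_mono r" unfolding r_def using l(2) g(2) by (rule strict_mono_o)
  have cr: "(\<lambda>n. c (r n)) \<longlonglongrightarrow> l"
    using LIMSEQ_subseq_LIMSEQ[OF l(3) g(2)] by (simp add: r_def o_def)
  have unif: "\<exists>M. \<forall>n\<ge>M. \<forall>t\<in>{0..1}. norm (y (r n) t - g t) < e" if "e > 0" for e
    using g(3)[OF that] unfolding r_def o_def by blast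
  have lim: "(\<lambda>n. y (r n) t) \<longlonglongrightarrow> g t" if "t \<in> {0..1}" for t
    unfolding LIMSEQ_iff using unif that by blast
  have gD: "g t \<in> D2" if "t \<in> {0..1}" for t
    unfolding D2_def by (rule closed_sequentially[OF closed_cbox _ lim[OF that]]) (use yD[OF that] in \<open>simp add: D2_def\<close>)
  \<comment> \<open>The derivatives converge uniformly in \<open>t\<close>: the parameters converge,
    the states converge uniformly, and the field is uniformly continuous.\<close>
  have uder: "\<forall>\<^sub>F n in sequentially. \<forall>t\<in>{0..1}. \<forall>h.
      norm (h *\<^sub>R square_field (c (r n)) (y (r n) t) - h *\<^sub>R square_field l (g t)) \<le> e * norm h" if ep: "e > 0" for e
  proof -
    obtain d where d: "d > 0" "\<And>x x'. x \<in> D1 \<times> D2 \<Longrightarrow> x' \<in> D1 \<times> D2 \<Longrightarrow> dist x' x < d \<Longrightarrow>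
        dist ((\<lambda>(c, y). square_field c y) x') ((\<lambda>(c, y). square_field c y) x) < e"
      using ucont[unfolded uniformly_continuous_on_def, rule_format, OF ep] by blast
    have d2: "d / 2 > 0" using d(1) by simp
    obtain M1 where M1: "\<And>n t. n \<ge> M1 \<Longrightarrow> t \<in> {0..1} \<Longrightarrow> norm (y (r n) t - g t) < d / 2"
      using unif[OF d2] by blast
    obtain M2 where M2: "\<And>n. n \<ge> M2 \<Longrightarrow> norm (c (r n) - l) < d / 2"
      using cr[unfolded LIMSEQ_iff, rule_format, OF d2] by blast
    show ?thesis
    proof (rule eventually_sequentiallyI[of "max M1 M2"], intro ballI allI)
      fix n t and h :: real assume n: "max M1 M2 \<le> n" and t: "t \<in> {0..1::real}"
      have "dist (c (r n), y (r n) t) (l, g t) \<le> norm (c (r n) - l) + norm (y (r n) t - g t)"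
        unfolding dist_norm using norm_Pair_le[of "c (r n) - l" "y (r n) t - g t"] by simp
      also have "\<dots> < d" using M1[of n t] M2[of n] n t by simp
      finally have "dist (square_field (c (r n)) (y (r n) t)) (square_field l (g t)) < e"
        using d(2)[of "(l, g t)" "(c (r n), y (r n) t)"] cD l(1) yD[OF t] gD[OF t] by simp
      then show "norm (h *\<^sub>R square_field (c (r n)) (y (r n) t) - h *\<^sub>R square_field l (g t)) \<le> e * norm h"
        unfolding dist_norm scaleR_diff_right[symmetric] norm_scaleR
        unfolding mult.commute[of e] real_norm_def by (intro mult_left_mono) auto
    qed
  qed
  have y0: "y n 0 = (u0^2, e0)" for n
    using feasible_facts(4)[OF c, of 0 n] by (simp add: y_def)
  have "\<exists>G. \<forall>t\<in>{0..1}. (\<lambda>n. y (r n) t) \<longlonglongrightarrow> G t \<and> (G has_derivative (\<lambda>h. h *\<^sub>R square_field l (g t))) (at t within {0..1})"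
  proof (rule has_derivative_sequence[where f'="\<lambda>n t h. h *\<^sub>R square_field (c (r n)) (y (r n) t)"])
    show "(y (r n) has_derivative (\<lambda>h. h *\<^sub>R square_field (c (r n)) (y (r n) t))) (at t within {0..1})"
      if "t \<in> {0..1}" for n t
      using der[OF that] unfolding has_vector_derivative_def .
    show "(\<lambda>n. y (r n) 0) \<longlonglongrightarrow> (u0^2, e0)" unfolding y0 by (rule tendsto_const)
    show "(0::real) \<in> {0..1}" by simp
  qed (use uder in auto)
  then obtain G where G: "\<And>t. t \<in> {0..1} \<Longrightarrow> (\<lambda>n. y (r n) t) \<longlonglongrightarrow> G t"
    "\<And>t. t \<in> {0..1} \<Longrightarrow> (G has_derivative (\<lambda>h. h *\<^sub>R square_field l (g t))) (at t within {0..1})" by blast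
  \<comment> \<open>The limit that comes with the derivative is identified with the Arzela-Ascoli
    limit, so that the equation becomes one for \<open>g\<close> alone.\<close>
  have Gg: "G t = g t" if "t \<in> {0..1}" for t using LIMSEQ_unique[OF G(1)[OF that] lim[OF that]] .
  have der_g: "(g has_vector_derivative square_field l (g t)) (at t within {0..1})" if "t \<in> {0..1}" for t
    unfolding has_vector_derivative_def
    by (rule has_derivative_transform[OF that _ G(2)[OF that]]) (simp add: Gg)
  have ends: "g 0 = (u0^2, e0)" "\<delta>^2 \<le> fst (g 1)" "\<delta> \<le> snd (g 1)"
  proof -
    show "g 0 = (u0^2, e0)" using LIMSEQ_unique[OF lim[of 0]] y0 by simp
    have "y n 1 \<in> cbox (\<delta>^2, \<delta>) (N^2, N)" for n
    proof -
      have "\<delta> \<le> fst (flow (c n) 1)" "\<delta> \<le> snd (flow (c n) 1)"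
        using end1[of n] by (auto simp: cbox_Pair_eq mem_Times_iff)
      moreover from this have "\<delta>^2 \<le> (fst (flow (c n) 1))^2" using \<delta> by (intro power_mono) auto
      ultimately show ?thesis using yD[of 1 n] by (simp add: y_def D2_def cbox_Pair_eq)
    qed
    then have "g 1 \<in> cbox (\<delta>^2, \<delta>) (N^2, N)"
      using closed_sequentially[OF closed_cbox _ lim[of 1]] by simp
    then show "\<delta>^2 \<le> fst (g 1)" "\<delta> \<le> snd (g 1)" by (auto simp: cbox_Pair_eq mem_Times_iff)
  qed
  have "feasible l (\<lambda>t. (sqrt (fst (g t)), snd (g t)))"
  proof (rule nonnegative_limit_feasible)
    fix t :: real assume t: "t \<in> {0..1}"
    show "((\<lambda>t. fst (g t)) has_real_derivative 2 * u0 / \<alpha> * (l$1 * sqrt (fst (g t)) + fst (g t) + \<Gamma> * snd (g t))) (at t within {0..1})"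
      "((\<lambda>t. snd (g t)) has_real_derivative u0 / \<nu> * (l$2 - l$1 * sqrt (fst (g t)) - fst (g t) / 2 + snd (g t))) (at t within {0..1})"
      using bounded_linear.has_vector_derivative[OF bounded_linear_fst der_g[OF t]]
        bounded_linear.has_vector_derivative[OF bounded_linear_snd der_g[OF t]]
      by (simp_all add: has_real_derivative_iff_has_vector_derivative square_field_def)
    show "0 \<le> fst (g t) \<and> 0 \<le> snd (g t)" using gD[OF t] by (auto simp: D2_def cbox_Pair_eq mem_Times_iff)
  next
    have "0 < \<delta>^2" using \<delta> by simp
    then show "fst (g 1) > 0" "snd (g 1) > 0" using ends \<delta> by linarith+
  qed (use ends in simp_all)
  then have "l \<in> Feas" using feasible_iff by blast
  then show thesis using that[OF _ r] cr by (simp add: o_def)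
qed

text \<open>A compact part of the open quadrant lies in a box away from both axes, where a
  convergent subsequence of parameters with feasible limit exists; continuity places the limit value
  in \<open>K\<close>.\<close>

lemma Psi_proper:
  assumes K: "compact K" "K \<subseteq> Quadrant"
  shows "compact {c \<in> Feas. Psi c \<in> K}"
  unfolding compact_def
proof (intro allI impI)
  fix c :: "nat \<Rightarrow> real^2" assume c: "\<forall>n. c n \<in> {c \<in> Feas. Psi c \<in> K}"
  obtain \<delta> R where \<delta>: "0 < \<delta>" "\<And>b. b \<in> K \<Longrightarrow> \<delta> \<le> b$1 \<and> \<delta> \<le> b$2 \<and> b$1 \<le> R \<and> b$2 \<le> R"
    using compact_Quadrant_subset[OF K] by blast
  have cF: "c n \<in> Feas" and cK: "Psi (c n) \<in> K" for n using c by auto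
  have end1: "flow (c n) 1 \<in> cbox (\<delta>, \<delta>) (R, R)" for n
    using \<delta>(2)[OF cK[of n]] by (simp add: Psi_eq_flow[OF cF] cbox_Pair_eq mem_Times_iff)
  obtain l r where l: "l \<in> Feas" "strict_mono (r :: nat \<Rightarrow> nat)" "(c \<circ> r) \<longlonglongrightarrow> l"
    by (rule feasible_subsequence[OF \<delta>(1) cF end1])
  have "(\<lambda>n. Psi ((c \<circ> r) n)) \<longlonglongrightarrow> Psi l"
    by (rule continuous_on_tendsto_compose[OF continuous_Psi l(3,1)]) (simp add: cF)
  then have "Psi l \<in> K"
    using closed_sequentially[OF compact_imp_closed[OF K(1)], of "\<lambda>n. Psi ((c \<circ> r) n)"] cK by simp
  then show "\<exists>l\<in>{c \<in> Feas. Psi c \<in> K}. \<exists>r. strict_mono r \<and> (c \<circ> r) \<longlonglongrightarrow> l"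
    using l by blast
qed

section \<open>A connected region of feasible parameters that contains a whole fibre\<close>

text \<open>For \<open>- c\<^sub>1\<close> large the energy \<open>e\<close> increases, since \<open>- c\<^sub>1 u - u\<^sup>2 / 2 > 0\<close> on the
  range of \<open>u\<close>; this keeps \<open>u\<close> away from \<open>0\<close> as well.\<close>

definition strong_region :: "real \<Rightarrow> (real^2) set" where
  "strong_region p = {c. 0 < c$2 \<and> c$2 < p \<and> c$1 < - u_bound p / 2}"

lemma connected_strong_region: "connected (strong_region p)"
proof (rule convex_connected, rule convexI)
  fix x y :: "real^2" and s t :: real
  assume xy: "x \<in> strong_region p" "y \<in> strong_region p" and st: "0 \<le> s" "0 \<le> t" "s + t = 1"
  have halfspace: "s * a + t * b < k" if "a < k" "b < k" for a b k :: real
    using convex_bound_lt[OF that st] .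
  show "s *\<^sub>R x + t *\<^sub>R y \<in> strong_region p"
    using xy halfspace[of "x$2" p "y$2"] halfspace[of "- x$2" 0 "- y$2"] halfspace[of "x$1" "- u_bound p / 2" "y$1"]
    by (simp add: strong_region_def)
qed

lemma strong_region_Feas:
  assumes p: "0 < p"
  shows "strong_region p \<subseteq> Feas"
proof
  fix c assume "c \<in> strong_region p"
  then have c: "0 < c$2" "c$2 < p" "c$1 < - u_bound p / 2" by (auto simp: strong_region_def)
  \<comment> \<open>\<open>U\<close> and \<open>E\<close> are the energy bounds for u and e. At u =
    \<open>\<delta>\<close> and e >= e0 the term Gamma e/u is at least 2 M, while c1 = - M, so u
    cannot cross \<open>\<delta>\<close> downwards.\<close>
  define U E M \<delta> where "U = u_bound p" and "E = e_bound p" and "M = - c$1" and "\<delta> = min u0 (\<Gamma> * e0 / (2 * M))"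
  have w0: "energy (u0, e0) \<le> energy_bound p" using energy_bound_ge p by simp
  have UE: "u0 \<le> U" "e0 \<le> E"
    using energy_le_imp_components_le[OF w0] pos unfolding U_def E_def by simp_all
  have M: "U < 2 * M" "0 < M" using c UE pos by (auto simp: M_def U_def)
  have \<delta>: "0 < \<delta>" "\<delta> \<le> u0" "M < \<Gamma> * (e0 / \<delta>)"
  proof -
    show 1: "0 < \<delta>" "\<delta> \<le> u0" using pos M by (auto simp: \<delta>_def)
    have "\<delta> \<le> \<Gamma> * e0 / (2 * M)" by (simp add: \<delta>_def)
    then have "2 * M * \<delta> \<le> \<Gamma> * e0" using M by (simp add: field_simps)
    then have "M * \<delta> < \<Gamma> * e0" using M 1 mult_pos_pos[of M \<delta>] by linarith
    then show "M < \<Gamma> * (e0 / \<delta>)" using 1 by (simp add: field_simps)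
  qed
  define R where "R = max U E + 1"
  \<comment> \<open>\<open>K\<close> is the box that the solution is shown not to leave.
    \<open>K'\<close> is a somewhat larger one, still away from u = 0, as
    \<open>continuation\<close> requires.\<close>
  define K' where "K' = cbox (\<delta> / 2, e0 / 2) (U + 1, E + 1)"
  define K where "K = cbox (\<delta>, e0) (U, E)"
  define L where "L = field_lip (\<delta> / 2) R (norm c)"
  have "\<exists>X. X 0 = (u0, e0) \<and> (\<forall>t\<in>{0..1}. X t \<in> K \<and> (X has_vector_derivative field c (X t)) (at t within {0..1}))"
  proof (rule continuation[where G="field c" and K="K" and K'="K'" and L=L and a="(u0, e0)"])
    show "convex K'" "closed K'" "closed K" unfolding K_def K'_def by (rule convex_box closed_cbox)+
    show "K \<subseteq> interior K'"
      unfolding K_def K'_def interior_cbox using \<delta> pos by (auto simp: cbox_Pair_eq mem_box Basis_prod_def)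
    show "(u0, e0) \<in> K" unfolding K_def using UE \<delta> by (simp add: cbox_Pair_eq)
    show "norm (field c x - field c y) \<le> L * norm (x - y)" if "x \<in> K'" "y \<in> K'" for x y
      unfolding L_def
    proof (rule field_lipschitz)
      have "K' \<subseteq> cbox (\<delta> / 2, - R) (R, R)"
        unfolding K'_def R_def using UE pos by (auto simp: cbox_Pair_eq)
      then show "x \<in> cbox (\<delta> / 2, - R) (R, R)" "y \<in> cbox (\<delta> / 2, - R) (R, R)" using that by auto
    qed (use \<delta> in simp_all)
    show "0 \<le> L" unfolding L_def using \<delta> UE pos by (intro field_lip_nonneg) (auto simp: R_def)
    show "X t \<in> K" if T: "T \<in> {0..1}" and X0: "X 0 = (u0, e0)"
      and X: "\<And>t. t \<in> {0..T} \<Longrightarrow> X t \<in> K' \<and> (X has_vector_derivative field c (X t)) (at t within {0..T})"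
      and t: "t \<in> {0..T}" for T X t
    proof -
      have sign: "0 < fst (X s)" "0 < snd (X s)" if "s \<in> {0..T}" for s
        using X[OF that] \<delta> pos by (auto simp: K'_def cbox_Pair_eq mem_Times_iff)
      have sol: "solves c {0..T} X"
        unfolding solves_def using T X0 X sign by (auto simp: is_interval_cc)
      have le: "fst (X s) \<le> U" "snd (X s) \<le> E" if s: "s \<in> {0..T}" for s
      proof -
        have "energy (X s) \<le> energy_bound p"
          using sol by (rule energy_le) (use c p T s sign in \<open>auto intro: less_imp_le\<close>)
        then show "fst (X s) \<le> U" "snd (X s) \<le> E"
          using energy_le_imp_components_le sign[OF s] unfolding U_def E_def by (meson less_imp_le)+
      qed
      let ?e' = "\<lambda>s. u0 / \<nu> * (c$2 - c$1 * fst (X s) - 1/2 * (fst (X s))^2 + snd (X s))"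
      let ?u' = "\<lambda>s. u0 / \<alpha> * (c$1 + fst (X s) + \<Gamma> * (snd (X s) / fst (X s)))"
      have e_ge: "e0 \<le> snd (X s)" if s: "s \<in> {0..T}" for s
      proof -
        have "0 * (s - 0) \<le> snd (X s) - snd (X 0)"
        proof (rule deriv_ge_imp_diff_ge[of 0 T _ ?e'])
          show "((\<lambda>t. snd (X t)) has_real_derivative ?e' r) (at r within {0..T})" if "r \<in> {0..T}" for r
            using has_derivative_components(2) X[OF that] by blast
          fix r assume "r \<in> {0..s}"
          then have r: "r \<in> {0..T}" using s by auto
          \<comment> \<open>Here c1 < - U/2 enters: M - u/2 is nonnegative for u <= U. With c2 > 0
            and e > 0 it makes e' nonnegative.\<close>
          have "0 \<le> fst (X r) * (M - fst (X r) / 2)"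
            using sign[OF r] le[OF r] M by (intro mult_nonneg_nonneg) auto
          then have "0 \<le> c$2 - c$1 * fst (X r) - 1/2 * (fst (X r))^2 + snd (X r)"
            using c sign[OF r] by (simp add: M_def algebra_simps power2_eq_square)
          then show "0 \<le> ?e' r" using pos by (intro mult_nonneg_nonneg) auto
        qed (use s in auto)
        then show ?thesis by (simp add: X0)
      qed
      have "\<delta> \<le> fst (X t)"
      proof (rule barrier_forward[of 0 T "\<lambda>t. fst (X t)" ?u' 0 \<delta>])
        show "((\<lambda>t. fst (X t)) has_real_derivative ?u' r) (at r within {0..T})" if "r \<in> {0..T}" for r
          using has_derivative_components(1) X[OF that] by blast
        fix r assume r: "r \<in> {0..T}" "fst (X r) = \<delta>"
        have "\<Gamma> * (e0 / \<delta>) \<le> \<Gamma> * (snd (X r) / \<delta>)"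
          using e_ge[OF r(1)] \<delta> pos by (intro mult_left_mono divide_right_mono) auto
        then have "0 < c$1 + \<delta> + \<Gamma> * (snd (X r) / \<delta>)" using \<delta> by (simp add: M_def)
        then show "0 < ?u' r" unfolding r(2) using pos by (intro mult_pos_pos) auto
      qed (use t X0 \<delta> in auto)
      then show "X t \<in> K"
        using le[OF t] e_ge[OF t] by (simp add: K_def cbox_Pair_eq mem_Times_iff)
    qed
    fix X assume "X 0 = (u0, e0)"
      "\<And>t. t \<in> {0..1} \<Longrightarrow> X t \<in> K \<and> (X has_vector_derivative field c (X t)) (at t within {0..1})"
    then show "\<exists>X. X 0 = (u0, e0) \<and> (\<forall>t\<in>{0..1}. X t \<in> K \<and> (X has_vector_derivative field c (X t)) (at t within {0..1}))"
      by blast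
  qed
  then obtain X where X: "X 0 = (u0, e0)"
    "\<And>t. t \<in> {0..1} \<Longrightarrow> X t \<in> K \<and> (X has_vector_derivative field c (X t)) (at t within {0..1})" by blast
  have "0 < fst (X t) \<and> 0 < snd (X t)" if "t \<in> {0..1}" for t
    using X(2)[OF that] \<delta> pos by (auto simp: K_def cbox_Pair_eq mem_Times_iff)
  then have "feasible c X" unfolding feasible_def solves_def using X by (auto simp: is_interval_cc)
  then show "c \<in> Feas" using feasible_iff by blast
qed

text \<open>Suppose c1 >= - M. Since e' is bounded above, e >= e1/2 on a last stretch of length
  \<open>h\<close>. There a small u has Gamma e outweigh c1 u, so u^2 grows at rate at least
  \<open>k\<close> and u(1)^2 >= k h, which contradicts a small final u.\<close>

lemma c1_less_if_final_u_small:
  assumes p: "0 < p" and e1: "0 < e1" and M: "0 < M"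
  shows "\<exists>\<eta>>0. \<forall>c\<in>Feas. c$2 \<le> p \<and> snd (flow c 1) = e1 \<and> fst (flow c 1) < \<eta> \<longrightarrow> c$1 < - M"
proof -
  define \<Lambda> where "\<Lambda> = u0 / \<nu> * (p + M * u_bound p + e_bound p)"
  have "0 \<le> energy_bound p" using energy_bound_ge[of p] w0_pos p by simp
  then have "0 \<le> u_bound p" "0 \<le> e_bound p" using pos by (auto simp: u_bound_def e_bound_def)
  then have \<Lambda>: "0 < \<Lambda>" unfolding \<Lambda>_def using pos p M by (auto intro!: mult_pos_pos add_pos_nonneg divide_pos_pos)
  define h where "h = min 1 (e1 / (2 * \<Lambda>))"
  have h: "0 < h" "h \<le> 1" "\<Lambda> * h \<le> e1 / 2" using \<Lambda> e1 by (auto simp: h_def min_def field_simps)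
  \<comment> \<open>For u < \<open>\<eta>1\<close> and e >= e1/2 the loss - c1 u uses at most half
    of Gamma e, leaving Gamma e1/4. At u = \<open>\<eta>1\<close> one has Gamma e/u >= 2 M, so u
    could not come down again through this level before time 1.\<close>
  define \<eta>1 where "\<eta>1 = \<Gamma> * e1 / (4 * M)"
  have \<eta>1: "0 < \<eta>1" "M * \<eta>1 = \<Gamma> * e1 / 4" using pos e1 M by (auto simp: \<eta>1_def)
  define k where "k = 2 * u0 / \<alpha> * (\<Gamma> * e1 / 4)"
  have k: "0 < k" using pos e1 by (simp add: k_def)
  define \<eta> where "\<eta> = min \<eta>1 (sqrt (k * h))"
  have \<eta>: "0 < \<eta>" using \<eta>1 k h by (simp add: \<eta>_def)
  have "c$1 < - M" if c: "c \<in> Feas" and c2: "c$2 \<le> p" and end1: "snd (flow c 1) = e1" and small: "fst (flow c 1) < \<eta>" for c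
  proof (rule ccontr)
    assume "\<not> c$1 < - M"
    then have c1: "- M \<le> c$1" by simp
    let ?u = "\<lambda>t. fst (flow c t)" and ?e = "\<lambda>t. snd (flow c t)"
    let ?e' = "\<lambda>s. u0 / \<nu> * (c$2 - c$1 * ?u s - 1/2 * (?u s)^2 + ?e s)"
    let ?u' = "\<lambda>s. u0 / \<alpha> * (c$1 + ?u s + \<Gamma> * (?e s / ?u s))"
    have der_e: "(?e has_real_derivative ?e' s) (at s within {0..1})" if "s \<in> {0..1}" for s
      using has_derivative_components(2) feasible_facts(3)[OF c that] by blast
    have der_u: "(?u has_real_derivative ?u' s) (at s within {0..1})" if "s \<in> {0..1}" for s
      using has_derivative_components(1) feasible_facts(3)[OF c that] by blast
    have e_ge: "e1 / 2 \<le> ?e s" if s: "s \<in> {1 - h..1}" for s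
    proof -
      have "?e 1 - ?e s \<le> \<Lambda> * (1 - s)"
      proof (rule deriv_le_imp_diff_le[of 0 1 ?e ?e', OF der_e])
        fix r assume "r \<in> {s..1}"
        then have r: "r \<in> {0..1}" using s h by auto
        have u: "0 < ?u r" "?u r \<le> u_bound p" "?e r \<le> e_bound p"
          using feasible_facts(1)[OF c r] flow_components_le(2,3)[OF c c2 _ r] p by auto
        have "- c$1 * ?u r \<le> M * ?u r" using u c1 by (intro mult_right_mono) auto
        also have "\<dots> \<le> M * u_bound p" using u M by simp
        finally have "- (c$1 * ?u r) \<le> M * u_bound p" by simp
        moreover have "0 \<le> (?u r)^2" by simp
        ultimately have "c$2 - c$1 * ?u r - 1/2 * (?u r)^2 + ?e r \<le> p + M * u_bound p + e_bound p"
          using c2 u(3) by linarith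
        then show "?e' r \<le> \<Lambda>" unfolding \<Lambda>_def using pos by (intro mult_left_mono) auto
      qed (use s h in auto)
      also have "\<dots> \<le> \<Lambda> * h" using s \<Lambda> by (intro mult_left_mono) auto
      finally show ?thesis using h(3) end1 by linarith
    qed
    have below: "?u s < \<eta>1" if s: "s \<in> {1 - h..1}" for s
    proof (rule ccontr)
      assume "\<not> ?u s < \<eta>1"
      then have init: "\<eta>1 \<le> ?u s" by simp
      have "\<eta>1 \<le> ?u 1"
      proof (rule barrier_forward[of 0 1 ?u ?u', OF der_u _ init])
        fix r assume r: "r \<in> {s..1}" "?u r = \<eta>1"
        have "e1 / 2 \<le> ?e r" using r s by (intro e_ge) auto
        then have "\<Gamma> * (e1 / 2 / \<eta>1) \<le> \<Gamma> * (?e r / \<eta>1)"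
          using \<eta>1 pos by (intro mult_left_mono divide_right_mono) auto
        moreover have "\<Gamma> * (e1 / 2 / \<eta>1) = 2 * M" using \<eta>1 pos e1 M by (simp add: \<eta>1_def field_simps)
        ultimately have "0 < c$1 + \<eta>1 + \<Gamma> * (?e r / \<eta>1)" using c1 M \<eta>1 by linarith
        then show "0 < ?u' r" unfolding r(2) using pos by (intro mult_pos_pos) auto
      qed (use s h in auto)
      then show False using small by (simp add: \<eta>_def)
    qed
    have "k * (1 - (1 - h)) \<le> (?u 1)^2 - (?u (1 - h))^2"
    proof (rule deriv_ge_imp_diff_ge[of 0 1 "\<lambda>t. (?u t)^2" "\<lambda>t. 2 * ?u t * ?u' t"])
      show "((\<lambda>t. (?u t)^2) has_real_derivative 2 * ?u r * ?u' r) (at r within {0..1})" if "r \<in> {0..1}" for r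
        by (rule derivative_eq_intros der_u[OF that] refl | simp)+
      fix r assume r: "r \<in> {1 - h..1}"
      then have r01: "r \<in> {0..1}" using h by auto
      have u: "0 < ?u r" using feasible_facts(1)[OF c r01] .
      have "- (M * ?u r) \<le> c$1 * ?u r" using mult_right_mono[OF c1, of "?u r"] u by simp
      moreover have "M * ?u r \<le> \<Gamma> * e1 / 4" using mult_left_mono[of "?u r" \<eta>1 M] below[OF r] M \<eta>1 by simp
      moreover have "\<Gamma> * (e1 / 2) \<le> \<Gamma> * ?e r" using e_ge[OF r] pos by (intro mult_left_mono) auto
      moreover have "0 \<le> (?u r)^2" by simp
      ultimately have "\<Gamma> * e1 / 4 \<le> c$1 * ?u r + (?u r)^2 + \<Gamma> * ?e r" by linarith
      then have "k \<le> 2 * u0 / \<alpha> * (c$1 * ?u r + (?u r)^2 + \<Gamma> * ?e r)"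
        unfolding k_def using pos by (intro mult_left_mono) auto
      also have "\<dots> = 2 * ?u r * ?u' r" using u pos by (simp add: field_simps power2_eq_square)
      finally show "k \<le> 2 * ?u r * ?u' r" .
    qed (use h in auto)
    then have "k * h \<le> (?u 1)^2 - (?u (1 - h))^2" by simp
    then have "k * h \<le> (?u 1)^2" using zero_le_power2[of "?u (1 - h)"] by linarith
    then have "sqrt (k * h) \<le> ?u 1" using feasible_facts(1)[OF c, of 1] by (intro real_le_lsqrt) (auto intro: less_imp_le)
    then show False using small by (simp add: \<eta>_def)
  qed
  then show ?thesis using \<eta> by blast
qed

lemma fibre_in_strong_region:
  obtains b p where "b \<in> Quadrant" "0 < p" "{c \<in> Feas. Psi c = b} \<subseteq> strong_region p"
proof -
  \<comment> \<open>If c2 <= 0, the final energy is at most \<open>energy_bound 0\<close>. The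
    summand 1 makes nu e1 exceed this, which forces c2 > 0.\<close>
  define e1 where "e1 = energy_bound 0 / \<nu> + 1"
  \<comment> \<open>The bound of \<open>c2_le\<close> for end values u1 <= 1 and e1, plus 1 for
    strictness. It does not depend on u1, so \<open>\<eta>\<close> and then u1 can be chosen
    afterwards.\<close>
  define p where "p = (\<nu> * e1 + \<alpha> / 2) / u0 + 1"
  have "0 \<le> energy_bound 0" using energy_bound_ge[of 0] w0_pos by simp
  then have e1: "0 < e1" "energy_bound 0 < \<nu> * e1" using pos by (auto simp: e1_def add_nonneg_pos distrib_left)
  have p: "0 < p" using pos e1 by (simp add: p_def add_pos_pos)
  have "w0 \<le> energy_bound p" using energy_bound_ge p by simp
  then have U: "0 < u_bound p" using w0_pos pos by (simp add: u_bound_def)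
  then obtain \<eta> where \<eta>: "0 < \<eta>" "\<And>c. c \<in> Feas \<Longrightarrow> c$2 \<le> p \<Longrightarrow> snd (flow c 1) = e1 \<Longrightarrow>
      fst (flow c 1) < \<eta> \<Longrightarrow> c$1 < - (u_bound p / 2)"
    using c1_less_if_final_u_small[OF p e1(1), of "u_bound p / 2"] by auto
  define u1 where "u1 = min 1 (\<eta> / 2)"
  have u1: "0 < u1" "u1 \<le> 1" "u1 < \<eta>" using \<eta>(1) by (auto simp: u1_def)
  show thesis
  proof (rule that[of "vec_of_pair (u1, e1)" p])
    show "vec_of_pair (u1, e1) \<in> Quadrant" using u1 e1 by simp
    show "0 < p" by (rule p)
    show "{c \<in> Feas. Psi c = vec_of_pair (u1, e1)} \<subseteq> strong_region p"
    proof
      fix c assume "c \<in> {c \<in> Feas. Psi c = vec_of_pair (u1, e1)}"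
      then have c: "c \<in> Feas" and end1: "flow c 1 = (u1, e1)" using Psi_eq_flow by (auto simp: inj_vec_of_pair)
      have "0 < c$2"
      proof (rule ccontr)
        assume "\<not> 0 < c$2"
        then have "energy (flow c 1) \<le> energy_bound 0" by (intro flow_components_le(1)[OF c]) auto
        moreover have "0 \<le> \<alpha> / 2 * u1^2" using pos by simp
        ultimately show False using e1(2) by (simp add: end1 energy_def)
      qed
      moreover have "c$2 < p"
      proof -
        have "u1^2 \<le> 1^2" using u1 by (intro power_mono) auto
        then have "energy (flow c 1) \<le> \<nu> * e1 + \<alpha> / 2" using pos by (simp add: end1 energy_def)
        then have "energy (flow c 1) / u0 \<le> (\<nu> * e1 + \<alpha> / 2) / u0" using pos by (intro divide_right_mono) auto
        then show ?thesis using c2_le[OF c] by (simp add: p_def)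
      qed
      moreover from this have "c$1 < - (u_bound p / 2)" using \<eta>(2)[OF c] u1 by (simp add: end1)
      ultimately show "c \<in> strong_region p" by (simp add: strong_region_def)
    qed
  qed
qed

section \<open>Global injectivity and the two conclusions\<close>

lemma convex_Quadrant: "convex Quadrant"
proof (rule convexI)
  fix x y :: "real^2" and s t :: real
  assume xy: "x \<in> Quadrant" "y \<in> Quadrant" and st: "0 \<le> s" "0 \<le> t" "s + t = 1"
  have "0 < s * a + t * b" if "0 < a" "0 < b" for a b :: real
    using convex_bound_lt[of "- a" 0 "- b" s t] that st by simp
  then show "s *\<^sub>R x + t *\<^sub>R y \<in> Quadrant" using xy by simp
qed

lemma Psi_in_Quadrant: "c \<in> Feas \<Longrightarrow> Psi c \<in> Quadrant"
  using feasible_facts(1,2)[of c 1] by (simp add: Psi_eq_flow)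

text \<open>Both parts rest on this. The hypothesis does not mention the derivative: in one part it
  follows from a nonvanishing determinant, in the other it is assumed for contradiction.\<close>

theorem locally_injective_imp_injective:
  assumes loc: "\<And>c. c \<in> Feas \<Longrightarrow> \<exists>U. open U \<and> c \<in> U \<and> inj_on Psi (U \<inter> Feas)"
  shows "connected Feas \<and> inj_on Psi Feas"
proof -
  interpret proper_local_injection Feas Quadrant Psi
    by unfold_locales (use open_Feas convex_Quadrant continuous_Psi Psi_in_Quadrant Psi_proper loc in \<open>auto simp only:\<close>)
  obtain b p where b: "b \<in> Quadrant" "0 < p" "{c \<in> Feas. Psi c = b} \<subseteq> strong_region p"
    by (rule fibre_in_strong_region)
  have "connected Feas"
    by (rule connected_dom[OF connected_strong_region strong_region_Feas[OF b(2)] b(1,3)])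
  then show ?thesis using injective by blast
qed

theorem orientation_constant:
  assumes "connected Feas" "inj_on Psi Feas" "c \<in> Feas" "c' \<in> Feas"
    and "profile_jacobian_det \<Gamma> \<alpha> \<nu> u0 e0 c > 0" "profile_jacobian_det \<Gamma> \<alpha> \<nu> u0 e0 c' < 0"
  shows False
  using injective_orientation[OF open_Feas assms(1) continuous_Psi assms(2,3) Psi_has_derivative[OF assms(3)] _
      assms(4) Psi_has_derivative[OF assms(4)]] assms(5,6)
  unfolding profile_jacobian_det_def by blast

end

theorem proposition5p1:
  fixes \<Gamma> \<alpha> \<nu> u0 e0 :: real
    and C :: "(real^2) set" and \<Psi> :: "real^2 \<Rightarrow> real^2" and \<gamma> :: "real^2 \<Rightarrow> real"
  assumes "\<Gamma> > 0" and "\<alpha> > 0" and "\<nu> > 0" and "u0 > 0" and "e0 > 0"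
  defines "C \<equiv> feasible_set \<Gamma> \<alpha> \<nu> u0 e0"
    and "\<Psi> \<equiv> cauchy_to_boundary \<Gamma> \<alpha> \<nu> u0 e0"
    and "\<gamma> \<equiv> profile_jacobian_det \<Gamma> \<alpha> \<nu> u0 e0"
  shows "((\<forall>c\<in>C. \<gamma> c \<noteq> 0) \<longrightarrow>
            (\<forall>b. b$1 > 0 \<and> b$2 > 0 \<longrightarrow> (\<exists>\<^sub>\<le>\<^sub>1 c. c \<in> C \<and> \<Psi> c = b)))
       \<and> ((\<exists>c\<in>C. \<gamma> c > 0) \<and> (\<exists>c\<in>C. \<gamma> c < 0) \<longrightarrow>
            (\<exists>c\<in>C. \<forall>U. open U \<and> c \<in> U \<longrightarrow> \<not> inj_on \<Psi> (U \<inter> C)) \<and>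
            (\<exists>b. b$1 > 0 \<and> b$2 > 0 \<and>
               (\<exists>c\<in>C. \<exists>c'\<in>C. c \<noteq> c' \<and> \<Psi> c = b \<and> \<Psi> c' = b)))"
proof -
  interpret profile_data \<Gamma> \<alpha> \<nu> u0 e0 using assms(1-5) by unfold_locales
  show ?thesis
    unfolding C_def \<Psi>_def \<gamma>_def
  proof (intro conjI impI)
    assume nz: "\<forall>c\<in>Feas. profile_jacobian_det \<Gamma> \<alpha> \<nu> u0 e0 c \<noteq> 0"
    have "\<exists>U. open U \<and> c \<in> U \<and> inj_on Psi (U \<inter> Feas)" if c: "c \<in> Feas" for c
    proof -
      obtain \<rho> where "\<rho> > 0" "inj_on Psi (ball c \<rho>)" using Psi_locally_inj[OF c] nz c by blast
      then show ?thesis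
        by (intro exI[of _ "ball c \<rho>"]) (auto intro: inj_on_subset[of Psi "ball c \<rho>"])
    qed
    then have "inj_on Psi Feas" using locally_injective_imp_injective by blast
    then show "\<forall>b. b$1 > 0 \<and> b$2 > 0 \<longrightarrow> (\<exists>\<^sub>\<le>\<^sub>1 c. c \<in> Feas \<and> Psi c = b)"
      unfolding Uniq_def inj_on_def by metis
  next
    assume sign: "(\<exists>c\<in>Feas. profile_jacobian_det \<Gamma> \<alpha> \<nu> u0 e0 c > 0) \<and>
      (\<exists>c\<in>Feas. profile_jacobian_det \<Gamma> \<alpha> \<nu> u0 e0 c < 0)"
    show "\<exists>c\<in>Feas. \<forall>U. open U \<and> c \<in> U \<longrightarrow> \<not> inj_on Psi (U \<inter> Feas)"
    \<comment> \<open>Otherwise the map is injective on a connected feasible set, and its Jacobian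
      determinant could not take both signs.\<close>
    proof (rule ccontr)
      assume "\<not> ?thesis"
      then have "\<And>c. c \<in> Feas \<Longrightarrow> \<exists>U. open U \<and> c \<in> U \<and> inj_on Psi (U \<inter> Feas)" by blast
      then show False using locally_injective_imp_injective orientation_constant sign by blast
    qed
    then obtain c where c: "\<And>U. open U \<Longrightarrow> c \<in> U \<Longrightarrow> \<not> inj_on Psi (U \<inter> Feas)" by blast
    \<comment> \<open>The whole space is itself a neighbourhood of \<open>c\<close>, so failure of
      local injectivity there contains failure of global injectivity.\<close>
    have "\<not> inj_on Psi Feas" using c[of UNIV] by simp
    then obtain c1 c2 where "c1 \<in> Feas" "c2 \<in> Feas" "c1 \<noteq> c2" "Psi c1 = Psi c2" unfolding inj_on_def by blast
    then show "\<exists>b. b$1 > 0 \<and> b$2 > 0 \<and> (\<exists>c\<in>Feas. \<exists>c'\<in>Feas. c \<noteq> c' \<and> Psi c = b \<and> Psi c' = b)"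
      using Psi_in_Quadrant[of c1] by auto
  qed
qed

end
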